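(* Let $n\in\{2,3\}$ and let $\mathbb A=(a_{kj}^{\alpha\beta})$ be a constant real tensor satisfying the symmetry and relaxed ellipticity conditions stated in the context. If $\mathbf f\in\dot{\mathbf H}_\#^{-1}$, then the anisotropic incompressible Navier-Stokes equation $$-\boldsymbol{\mathcal L}(\mathbf u,p)=\mathbf f-(\mathbf u\cdot\nabla)\mathbf u$$ on the torus $\mathbb T$ (understood in the sense of distributions) has a solution $(\mathbf u,p)\in\dot{\mathbf H}_{\#\sigma}^{1}\times\dot H_\#^{0}$.
   Context: Summation over repeated indices from $1$ to $n$ is used. Function spaces. $\mathbb T=[0,1)^n$ is the $n$-dimensional flat torus; functions and distributions on $\mathbb T$ are real-valued and identified with $1$-periodic ones on $\mathbb R^n$. $\mathcal C_\#^\infty$ is the space of $1$-periodic $C^\infty$ functions; $\mathcal D'_\#$ is its dual (periodic distributions). Fourier coefficients: $\hat g(\boldsymbol\xi)=\int_{\mathbb T}e^{-2\pi i\mathbf x\cdot\boldsymbol\xi}g(\mathbf x)\,d\mathbf x$, $\boldsymbol\xi\in\mathbb Z^n$, extended to $g\in\mathcal D'_\#$. Let $|\boldsymbol\xi|$ be the Euclidean norm and $\rho(\boldsymbol\xi)=(1+|\boldsymbol\xi|^2)^{1/2}$. For $s\in\mathbb R$, $H_\#^s$ is the space of $g\in\mathcal D'_\#$ with finite norm $\|g\|_{H_\#^s}=\big(\sum_{\boldsymbol\xi\in\mathbb Z^n}\rho(\boldsymbol\xi)^{2s}|\hat g(\boldsymbol\xi)|^2\big)^{1/2}$; $\dot H_\#^s=\{g\in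 H_\#^s:\langle g,1\rangle_{\mathbb T}=0\}$. Bold letters denote spaces of $n$-component vectors: $\mathbf H_\#^s=(H_\#^s)^n$, $\dot{\mathbf H}_\#^s=(\dot H_\#^s)^n$, and $\dot{\mathbf H}_{\#\sigma}^s=\{\mathbf w\in\dot{\mathbf H}_\#^s:\operatorname{div}\mathbf w=0\}$. Viscosity tensor. $\mathbb A=(a_{kj}^{\alpha\beta})_{1\le k,j,\alpha,\beta\le n}$ has constant real components, with symmetries $a_{kj}^{\alpha\beta}=a_{\alpha j}^{k\beta}=a_{k\beta}^{\alpha j}$, and satisfies the relaxed ellipticity condition: there is $C_{\mathbb A}>0$ such that $a_{kj}^{\alpha\beta}\zeta_{k\alpha}\zeta_{j\beta}\ge C_{\mathbb A}^{-1}|\boldsymbol\zeta|^2$ for all real $n\times n$ matrices $\boldsymbol\zeta=(\zeta_{k\alpha})$ with $\boldsymbol\zeta=\boldsymbol\zeta^\top$ and $\sum_{k=1}^n\zeta_{kk}=0$, where $|\boldsymbol\zeta|^2=\zeta_{k\alpha}\zeta_{k\alpha}$. Stokes operator. $(\boldsymbol{\mathfrak L}\mathbf u)_k=\partial_\alpha\big(a_{kj}^{\alpha\beta}E_{j\beta}(\mathbf u)\big)=\partial_\alpha\big(a_{kj}^{\alpha\beta}\partial_\beta u_j\big)$, $k=1,\dots,n$, where $E_{j\beta}(\mathbf u)=\frac12(\partial_ju_\beta+\partial_\beta u_j)$, and $\boldsymbol{\mathcal L}(\mathbf u,p)=\boldsymbol{\mathfrak L}\mathbf u-\nabla p$. 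*)

theory Defs
  imports "HOL-Analysis.Analysis"
begin

section \<open>Periodic test functions\<close>

definition partial :: "'n \<Rightarrow> (real^'n \<Rightarrow> real) \<Rightarrow> (real^'n \<Rightarrow> real)" where
  "partial i f = (\<lambda>x. frechet_derivative f (at x) (axis i 1))"

definition partials :: "'n list \<Rightarrow> (real^'n \<Rightarrow> real) \<Rightarrow> (real^'n \<Rightarrow> real)" where
  "partials ds f = foldr partial ds f"

text \<open>Since every iterated partial derivative is required to be (Frechet) differentiable, all of
  them are in particular continuous.\<close>

definition smooth :: "(real^'n \<Rightarrow> real) \<Rightarrow> bool" where
  "smooth f \<longleftrightarrow> (\<forall>ds x. partials ds f differentiable (at x))"

definition periodic :: "(real^'n \<Rightarrow> real) \<Rightarrow> bool" where
  "periodic f \<longleftrightarrow> (\<forall>x i. f (x + axis i 1) = f x)"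

definition test_functions :: "(real^'n \<Rightarrow> real) set" where
  "test_functions = {\<phi>. smooth \<phi> \<and> periodic \<phi>}"

definition test_converges ::
  "(nat \<Rightarrow> real^'n \<Rightarrow> real) \<Rightarrow> (real^'n \<Rightarrow> real) \<Rightarrow> bool" where
  "test_converges \<Phi> \<phi> \<longleftrightarrow>
     (\<forall>ds. uniform_limit UNIV (\<lambda>m. partials ds (\<Phi> m)) (partials ds \<phi>) sequentially)"


section \<open>Periodic distributions\<close>

text \<open>The values of a functional outside the test functions are irrelevant, so distributions are
  compared on test functions only. Continuity is stated with sequences, which is no restriction,
  as the topology of the space of test functions is metrizable.\<close>

type_synonym 'n dist = "(real^'n \<Rightarrow> real) \<Rightarrow> real"

definition periodic_distributions :: "('n::finite) dist set" where
  "periodic_distributions = {g.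
     (\<forall>\<phi>\<in>test_functions. \<forall>\<psi>\<in>test_functions. \<forall>a b.
        g (\<lambda>x. a * \<phi> x + b * \<psi> x) = a * g \<phi> + b * g \<psi>) \<and>
     (\<forall>\<Phi>. \<forall>\<phi>\<in>test_functions. (\<forall>m. \<Phi> m \<in> test_functions) \<longrightarrow> test_converges \<Phi> \<phi> \<longrightarrow>
        (\<lambda>m. g (\<Phi> m)) \<longlonglongrightarrow> g \<phi>)}"

definition dist_eq :: "('n::finite) dist \<Rightarrow> 'n dist \<Rightarrow> bool" (infix \<open>\<doteq>\<close> 50) where
  "g \<doteq> h \<longleftrightarrow> (\<forall>\<phi>\<in>test_functions. g \<phi> = h \<phi>)"

definition dist_deriv :: "'n \<Rightarrow> ('n::finite) dist \<Rightarrow> 'n dist" where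
  "dist_deriv i g = (\<lambda>\<phi>. - g (partial i \<phi>))"

definition torus :: "(real^'n) set" where
  "torus = {x. \<forall>i. 0 \<le> x $ i \<and> x $ i < 1}"

definition represents :: "(real^'n \<Rightarrow> real) \<Rightarrow> ('n::finite) dist \<Rightarrow> bool" where
  "represents G g \<longleftrightarrow> set_integrable lebesgue torus G \<and>
     g \<doteq> (\<lambda>\<phi>. LINT x:torus|lebesgue. G x * \<phi> x)"


section \<open>Periodic Sobolev spaces\<close>

definition lattice_vec :: "int^'n \<Rightarrow> real^'n" where
  "lattice_vec \<xi> = (\<chi> i. real_of_int (\<xi> $ i))"

text \<open>The value of \<open>g\<close> at \<open>x \<mapsto> exp (- 2 \<pi> \<i> x \<bullet> \<xi>)\<close>, with \<open>g\<close> extended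
  complex-linearly to complex-valued test functions.\<close>

definition fourier :: "('n::finite) dist \<Rightarrow> int^'n \<Rightarrow> complex" where
  "fourier g \<xi> = Complex (g (\<lambda>x. cos (2 * pi * (x \<bullet> lattice_vec \<xi>))))
                        (- g (\<lambda>x. sin (2 * pi * (x \<bullet> lattice_vec \<xi>))))"

definition rho :: "int^'n \<Rightarrow> real" where
  "rho \<xi> = sqrt (1 + (norm (lattice_vec \<xi>))\<^sup>2)"

definition sobolev :: "real \<Rightarrow> ('n::finite) dist set" where
  "sobolev s = {g \<in> periodic_distributions.
     (\<lambda>\<xi>. rho \<xi> powr (2 * s) * (cmod (fourier g \<xi>))\<^sup>2) summable_on UNIV}"

definition sobolev0 :: "real \<Rightarrow> ('n::finite) dist set" where
  "sobolev0 s = {g \<in> sobolev s. g (\<lambda>x. 1) = 0}"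

definition vsobolev0 :: "real \<Rightarrow> (('n::finite) dist ^ 'n) set" where
  "vsobolev0 s = {w. \<forall>k. w $ k \<in> sobolev0 s}"

definition divergence :: "('n::finite) dist ^ 'n \<Rightarrow> 'n dist" where
  "divergence w = (\<lambda>\<phi>. \<Sum>j\<in>UNIV. dist_deriv j (w $ j) \<phi>)"

definition vsobolev0_sigma :: "real \<Rightarrow> (('n::finite) dist ^ 'n) set" where
  "vsobolev0_sigma s = {w \<in> vsobolev0 s. divergence w \<doteq> (\<lambda>\<phi>. 0)}"


section \<open>The viscosity tensor and the Stokes operator\<close>

text \<open>The component with lower indices \<open>k, j\<close> and upper indices \<open>\<alpha>, \<beta>\<close> is
  written \<open>a k j \<alpha> \<beta>\<close>.\<close>

type_synonym 'n tensor = "'n \<Rightarrow> 'n \<Rightarrow> 'n \<Rightarrow> 'n \<Rightarrow> real"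

definition symmetric_tensor :: "'n tensor \<Rightarrow> bool" where
  "symmetric_tensor a \<longleftrightarrow>
     (\<forall>k j \<alpha> \<beta>. a k j \<alpha> \<beta> = a \<alpha> j k \<beta> \<and> a k j \<alpha> \<beta> = a k \<beta> \<alpha> j)"

definition relaxed_elliptic :: "('n::finite) tensor \<Rightarrow> bool" where
  "relaxed_elliptic a \<longleftrightarrow>
     (\<exists>C>0. \<forall>\<zeta>::real^'n^'n. transpose \<zeta> = \<zeta> \<longrightarrow> trace \<zeta> = 0 \<longrightarrow>
        (\<Sum>k\<in>UNIV. \<Sum>j\<in>UNIV. \<Sum>\<alpha>\<in>UNIV. \<Sum>\<beta>\<in>UNIV. a k j \<alpha> \<beta> * \<zeta> $ k $ \<alpha> * \<zeta> $ j $ \<beta>)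
          \<ge> inverse C * (\<Sum>k\<in>UNIV. \<Sum>\<alpha>\<in>UNIV. (\<zeta> $ k $ \<alpha>)\<^sup>2))"

definition strain :: "('n::finite) dist ^ 'n \<Rightarrow> 'n \<Rightarrow> 'n \<Rightarrow> 'n dist" where
  "strain u j \<beta> = (\<lambda>\<phi>. 1/2 * (dist_deriv j (u $ \<beta>) \<phi> + dist_deriv \<beta> (u $ j) \<phi>))"

definition viscous :: "('n::finite) tensor \<Rightarrow> 'n dist ^ 'n \<Rightarrow> 'n dist ^ 'n" where
  "viscous a u = (\<chi> k. (\<lambda>\<phi>. \<Sum>\<alpha>\<in>UNIV.
     dist_deriv \<alpha> (\<lambda>\<psi>. \<Sum>j\<in>UNIV. \<Sum>\<beta>\<in>UNIV. a k j \<alpha> \<beta> * strain u j \<beta> \<psi>) \<phi>))"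

definition stokes :: "('n::finite) tensor \<Rightarrow> 'n dist ^ 'n \<Rightarrow> 'n dist \<Rightarrow> 'n dist ^ 'n" where
  "stokes a u p = (\<chi> k. (\<lambda>\<phi>. (viscous a u $ k) \<phi> - dist_deriv k p \<phi>))"


section \<open>The Navier-Stokes equation\<close>

text \<open>The product of two distributions is taken in the sense of functions: both factors and the
  pointwise product must be given by integrable functions on the torus. As these are determined
  almost everywhere, there is at most one product, up to \<open>\<doteq>\<close>.\<close>

definition is_product :: "('n::finite) dist \<Rightarrow> 'n dist \<Rightarrow> 'n dist \<Rightarrow> bool" where
  "is_product g h q \<longleftrightarrow>
     (\<exists>G H. represents G g \<and> represents H h \<and> represents (\<lambda>x. G x * H x) q)"

text \<open>\<open>c\<close> is the vector \<open>(u \<cdot> \<nabla>) u\<close>.\<close>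

definition is_convection :: "('n::finite) dist ^ 'n \<Rightarrow> 'n dist ^ 'n \<Rightarrow> bool" where
  "is_convection u c \<longleftrightarrow> (\<exists>q :: 'n \<Rightarrow> 'n \<Rightarrow> 'n dist.
     (\<forall>j k. is_product (u $ j) (dist_deriv j (u $ k)) (q j k)) \<and>
     (\<forall>k. c $ k \<doteq> (\<lambda>\<phi>. \<Sum>j\<in>UNIV. q j k \<phi>)))"

definition navier_stokes_solution ::
  "('n::finite) tensor \<Rightarrow> 'n dist ^ 'n \<Rightarrow> 'n dist ^ 'n \<Rightarrow> 'n dist \<Rightarrow> bool" where
  "navier_stokes_solution a f u p \<longleftrightarrow>
     (\<exists>c. is_convection u c \<and>
          (\<forall>k. (\<lambda>\<phi>. - (stokes a u p $ k) \<phi>) \<doteq> (\<lambda>\<phi>. (f $ k) \<phi> - (c $ k) \<phi>)))"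

end

theory Submission
  imports Defs
begin

text \<open>The proof is a Galerkin argument carried out on Fourier coefficients. Truncating to finitely many
  frequencies turns the projected equation into a finite-dimensional system; it is solvable because
  the viscous term is coercive on solenoidal modes and the convective term does no work, so that
  Kuhn's combinatorial lemma (equivalently Brouwer's theorem) yields a zero. The energy bound in
  \<open>H\<^sup>1\<close> is uniform, hence a subsequence of the truncated solutions converges coefficientwise, and
  the convolution sums pass to the limit since their tails are uniformly small. The remaining
  residual is parallel to \<open>\<xi>\<close>, which defines the pressure; it is square-integrable because the product
  of two \<open>H\<^sup>1\<close> functions is, by \<open>\<Sum> \<rho>\<^sup>-\<^sup>4 < \<infinity>\<close> in dimension less than four. Coefficients are turned into
  functions by the Riesz-Fischer theorem, and equations between distributions reduce to equations
  between Fourier coefficients by density of the trigonometric polynomials in the test functions.\<close>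

section \<open>Zeros of coercive maps\<close>

text \<open>Two demands pull the convective term in different directions. The passage to the limit
  wants the divergence form, where the factor \<xi> stands outside the convolution and one weight
  \<open>rho\<close> makes all tails O(1/N). The definition of a solution wants the product of
  \<open>u $ j\<close> with the weak derivative of \<open>u $ k\<close>, both given by functions.
  The forms agree because \<xi> and \<eta> have the same product with
  \<open>u (\<xi> - \<eta>)\<close> when this vector is orthogonal to \<xi> - \<eta>; the same
  identity makes the convective term do no work. A second obstacle: real solenoidal families form a
  subspace cut out by linear relations, whereas the zero theorem works in coordinates. Adding to the
  equation the component orthogonal to that subspace avoids choosing a basis of it. Mean zero makes
  the frequency 0 harmless: ellipticity gives no control there, but every term of the equation
  vanishes. At all other frequencies the norm of \<xi> is at least 1, which is the Poincare
  inequality.\<close>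

lemma tendsto_coordinatewise:
  fixes f :: "'a \<Rightarrow> 'i \<Rightarrow> 'b::topological_space"
  assumes "\<And>i. ((\<lambda>x. f x i) \<longlongrightarrow> l i) F"
  shows "(f \<longlongrightarrow> l) F"
  using assms limitin_componentwise[where X = "\<lambda>_. euclidean" and I = UNIV and f = f and l = l and F = F]
  by (simp add: euclidean_product_topology)

text \<open>The cube \<open>[-R, R]^N\<close> is cut into ever finer grids, and each vertex gets one
  label per coordinate, recording the sign of \<open>F x i\<close>. Kuhn's lemma gives a cell in
  which every coordinate sees both labels, so in the limit \<open>F z i\<close> vanishes unless z
  lies on a face in direction i, where it points inwards. A nonzero inward component makes the sum
  of \<open>F z i * z i\<close> negative at a point of norm at least \<open>R\<close>, against
  coercivity.\<close>

lemma grid_labelling_zero: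
  fixes F :: "(nat \<Rightarrow> real) \<Rightarrow> nat \<Rightarrow> real"
  assumes cont: "\<And>i. i < N \<Longrightarrow> continuous_on UNIV (\<lambda>x. F x i)"
    and R: "R > 0"
    and coercive: "\<And>x. (\<forall>i\<ge>N. x i = 0) \<Longrightarrow> (\<Sum>i<N. (x i)\<^sup>2) \<ge> R\<^sup>2 \<Longrightarrow> (\<Sum>i<N. F x i * x i) \<ge> 0"
  shows "\<exists>x. (\<forall>i\<ge>N. x i = 0) \<and> (\<forall>i<N. F x i = 0)"
proof -
  define P :: "nat \<Rightarrow> (nat \<Rightarrow> nat) \<Rightarrow> nat \<Rightarrow> real" where
    "P p x = (\<lambda>i. if i < N then R * (2 * real (x i) / real p - 1) else 0)" for p x
  \<comment> \<open>The values at \<open>x i = 0\<close> and \<open>x i = p\<close> are forced by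
    the boundary conditions of Kuhn's lemma. A vertex labelled 0 has \<open>F\<close> negative or
    lies on the lower face; one labelled 1 has \<open>F\<close> nonnegative or lies on the upper
    face.\<close>
  define label :: "nat \<Rightarrow> (nat \<Rightarrow> nat) \<Rightarrow> nat \<Rightarrow> nat" where
    "label p x i = (if x i = 0 then 0 else if x i = p then 1 else if F (P p x) i < 0 then 0 else 1)"
    for p x i
  have "\<exists>q. (\<forall>i<N. q i < Suc p) \<and> (\<forall>i<N. \<exists>r s. (\<forall>j<N. q j \<le> r j \<and> r j \<le> q j + 1) \<and>
        (\<forall>j<N. q j \<le> s j \<and> s j \<le> q j + 1) \<and> label (Suc p) r i = 0 \<and> label (Suc p) s i = 1)" for p
  proof -
    obtain q where q: "\<forall>i<N. q i < Suc p"
      and "\<forall>i<N. \<exists>r s. (\<forall>j<N. q j \<le> r j \<and> r j \<le> q j + 1) \<and> (\<forall>j<N. q j \<le> s j \<and> s j \<le> q j + 1)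
            \<and> label (Suc p) r i \<noteq> label (Suc p) s i"
      by (rule kuhn_lemma[of "Suc p" N "label (Suc p)"]) (auto simp: label_def)
    moreover have "label (Suc p) r i = 0 \<or> label (Suc p) r i = 1" for r i
      by (auto simp: label_def)
    ultimately show ?thesis by metis
  qed
  then obtain q where q: "\<And>p i. i < N \<Longrightarrow> q p i < Suc p"
    and "\<forall>p. \<forall>i<N. \<exists>r s. (\<forall>j<N. q p j \<le> r j \<and> r j \<le> q p j + 1) \<and>
        (\<forall>j<N. q p j \<le> s j \<and> s j \<le> q p j + 1) \<and> label (Suc p) r i = 0 \<and> label (Suc p) s i = 1"
    by metis
  then obtain r s where
    rs: "\<And>p i j. i < N \<Longrightarrow> j < N \<Longrightarrow> q p j \<le> r p i j \<and> r p i j \<le> q p j + 1"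
        "\<And>p i j. i < N \<Longrightarrow> j < N \<Longrightarrow> q p j \<le> s p i j \<and> s p i j \<le> q p j + 1"
    and lab: "\<And>p i. i < N \<Longrightarrow> label (Suc p) (r p i) i = 0" "\<And>p i. i < N \<Longrightarrow> label (Suc p) (s p i) i = 1"
    by metis
  define Z where "Z p = P (Suc p) (q p)" for p
  have "Z p \<in> PiE UNIV (\<lambda>_. {-R..R})" for p
  proof -
    have "2 * (real (q p i) / real (Suc p)) - 1 \<in> {-1..1}" if "i < N" for i
      using q[OF that, of p] by (simp add: field_simps)
    then have "R * (2 * (real (q p i) / real (Suc p)) - 1) \<in> {R * (-1)..R * 1}" if "i < N" for i
      using that R unfolding atLeastAtMost_iff by (intro conjI mult_left_mono) auto
    then show ?thesis using R unfolding Z_def P_def by auto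
  qed
  moreover have "compact (PiE UNIV (\<lambda>_::nat. {-R..R}))"
    using compactin_PiE[where X = "\<lambda>_. euclidean" and I = UNIV and S = "\<lambda>_::nat. {-R..R}"]
    by (simp add: euclidean_product_topology)
  ultimately obtain z \<sigma> where z: "strict_mono (\<sigma> :: nat \<Rightarrow> nat)" "(Z \<circ> \<sigma>) \<longlonglongrightarrow> z"
    unfolding compact_def by metis
  have Zi: "(\<lambda>p. Z (\<sigma> p) i) \<longlonglongrightarrow> z i" for i
    using continuous_on_tendsto_compose[OF continuous_on_product_coordinates[of i] z(2)]
    by (simp add: o_def)
  have inv: "(\<lambda>p. 2 * R / real (Suc (\<sigma> p))) \<longlonglongrightarrow> 0"
    using LIMSEQ_subseq_LIMSEQ[OF LIMSEQ_Suc[OF lim_const_over_n[of "2*R"]] z(1)] by (simp add: o_def)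
  \<comment> \<open>Every vertex of a selected cell differs from its base vertex by at most one mesh
    width per coordinate, so all choices of vertices have the same limit z.\<close>
  have near: "(\<lambda>p. P (Suc (\<sigma> p)) (w (\<sigma> p))) \<longlonglongrightarrow> z"
    if w: "\<And>p j. j < N \<Longrightarrow> q p j \<le> w p j \<and> w p j \<le> q p j + 1" for w
  proof -
    have "(\<lambda>p. P (Suc (\<sigma> p)) (w (\<sigma> p)) j) \<longlonglongrightarrow> z j" for j
    proof (cases "j < N")
      case True
      have "\<bar>P (Suc p) (w p) j - Z p j\<bar> \<le> 2 * R / real (Suc p)" for p
      proof -
        have "P (Suc p) (w p) j - Z p j = 2 * R * (real (w p j) - real (q p j)) / real (Suc p)"
          using True by (simp add: P_def Z_def algebra_simps diff_divide_distrib)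
        moreover have "\<bar>real (w p j) - real (q p j)\<bar> \<le> 1" using w[OF True, of p] by auto
        ultimately show ?thesis using R
          by (simp add: abs_mult divide_right_mono mult_left_le)
      qed
      then have "(\<lambda>p. P (Suc (\<sigma> p)) (w (\<sigma> p)) j - Z (\<sigma> p) j) \<longlonglongrightarrow> 0"
        using R by (intro tendsto_0_le[OF inv, of _ 1] always_eventually allI) simp
      from tendsto_add[OF this Zi[of j]] show ?thesis by simp
    next
      case False
      then show ?thesis using Zi[of j] by (simp add: P_def Z_def)
    qed
    then show ?thesis by (rule tendsto_coordinatewise)
  qed
  have zN: "z i = 0" if "i \<ge> N" for i
    using Zi[of i] that LIMSEQ_unique[OF _ tendsto_const] by (force simp: Z_def P_def)
  have sgn: "F z i = 0 \<or> z i = -R \<and> F z i > 0 \<or> z i = R \<and> F z i < 0" if i: "i < N" for i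
  proof -
    have Fr: "(\<lambda>p. F (P (Suc (\<sigma> p)) (w (\<sigma> p))) i) \<longlonglongrightarrow> F z i"
      if "\<And>p j. j < N \<Longrightarrow> q p j \<le> w p j \<and> w p j \<le> q p j + 1" for w
      using continuous_on_tendsto_compose[OF cont[OF i] near[of w, OF that]] by simp
    have Pi: "(\<lambda>p. P (Suc (\<sigma> p)) (w (\<sigma> p)) i) \<longlonglongrightarrow> z i"
      if "\<And>p j. j < N \<Longrightarrow> q p j \<le> w p j \<and> w p j \<le> q p j + 1" for w
      using continuous_on_tendsto_compose[OF continuous_on_product_coordinates near[of w, OF that]] by simp
    have l0: "P (Suc p) (r p i) i = -R \<or> F (P (Suc p) (r p i)) i < 0" for p
    proof -
      have "r p i i = 0 \<or> F (P (Suc p) (r p i)) i < 0"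
        using lab(1)[OF i, of p] by (auto simp: label_def split: if_splits)
      then show ?thesis using i by (auto simp: P_def)
    qed
    have l1: "P (Suc p) (s p i) i = R \<or> \<not> F (P (Suc p) (s p i)) i < 0" for p
    proof -
      have "s p i i = Suc p \<or> \<not> F (P (Suc p) (s p i)) i < 0"
        using lab(2)[OF i, of p] by (auto simp: label_def split: if_splits)
      moreover have "P (Suc p) (s p i) i = R" if "s p i i = Suc p"
        unfolding P_def that using i by simp (simp add: field_simps)
      ultimately show ?thesis by blast
    qed
    \<comment> \<open>If \<open>F z i > 0\<close>, the vertices labelled 0 close to z cannot have
      \<open>F\<close> negative, so they lie on the lower face. The other sign is symmetric.\<close>
    have "z i = -R" if "F z i > 0"
    proof -
      have "eventually (\<lambda>p. F (P (Suc (\<sigma> p)) (r (\<sigma> p) i)) i > 0) sequentially"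
        using order_tendstoD(1)[OF Fr[of "\<lambda>p. r p i"] that] rs i by auto
      then have "eventually (\<lambda>p. P (Suc (\<sigma> p)) (r (\<sigma> p) i) i = -R) sequentially"
        by (rule eventually_mono)
          (use l0 in force)
      then show ?thesis
        using LIMSEQ_unique[OF Pi[of "\<lambda>p. r p i"] tendsto_eventually] rs i by blast
    qed
    moreover have "z i = R" if "F z i < 0"
    proof -
      have "eventually (\<lambda>p. F (P (Suc (\<sigma> p)) (s (\<sigma> p) i)) i < 0) sequentially"
        using order_tendstoD(2)[OF Fr[of "\<lambda>p. s p i"] that] rs i by auto
      then have "eventually (\<lambda>p. P (Suc (\<sigma> p)) (s (\<sigma> p) i) i = R) sequentially"
        by (rule eventually_mono)
          (use l1 in force)
      then show ?thesis
        using LIMSEQ_unique[OF Pi[of "\<lambda>p. s p i"] tendsto_eventually] rs i by blast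
    qed
    ultimately show ?thesis by linarith
  qed
  have "F z i = 0" if i: "i < N" for i
  proof (rule ccontr)
    assume nz: "F z i \<noteq> 0"
    have le: "F z j * z j \<le> 0" if "j < N" for j
      using sgn[OF that] R by (auto simp: mult_le_0_iff)
    have "F z i * z i < 0" using sgn[OF i] nz R by (auto simp: mult_less_0_iff)
    then have "(\<Sum>j<N. F z j * z j) < (\<Sum>j<N. 0)"
      using le i by (intro sum_strict_mono_ex1) auto
    moreover have "(z i)\<^sup>2 \<le> (\<Sum>j<N. (z j)\<^sup>2)"
      using i by (intro member_le_sum) auto
    moreover have "(z i)\<^sup>2 = R\<^sup>2" using sgn[OF i] nz by auto
    ultimately show False using coercive[of z] zN by auto
  qed
  then show ?thesis using zN by blast
qed

text \<open>The coordinates are the pairs of an index in \<open>I\<close> and a basis vector,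
  enumerated by \<open>h\<close>. Under this enumeration the squared norm and the sum of
  \<open>F x i \<bullet> x i\<close> become plain coordinate sums, so the statement reduces to the
  one on real sequences.\<close>

lemma coercive_zero:
  fixes F :: "('i \<Rightarrow> 'v::euclidean_space) \<Rightarrow> 'i \<Rightarrow> 'v"
  assumes I: "finite I"
    and cont: "\<And>i. i \<in> I \<Longrightarrow> continuous_on UNIV (\<lambda>x. F x i)"
    and R: "R > 0"
    and coercive: "\<And>x. (\<forall>i. i \<notin> I \<longrightarrow> x i = 0) \<Longrightarrow> (\<Sum>i\<in>I. (norm (x i))\<^sup>2) \<ge> R\<^sup>2 \<Longrightarrow>
      (\<Sum>i\<in>I. F x i \<bullet> x i) \<ge> 0"
  shows "\<exists>x. (\<forall>i. i \<notin> I \<longrightarrow> x i = 0) \<and> (\<forall>i\<in>I. F x i = 0)"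
proof -
  define J where "J = I \<times> (Basis :: 'v set)"
  define N where "N = card J"
  have "finite J" using I by (simp add: J_def)
  then obtain h where h: "bij_betw h {..<N} J"
    unfolding N_def using ex_bij_betw_nat_finite[of J] by (auto simp: atLeast0LessThan)
  define g where "g = the_inv_into {..<N} h"
  have hg: "h (g k) = k" "g k < N" if "k \<in> J" for k
    using that f_the_inv_into_f_bij_betw[OF h] bij_betwE[OF bij_betw_the_inv_into[OF h]]
    by (auto simp: g_def)
  have gh: "g (h m) = m" "h m \<in> J" if "m < N" for m
    using h that unfolding g_def by (auto simp: bij_betw_def the_inv_into_f_f)
  define X :: "(nat \<Rightarrow> real) \<Rightarrow> 'i \<Rightarrow> 'v" where
    "X z i = (if i \<in> I then \<Sum>b\<in>Basis. z (g (i, b)) *\<^sub>R b else 0)" for z i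
  have X_inner: "X z (fst (h m)) \<bullet> snd (h m) = z m" if "m < N" for z m
    using gh[OF that] by (auto simp: X_def J_def inner_sum_left inner_Basis if_distrib sum.delta cong: if_cong)
  define G where "G z m = F (X z) (fst (h m)) \<bullet> snd (h m)" for z m
  have contX: "continuous_on UNIV X"
  proof (rule continuous_on_coordinatewise_then_product)
    fix i show "continuous_on UNIV (\<lambda>z. X z i)"
      by (cases "i \<in> I") (auto simp: X_def intro!: continuous_intros)
  qed
  have reindex: "(\<Sum>m<N. f (h m)) = (\<Sum>i\<in>I. \<Sum>b\<in>Basis. f (i, b))" for f :: "_ \<Rightarrow> real"
    using sum.reindex_bij_betw[OF h, of f] by (simp add: J_def sum.cartesian_product)
  have Xsum: "(\<Sum>m<N. f (X z) (fst (h m)) (snd (h m)) * z m) = (\<Sum>i\<in>I. \<Sum>b\<in>Basis. f (X z) i b * (X z i \<bullet> b))"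
    for f :: "_ \<Rightarrow> _ \<Rightarrow> _ \<Rightarrow> real" and z
    using reindex[of "\<lambda>k. f (X z) (fst k) (snd k) * (X z (fst k) \<bullet> snd k)"] by (simp add: X_inner)
  have "\<exists>z. (\<forall>m\<ge>N. z m = 0) \<and> (\<forall>m<N. G z m = 0)"
  proof (rule grid_labelling_zero[OF _ R])
    fix m assume m: "m < N"
    then have "fst (h m) \<in> I" using gh[OF m] by (auto simp: J_def)
    from continuous_on_compose2[OF cont[OF this] contX]
    show "continuous_on UNIV (\<lambda>z. G z m)" unfolding G_def by (intro continuous_intros) auto
  next
    fix z assume "R\<^sup>2 \<le> (\<Sum>m<N. (z m)\<^sup>2)"
    also have "(\<Sum>m<N. (z m)\<^sup>2) = (\<Sum>i\<in>I. (norm (X z i))\<^sup>2)"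
      using Xsum[of "\<lambda>x i b. x i \<bullet> b" z]
      by (simp add: X_inner power2_eq_square euclidean_inner[symmetric] dot_square_norm)
    finally have "0 \<le> (\<Sum>i\<in>I. F (X z) i \<bullet> X z i)" by (intro coercive) (auto simp: X_def)
    also have "\<dots> = (\<Sum>m<N. G z m * z m)"
      using Xsum[of "\<lambda>x i b. F x i \<bullet> b" z] by (simp add: G_def euclidean_inner[symmetric])
    finally show "0 \<le> (\<Sum>m<N. G z m * z m)" .
  qed
  then obtain z where z: "\<And>m. m < N \<Longrightarrow> G z m = 0" by blast
  have "F (X z) i = 0" if "i \<in> I" for i
  proof (rule euclidean_eqI)
    fix b :: 'v assume "b \<in> Basis"
    then have "(i, b) \<in> J" using that by (simp add: J_def)
    from z[OF hg(2)[OF this]] hg(1)[OF this] show "F (X z) i \<bullet> b = 0 \<bullet> b" by (simp add: G_def)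
  qed
  moreover have "X z i = 0" if "i \<notin> I" for i using that by (simp add: X_def)
  ultimately show ?thesis by blast
qed

section \<open>Weighted square-summable families on the lattice\<close>

lemma infsum_Cauchy_Schwarz:
  fixes a b :: "'i \<Rightarrow> 'a::{real_normed_div_algebra,banach,second_countable_topology}"
  assumes a: "(\<lambda>i. (norm (a i))\<^sup>2) summable_on A" and b: "(\<lambda>i. (norm (b i))\<^sup>2) summable_on A"
  shows abs_summable_on_mult_l2: "(\<lambda>i. norm (a i * b i)) summable_on A"
    and infsum_norm_mult_le: "(\<Sum>\<^sub>\<infinity>i\<in>A. norm (a i * b i))\<^sup>2 \<le>
      (\<Sum>\<^sub>\<infinity>i\<in>A. (norm (a i))\<^sup>2) * (\<Sum>\<^sub>\<infinity>i\<in>A. (norm (b i))\<^sup>2)"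
proof -
  show *: "(\<lambda>i. norm (a i * b i)) summable_on A"
    by (rule Infinite_Sum.abs_summable_product) (use a b in \<open>simp_all add: norm_mult power2_eq_square\<close>)
  define X where "X = (\<Sum>\<^sub>\<infinity>i\<in>A. (norm (a i))\<^sup>2) * (\<Sum>\<^sub>\<infinity>i\<in>A. (norm (b i))\<^sup>2)"
  have "(\<Sum>\<^sub>\<infinity>i\<in>A. norm (a i * b i)) \<le> sqrt X"
  proof (rule infsum_le_finite_sums[OF *])
    fix F assume F: "finite F" "F \<subseteq> A"
    have "(\<Sum>i\<in>F. norm (a i * b i))\<^sup>2 \<le> (\<Sum>i\<in>F. (norm (a i))\<^sup>2) * (\<Sum>i\<in>F. (norm (b i))\<^sup>2)"
      using Cauchy_Schwarz_ineq_sum[of "\<lambda>i. norm (a i)"] by (simp add: norm_mult)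
    also have "\<dots> \<le> X" unfolding X_def
      using F a b by (intro mult_mono finite_sum_le_infsum) (auto intro: sum_nonneg infsum_nonneg)
    finally show "(\<Sum>i\<in>F. norm (a i * b i)) \<le> sqrt X"
      by (rule real_le_rsqrt)
  qed
  then have "(\<Sum>\<^sub>\<infinity>i\<in>A. norm (a i * b i))\<^sup>2 \<le> (sqrt X)\<^sup>2"
    by (intro power_mono infsum_nonneg) auto
  also have "(sqrt X)\<^sup>2 = X" by (simp add: X_def infsum_nonneg)
  finally show "(\<Sum>\<^sub>\<infinity>i\<in>A. norm (a i * b i))\<^sup>2 \<le>
      (\<Sum>\<^sub>\<infinity>i\<in>A. (norm (a i))\<^sup>2) * (\<Sum>\<^sub>\<infinity>i\<in>A. (norm (b i))\<^sup>2)" by (simp add: X_def)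
qed

section \<open>Integer frequencies, the weight \<open>rho\<close>, and boxes exhausting the
  lattice\<close>

lemma lattice_vec_nth [simp]: "lattice_vec \<xi> $ i = real_of_int (\<xi> $ i)"
  by (simp add: lattice_vec_def)

lemma lattice_vec_add: "lattice_vec (\<xi> + \<eta>) = lattice_vec \<xi> + lattice_vec \<eta>"
  and lattice_vec_diff: "lattice_vec (\<xi> - \<eta>) = lattice_vec \<xi> - lattice_vec \<eta>"
  and lattice_vec_minus [simp]: "lattice_vec (- \<xi>) = - lattice_vec \<xi>"
  and lattice_vec_0 [simp]: "lattice_vec 0 = 0"
  by (simp_all add: vec_eq_iff)

lemma rho_squared: "(rho \<xi>)\<^sup>2 = 1 + (norm (lattice_vec \<xi>))\<^sup>2"
  by (simp add: rho_def add_nonneg_nonneg)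

lemma rho_ge_1: "rho \<xi> \<ge> 1" and rho_pos [simp]: "rho \<xi> > 0"
proof -
  show "rho \<xi> \<ge> 1" by (simp add: rho_def)
  then show "rho \<xi> > 0" by linarith
qed

lemma norm_lattice_vec_ge_1: "\<xi> \<noteq> 0 \<Longrightarrow> norm (lattice_vec \<xi>) \<ge> 1"
proof -
  assume "\<xi> \<noteq> 0"
  then obtain i where "\<xi> $ i \<noteq> 0" by (auto simp: vec_eq_iff)
  then have "1 \<le> \<bar>lattice_vec \<xi> $ i\<bar>" by (simp flip: of_int_abs)
  also have "\<dots> \<le> norm (lattice_vec \<xi>)" by (rule component_le_norm_cart)
  finally show ?thesis .
qed

text \<open>Boxes serve as exhausting sets because they are finite, increasing and invariant under
  negation; the last property keeps truncated Fourier sums real.\<close>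

definition lattice_box :: "nat \<Rightarrow> (int^'n) set" where
  "lattice_box N = {\<xi>. \<forall>i. \<bar>\<xi> $ i\<bar> \<le> int N}"

lemma finite_lattice_box [simp]: "finite (lattice_box N :: (int^'n::finite) set)"
proof -
  have "vec_nth ` (lattice_box N :: (int^'n) set) \<subseteq> PiE UNIV (\<lambda>_. {- int N..int N})"
    by (auto simp: lattice_box_def abs_le_iff minus_le_iff)
  then have "finite (vec_nth ` (lattice_box N :: (int^'n) set))"
    by (rule finite_subset) (intro finite_PiE, auto)
  then show ?thesis by (rule finite_imageD) (simp add: inj_on_def vec_nth_inject)
qed

lemma lattice_box_minus [simp]: "- \<xi> \<in> lattice_box N \<longleftrightarrow> \<xi> \<in> lattice_box N"
  by (simp add: lattice_box_def)

lemma lattice_box_mono: "M \<le> N \<Longrightarrow> lattice_box M \<subseteq> lattice_box N"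
  unfolding lattice_box_def by (auto intro: order_trans)

lemma finite_subset_lattice_box:
  assumes "finite (F :: (int^'n::finite) set)" shows "\<exists>N. F \<subseteq> lattice_box N"
  using assms
proof induction
  case (insert \<xi> F)
  then obtain N where "F \<subseteq> lattice_box N" by blast
  moreover have "\<xi> \<in> lattice_box (\<Sum>i\<in>UNIV. nat \<bar>\<xi> $ i\<bar>)"
  proof -
    have "nat \<bar>\<xi> $ i\<bar> \<le> (\<Sum>i\<in>UNIV. nat \<bar>\<xi> $ i\<bar>)" for i by (rule member_le_sum) auto
    then have "int (nat \<bar>\<xi> $ i\<bar>) \<le> int (\<Sum>i\<in>UNIV. nat \<bar>\<xi> $ i\<bar>)" for i
      by (simp only: of_nat_le_iff)
    then show ?thesis by (simp add: lattice_box_def)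
  qed
  ultimately have "insert \<xi> F \<subseteq> lattice_box (max N (\<Sum>i\<in>UNIV. nat \<bar>\<xi> $ i\<bar>))"
    using lattice_box_mono[of N "max N (\<Sum>i\<in>UNIV. nat \<bar>\<xi> $ i\<bar>)"]
      lattice_box_mono[of "\<Sum>i\<in>UNIV. nat \<bar>\<xi> $ i\<bar>" "max N (\<Sum>i\<in>UNIV. nat \<bar>\<xi> $ i\<bar>)"] by auto
  then show ?case by blast
qed simp

lemma rho_ge_if_notin_lattice_box:
  assumes "\<xi> \<notin> lattice_box N" shows "rho \<xi> \<ge> real N"
proof -
  obtain i where "\<bar>\<xi> $ i\<bar> > int N" using assms by (auto simp: lattice_box_def not_le)
  then have "real N \<le> \<bar>lattice_vec \<xi> $ i\<bar>" by simp
  also have "\<dots> \<le> norm (lattice_vec \<xi>)" by (rule component_le_norm_cart)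
  also have "\<dots> \<le> rho \<xi>" unfolding rho_def by (rule real_le_rsqrt) simp
  finally show ?thesis .
qed

text \<open>Links unordered sums to limits of sequences: along boxes, the finite sums of a summable
  family converge to its \<open>infsum\<close>.\<close>

lemma filterlim_lattice_box: "filterlim lattice_box (finite_subsets_at_top UNIV) sequentially"
  unfolding filterlim_finite_subsets_at_top
proof (intro allI impI)
  fix X :: "(int^'a) set" assume "finite X \<and> X \<subseteq> UNIV"
  then obtain N where "X \<subseteq> lattice_box N" using finite_subset_lattice_box by blast
  then show "\<forall>\<^sub>F m in sequentially. finite (lattice_box m) \<and> X \<subseteq> lattice_box m \<and> lattice_box m \<subseteq> UNIV"
    by (intro eventually_mono[OF eventually_ge_at_top[of N]]) (use lattice_box_mono in force)
qed

lemma bij_diff_left: "bij (\<lambda>\<eta>. \<xi> - \<eta> :: 'a::ab_group_add)"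
  by (rule bij_betw_byWitness[where f' = "\<lambda>\<eta>. \<xi> - \<eta>"]) auto

lemma summable_on_diff_left:
  "(\<lambda>\<eta>. f (\<xi> - \<eta> :: 'a::ab_group_add)) summable_on UNIV \<longleftrightarrow> f summable_on UNIV"
  using summable_on_reindex_bij_betw[OF bij_diff_left] .

lemma infsum_diff_left:
  "(\<Sum>\<^sub>\<infinity>\<eta>. f (\<xi> - \<eta> :: 'a::ab_group_add)) = (\<Sum>\<^sub>\<infinity>\<eta>. f \<eta>)"
  using infsum_reindex_bij_betw[OF bij_diff_left] .

section \<open>Summability of the inverse fourth power of the weight\<close>

lemma sum_int_powr_bounded:
  assumes s: "s > (1::real)"
  shows "\<exists>S. \<forall>N. (\<Sum>m\<in>{- int N..int N}. (1 + (real_of_int m)\<^sup>2) powr (- (s / 2))) \<le> S"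
proof -
  define g where "g m = (1 + (real_of_int m)\<^sup>2) powr (- (s / 2))" for m :: int
  have sm: "summable (\<lambda>m. real m powr (-s))" using s by (simp add: summable_real_powr_iff)
  have g_le: "g (int m) \<le> real m powr (-s)" if "m > 0" for m
  proof -
    have "g (int m) \<le> ((real m)\<^sup>2) powr (- (s / 2))" unfolding g_def
      using s that by (intro powr_mono2') auto
    also have "(real m)\<^sup>2 = real m powr 2" using that by simp
    also have "\<dots> powr (- (s / 2)) = real m powr (-s)" by (simp only: powr_powr) simp
    finally show ?thesis .
  qed
  define S where "S = (\<Sum>m. real m powr (-s))"
  have part: "(\<Sum>m\<in>{1..N}. g (int m)) \<le> S" for N
  proof -
    have "(\<Sum>m\<in>{1..N}. g (int m)) \<le> (\<Sum>m\<in>{1..N}. real m powr (-s))"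
      by (intro sum_mono g_le) auto
    also have "\<dots> \<le> S" unfolding S_def by (rule sum_le_suminf[OF sm]) auto
    finally show ?thesis .
  qed
  have "(\<Sum>m\<in>{- int N..int N}. g m) = g 0 + 2 * (\<Sum>m\<in>{1..N}. g (int m))" for N
  proof (induction N)
    case (Suc N)
    have "{- int (Suc N)..int (Suc N)} = insert (int (Suc N)) (insert (- int (Suc N)) {- int N..int N})"
      by auto
    moreover have "(- 1 - real N)\<^sup>2 = (1 + real N)\<^sup>2" by (simp add: power2_eq_square algebra_simps)
    ultimately show ?case using Suc by (simp add: g_def)
  qed simp
  then show ?thesis using part unfolding g_def by (intro exI[of _ "g 0 + 2 * S"]) (simp add: g_def)
qed

text \<open>This is where the restriction on the dimension enters.\<close>

lemma summable_rho_minus_4: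
  assumes "CARD('n::finite) < 4"
  shows "(\<lambda>\<xi>::int^'n. 1 / rho \<xi> ^ 4) summable_on UNIV"
proof -
  \<comment> \<open>The exponent is chosen so that \<open>rho^(-4)\<close> is the product of one
    factor \<open>rho^(-s)\<close> per coordinate. Each factor is at most
    \<open>(1 + (\<xi> $ i)^2)^(-s/2)\<close>, so sums over boxes are bounded by products of
    one-dimensional sums, which are bounded because s > 1, that is, because the dimension is less
    than 4.\<close>
  define s where "s = 4 / real CARD('n)"
  define g where "g m = (1 + (real_of_int m)\<^sup>2) powr (- (s / 2))" for m :: int
  have "s > 1" using assms by (simp add: s_def zero_less_card_finite)
  then obtain S where S: "\<And>N. (\<Sum>m\<in>{- int N..int N}. g m) \<le> S"
    using sum_int_powr_bounded unfolding g_def by blast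
  have le: "1 / rho \<xi> ^ 4 \<le> (\<Prod>i\<in>UNIV. g (\<xi> $ i))" for \<xi> :: "int^'n"
  proof -
    have "1 / rho \<xi> ^ 4 = ((rho \<xi>)\<^sup>2) powr (-2)"
      by (simp add: powr_minus_divide flip: power_mult)
    also have "\<dots> = (((rho \<xi>)\<^sup>2) powr (- (s / 2))) powr (real CARD('n))"
      by (simp add: s_def powr_powr)
    also have "\<dots> = (\<Prod>i\<in>(UNIV::'n set). ((rho \<xi>)\<^sup>2) powr (- (s / 2)))"
      using rho_pos[of \<xi>] powr_realpow[of "((rho \<xi>)\<^sup>2) powr (- (s / 2))" "CARD('n)"]
      by (simp del: rho_pos)
    also have "\<dots> \<le> (\<Prod>i\<in>UNIV. g (\<xi> $ i))"
    proof (rule prod_mono, intro conjI)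
      fix i
      have "(real_of_int (\<xi> $ i))\<^sup>2 \<le> (norm (lattice_vec \<xi>))\<^sup>2"
        using component_le_norm_cart[of "lattice_vec \<xi>" i] by (simp add: abs_le_square_iff flip: abs_le_square_iff)
      then show "((rho \<xi>)\<^sup>2) powr (- (s / 2)) \<le> g (\<xi> $ i)"
        unfolding g_def rho_squared using \<open>s > 1\<close> by (intro powr_mono2') (auto intro: add_pos_nonneg)
    qed simp
    finally show ?thesis .
  qed
  show ?thesis
  proof (rule nonneg_bdd_above_summable_on)
    show "bdd_above (sum (\<lambda>\<xi>::int^'n. 1 / rho \<xi> ^ 4) ` {F. F \<subseteq> UNIV \<and> finite F})"
    proof (rule bdd_aboveI2, safe)
      fix F :: "(int^'n) set" assume "finite F"
      then obtain N where N: "F \<subseteq> lattice_box N" using finite_subset_lattice_box by blast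
      have "(\<Sum>\<xi>\<in>F. 1 / rho \<xi> ^ 4) \<le> (\<Sum>\<xi>\<in>F. \<Prod>i\<in>UNIV. g (\<xi> $ i))"
        by (intro sum_mono le)
      also have "\<dots> = (\<Sum>x\<in>vec_nth ` F. \<Prod>i\<in>UNIV. g (x i))"
        by (simp add: sum.reindex inj_on_def vec_nth_inject)
      also have "\<dots> \<le> (\<Sum>x\<in>PiE (UNIV::'n set) (\<lambda>_. {- int N..int N}). \<Prod>i\<in>UNIV. g (x i))"
        using N by (intro sum_mono2 finite_PiE)
          (auto simp: g_def lattice_box_def abs_le_iff minus_le_iff subset_iff intro!: prod_nonneg)
      also have "\<dots> = (\<Prod>i\<in>(UNIV::'n set). \<Sum>m\<in>{- int N..int N}. g m)"
        by (subst prod_sum_PiE) auto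
      also have "\<dots> \<le> (\<Prod>i\<in>(UNIV::'n set). S)"
        using S by (intro prod_mono) (auto simp: g_def intro!: sum_nonneg)
      finally show "(\<Sum>\<xi>\<in>F. 1 / rho \<xi> ^ 4) \<le> S ^ CARD('n)" by simp
    qed
  qed (simp add: less_imp_le)
qed

section \<open>Convolutions of weighted square-summable families\<close>

definition convolution :: "('a::ab_group_add \<Rightarrow> complex) \<Rightarrow> ('a \<Rightarrow> complex) \<Rightarrow> 'a \<Rightarrow> complex" where
  "convolution a b \<xi> = (\<Sum>\<^sub>\<infinity>\<eta>. a (\<xi> - \<eta>) * b \<eta>)"

lemma abs_summable_convolution:
  fixes a b :: "'a::ab_group_add \<Rightarrow> complex"
  assumes "(\<lambda>\<eta>. (cmod (a \<eta>))\<^sup>2) summable_on UNIV" and "(\<lambda>\<eta>. (cmod (b \<eta>))\<^sup>2) summable_on UNIV"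
  shows "(\<lambda>\<eta>. norm (a (\<xi> - \<eta>) * b \<eta>)) summable_on UNIV"
  using assms by (intro abs_summable_on_mult_l2) (simp_all add: summable_on_diff_left[of "\<lambda>\<eta>. (cmod (a \<eta>))\<^sup>2"])

lemma summable_l2_of_weighted:
  fixes a :: "int^'n::finite \<Rightarrow> 'a::real_normed_vector"
  assumes "(\<lambda>\<eta>. (rho \<eta> * norm (a \<eta>))\<^sup>2) summable_on UNIV"
  shows "(\<lambda>\<eta>. (norm (a \<eta>))\<^sup>2) summable_on UNIV"
proof (rule summable_on_comparison_test[OF assms])
  fix \<eta>
  have "norm (a \<eta>) \<le> rho \<eta> * norm (a \<eta>)" using mult_right_mono[OF rho_ge_1, of "norm (a \<eta>)" \<eta>] by simp
  then show "(norm (a \<eta>))\<^sup>2 \<le> (rho \<eta> * norm (a \<eta>))\<^sup>2" by (intro power_mono) auto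
qed simp

lemma summable_on_times_nonneg:
  fixes f :: "'a \<Rightarrow> real" and g :: "'b \<Rightarrow> real"
  assumes f: "f summable_on UNIV" "\<And>x. f x \<ge> 0" and g: "g summable_on UNIV" "\<And>x. g x \<ge> 0"
  shows "(\<lambda>(x, y). f x * g y) summable_on UNIV"
proof -
  have "(\<lambda>p. norm ((\<lambda>(x, y). f x * g y) p)) summable_on (Sigma UNIV (\<lambda>_. UNIV))"
    unfolding Infinite_Sum.abs_summable_on_Sigma_iff
    using f g by (auto simp: abs_mult infsum_cmult_right' infsum_nonneg
        intro!: summable_on_cmult_right summable_on_cmult_left)
  then show ?thesis by (simp add: case_prod_unfold f g)
qed

text \<open>The Fourier form of the product estimate from \<open>H^1\<close> times
  \<open>H^1\<close> to \<open>L^2\<close>. Splitting the summand as \<open>w * v\<close> with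
  \<open>w = 1 / (rho (\<xi> - \<eta>) * rho \<eta>)\<close>, Cauchy-Schwarz separates a factor
  bounded uniformly in \<xi> by the sum of \<open>1 / rho ^ 4\<close> from a factor whose sum over
  all \<xi> is the product of the two weighted sums.\<close>

lemma convolution_l2:
  fixes a b :: "int^'n::finite \<Rightarrow> complex"
  assumes n: "CARD('n) < 4"
    and a: "(\<lambda>\<eta>. (rho \<eta> * cmod (a \<eta>))\<^sup>2) summable_on UNIV"
    and b: "(\<lambda>\<eta>. (rho \<eta> * cmod (b \<eta>))\<^sup>2) summable_on UNIV"
  shows "(\<lambda>\<xi>. (cmod (convolution a b \<xi>))\<^sup>2) summable_on UNIV"
proof -
  define A where "A \<eta> = (rho \<eta> * cmod (a \<eta>))\<^sup>2" for \<eta>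
  define B where "B \<eta> = (rho \<eta> * cmod (b \<eta>))\<^sup>2" for \<eta>
  define K where "K = (\<Sum>\<^sub>\<infinity>\<eta>::int^'n. 1 / rho \<eta> ^ 4)"
  have "(\<lambda>(x, y). A x * B y) summable_on UNIV"
    using a b by (intro summable_on_times_nonneg) (auto simp: A_def B_def)
  \<comment> \<open>This shear turns the summable product family into the double family of squared
    convolution terms.\<close>
  moreover have "bij (\<lambda>(\<xi>, \<eta>). (\<xi> - \<eta>, \<eta>) :: (int^'n) \<times> (int^'n))"
    by (rule bij_betw_byWitness[where f' = "\<lambda>(\<xi>, \<eta>). (\<xi> + \<eta>, \<eta>)"]) auto
  ultimately have AB: "(\<lambda>(\<xi>, \<eta>). A (\<xi> - \<eta>) * B \<eta>) summable_on Sigma UNIV (\<lambda>_. UNIV)"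
    using summable_on_reindex_bij_betw[of "\<lambda>(\<xi>, \<eta>). (\<xi> - \<eta>, \<eta>)" UNIV UNIV "\<lambda>(x, y). A x * B y"]
    by (simp add: case_prod_unfold)
  have ABxi: "(\<lambda>\<eta>. A (\<xi> - \<eta>) * B \<eta>) summable_on UNIV" for \<xi>
  proof -
    have "(\<lambda>p. norm ((\<lambda>(\<xi>, \<eta>). A (\<xi> - \<eta>) * B \<eta>) p)) summable_on Sigma UNIV (\<lambda>_. UNIV)"
      using AB by (simp add: case_prod_unfold A_def B_def)
    then show ?thesis unfolding Infinite_Sum.abs_summable_on_Sigma_iff by (auto simp: A_def B_def)
  qed
  have "(\<lambda>\<xi>. (\<Sum>\<^sub>\<infinity>\<eta>. A (\<xi> - \<eta>) * B \<eta>)) summable_on UNIV"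
    using summable_on_Sigma_banach[OF AB] by simp
  then have "(\<lambda>\<xi>. K * (\<Sum>\<^sub>\<infinity>\<eta>. A (\<xi> - \<eta>) * B \<eta>)) summable_on UNIV"
    by (rule summable_on_cmult_right)
  then show ?thesis
  proof (rule summable_on_comparison_test)
    fix \<xi> :: "int^'n"
    define w where "w \<eta> = 1 / (rho (\<xi> - \<eta>) * rho \<eta>)" for \<eta>
    define v where "v \<eta> = rho (\<xi> - \<eta>) * cmod (a (\<xi> - \<eta>)) * (rho \<eta> * cmod (b \<eta>))" for \<eta>
    have r4: "(\<lambda>\<eta>::int^'n. 1 / rho \<eta> ^ 4) summable_on UNIV" by (rule summable_rho_minus_4[OF n])
    then have r4': "(\<lambda>\<eta>. 1 / rho (\<xi> - \<eta>) ^ 4) summable_on UNIV"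
      by (simp add: summable_on_diff_left[of "\<lambda>\<eta>. 1 / rho \<eta> ^ 4"])
    have rr: "(\<lambda>\<eta>. 1/2 * (1 / rho (\<xi> - \<eta>) ^ 4 + 1 / rho \<eta> ^ 4)) summable_on UNIV"
      using r4 r4' by (intro summable_on_cmult_right summable_on_add)
    \<comment> \<open>Arithmetic-geometric mean. Of the two resulting sums one is the sum of
      \<open>1 / rho ^ 4\<close> itself and the other a reflected translate of it, so the bound
      \<open>K\<close> does not depend on \<xi>.\<close>
    have w_le: "(norm (w \<eta>))\<^sup>2 \<le> 1/2 * (1 / rho (\<xi> - \<eta>) ^ 4 + 1 / rho \<eta> ^ 4)" for \<eta>
      using sum_squares_bound[of "(1 / rho (\<xi> - \<eta>))\<^sup>2" "(1 / rho \<eta>)\<^sup>2"]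
      by (simp add: w_def power_mult_distrib power_divide)
    have w: "(\<lambda>\<eta>. (norm (w \<eta>))\<^sup>2) summable_on UNIV"
      by (rule summable_on_comparison_test[OF rr w_le]) simp
    have "(\<Sum>\<^sub>\<infinity>\<eta>. (norm (w \<eta>))\<^sup>2) \<le> (\<Sum>\<^sub>\<infinity>\<eta>. 1/2 * (1 / rho (\<xi> - \<eta>) ^ 4 + 1 / rho \<eta> ^ 4))"
      by (intro infsum_mono w rr w_le)
    also have "\<dots> = 1/2 * (K + K)"
      unfolding infsum_cmult_right' infsum_add[OF r4' r4] K_def
      by (simp add: infsum_diff_left[of "\<lambda>\<eta>. 1 / rho \<eta> ^ 4"])
    finally have wK: "(\<Sum>\<^sub>\<infinity>\<eta>. (norm (w \<eta>))\<^sup>2) \<le> K" by simp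
    have v2: "(norm (v \<eta>))\<^sup>2 = A (\<xi> - \<eta>) * B \<eta>" for \<eta>
      by (simp add: v_def A_def B_def power_mult_distrib)
    have v: "(\<lambda>\<eta>. (norm (v \<eta>))\<^sup>2) summable_on UNIV" unfolding v2 by (rule ABxi)
    have wv: "norm (w \<eta> * v \<eta>) = norm (a (\<xi> - \<eta>) * b \<eta>)" for \<eta>
      using rho_pos[of "\<xi> - \<eta>"] rho_pos[of \<eta>] by (simp add: w_def v_def norm_mult abs_mult del: rho_pos)
    have "cmod (convolution a b \<xi>) \<le> (\<Sum>\<^sub>\<infinity>\<eta>. norm (w \<eta> * v \<eta>))"
      unfolding convolution_def wv
      by (intro norm_infsum_bound abs_summable_convolution summable_l2_of_weighted a b)
    then have "(cmod (convolution a b \<xi>))\<^sup>2 \<le> (\<Sum>\<^sub>\<infinity>\<eta>. norm (w \<eta> * v \<eta>))\<^sup>2"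
      by (intro power_mono) auto
    also have "\<dots> \<le> (\<Sum>\<^sub>\<infinity>\<eta>. (norm (w \<eta>))\<^sup>2) * (\<Sum>\<^sub>\<infinity>\<eta>. (norm (v \<eta>))\<^sup>2)"
      by (rule infsum_norm_mult_le[OF w v])
    also have "\<dots> \<le> K * (\<Sum>\<^sub>\<infinity>\<eta>. A (\<xi> - \<eta>) * B \<eta>)"
      unfolding v2 using wK by (intro mult_right_mono infsum_nonneg) (auto simp: A_def B_def)
    finally show "(cmod (convolution a b \<xi>))\<^sup>2 \<le> K * (\<Sum>\<^sub>\<infinity>\<eta>. A (\<xi> - \<eta>) * B \<eta>)" .
  qed simp
qed

lemma weighted_l2_limit:
  fixes a :: "nat \<Rightarrow> int^'n::finite \<Rightarrow> 'a::real_normed_vector"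
  assumes bound: "\<And>m F. finite F \<Longrightarrow> (\<Sum>\<eta>\<in>F. (rho \<eta> * norm (a m \<eta>))\<^sup>2) \<le> M"
    and lim: "\<And>\<eta>. (\<lambda>m. a m \<eta>) \<longlonglongrightarrow> l \<eta>"
    and F: "finite F"
  shows "(\<Sum>\<eta>\<in>F. (rho \<eta> * norm (l \<eta>))\<^sup>2) \<le> M"
proof (rule tendsto_upperbound)
  show "(\<lambda>m. \<Sum>\<eta>\<in>F. (rho \<eta> * norm (a m \<eta>))\<^sup>2) \<longlonglongrightarrow> (\<Sum>\<eta>\<in>F. (rho \<eta> * norm (l \<eta>))\<^sup>2)"
    by (intro tendsto_intros lim)
qed (use bound F in auto)

lemma summable_on_if_bounded:
  fixes f :: "'a \<Rightarrow> real"
  assumes "\<And>F. finite F \<Longrightarrow> sum f F \<le> M" "\<And>x. f x \<ge> 0"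
  shows "f summable_on UNIV" "infsum f UNIV \<le> M"
proof -
  show "f summable_on UNIV"
    using assms by (intro nonneg_bdd_above_summable_on) (auto intro!: bdd_aboveI2[where M = M])
  then show "infsum f UNIV \<le> M" using assms by (intro infsum_le_finite_sums)
qed

text \<open>Outside the box \<open>rho \<eta> \<ge> N\<close>, so the weight carried by
  \<open>b\<close> yields the factor \<open>1 / N\<close>, and Cauchy-Schwarz bounds what is left by
  \<open>M\<close>. The rate depends on \<open>a\<close> and \<open>b\<close> only through
  \<open>M\<close>; this uniformity takes the place of a compact embedding.\<close>

lemma convolution_tail:
  fixes a b :: "int^'n::finite \<Rightarrow> complex"
  assumes a: "\<And>F. finite F \<Longrightarrow> (\<Sum>\<eta>\<in>F. (rho \<eta> * cmod (a \<eta>))\<^sup>2) \<le> M"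
    and b: "\<And>F. finite F \<Longrightarrow> (\<Sum>\<eta>\<in>F. (rho \<eta> * cmod (b \<eta>))\<^sup>2) \<le> M"
    and N: "N > 0"
  shows "cmod (convolution a b \<xi> - (\<Sum>\<eta>\<in>lattice_box N. a (\<xi> - \<eta>) * b \<eta>)) \<le> M / real N"
proof -
  have M: "M \<ge> 0" using a[of "{}"] by simp
  have as: "(\<lambda>\<eta>. (rho \<eta> * cmod (a \<eta>))\<^sup>2) summable_on UNIV" and bs: "(\<lambda>\<eta>. (rho \<eta> * cmod (b \<eta>))\<^sup>2) summable_on UNIV"
    and bM: "(\<Sum>\<^sub>\<infinity>\<eta>. (rho \<eta> * cmod (b \<eta>))\<^sup>2) \<le> M"
    using summable_on_if_bounded[of "\<lambda>\<eta>. (rho \<eta> * cmod (a \<eta>))\<^sup>2"]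
      summable_on_if_bounded[of "\<lambda>\<eta>. (rho \<eta> * cmod (b \<eta>))\<^sup>2"] a b by auto
  note al = summable_l2_of_weighted[OF as] and bl = summable_l2_of_weighted[OF bs]
  have aM: "(\<Sum>\<^sub>\<infinity>\<eta>. (cmod (a \<eta>))\<^sup>2) \<le> M"
  proof (rule summable_on_if_bounded(2))
    fix F :: "(int^'n) set" assume F: "finite F"
    have "(\<Sum>\<eta>\<in>F. (cmod (a \<eta>))\<^sup>2) \<le> (\<Sum>\<eta>\<in>F. (rho \<eta> * cmod (a \<eta>))\<^sup>2)"
      using rho_ge_1 by (intro sum_mono power_mono) (auto simp: mult_le_cancel_right1)
    with a[OF F] show "(\<Sum>\<eta>\<in>F. (cmod (a \<eta>))\<^sup>2) \<le> M" by linarith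
  qed simp
  define h where "h \<eta> = a (\<xi> - \<eta>) * b \<eta>" for \<eta>
  define A where "A \<eta> = cmod (a (\<xi> - \<eta>))" for \<eta>
  define B where "B \<eta> = rho \<eta> * cmod (b \<eta>)" for \<eta>
  have A: "(\<lambda>\<eta>. (norm (A \<eta>))\<^sup>2) summable_on UNIV"
    using al by (simp add: A_def summable_on_diff_left[of "\<lambda>\<eta>. (cmod (a \<eta>))\<^sup>2"])
  have B: "(\<lambda>\<eta>. (norm (B \<eta>))\<^sup>2) summable_on UNIV" using bs by (simp add: B_def)
  have "(\<Sum>\<^sub>\<infinity>\<eta>. norm (A \<eta> * B \<eta>))\<^sup>2 \<le> (\<Sum>\<^sub>\<infinity>\<eta>. (norm (A \<eta>))\<^sup>2) * (\<Sum>\<^sub>\<infinity>\<eta>. (norm (B \<eta>))\<^sup>2)"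
    by (rule infsum_norm_mult_le[OF A B])
  also have "\<dots> \<le> M * M"
    using aM bM M by (intro mult_mono infsum_nonneg)
      (auto simp: A_def B_def infsum_diff_left[of "\<lambda>\<eta>. (cmod (a \<eta>))\<^sup>2"])
  finally have AB: "(\<Sum>\<^sub>\<infinity>\<eta>. norm (A \<eta> * B \<eta>)) \<le> M"
    using M by (simp add: power2_eq_square[symmetric] abs_le_square_iff[symmetric] infsum_nonneg)
  have ABs: "(\<lambda>\<eta>. norm (A \<eta> * B \<eta>)) summable_on UNIV" by (rule abs_summable_on_mult_l2[OF A B])
  have hs: "(\<lambda>\<eta>. norm (h \<eta>)) summable_on UNIV" unfolding h_def by (rule abs_summable_convolution[OF al bl])
  have hs': "h summable_on UNIV" by (rule abs_summable_summable[OF hs])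
  have "convolution a b \<xi> - (\<Sum>\<eta>\<in>lattice_box N. h \<eta>) = (\<Sum>\<^sub>\<infinity>\<eta>\<in>UNIV - lattice_box N. h \<eta>)"
    using hs' by (subst infsum_Diff) (auto simp: convolution_def h_def[abs_def])
  also have "cmod \<dots> \<le> (\<Sum>\<^sub>\<infinity>\<eta>\<in>UNIV - lattice_box N. norm (h \<eta>))"
    by (intro norm_infsum_bound summable_on_subset_banach[OF hs]) auto
  also have "\<dots> \<le> (\<Sum>\<^sub>\<infinity>\<eta>. norm (A \<eta> * B \<eta>) * (1 / real N))"
  proof (rule infsum_mono_neutral)
    fix \<eta> :: "int^'n" assume "\<eta> \<in> (UNIV - lattice_box N) \<inter> UNIV"
    then have "rho \<eta> \<ge> real N" by (intro rho_ge_if_notin_lattice_box) auto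
    then have "1 \<le> rho \<eta> * (1 / real N)" using N by (simp add: field_simps)
    then have "norm (h \<eta>) * 1 \<le> norm (h \<eta>) * (rho \<eta> * (1 / real N))" by (intro mult_left_mono) auto
    then show "norm (h \<eta>) \<le> norm (A \<eta> * B \<eta>) * (1 / real N)"
      using rho_pos[of \<eta>] by (simp add: h_def A_def B_def norm_mult mult_ac abs_mult del: rho_pos)
  qed (use summable_on_cmult_left[OF ABs, of "1 / real N"] in
      \<open>auto intro: summable_on_subset_banach[OF hs]\<close>)
  also have "\<dots> \<le> M * (1 / real N)"
    unfolding infsum_cmult_left' using AB by (intro mult_right_mono) auto
  finally show ?thesis by (simp add: h_def)
qed

text \<open>A three-term estimate: two tails, each below \<open>e / 3\<close> by the uniform rate,
  and a finite sum that converges termwise. The limit families obey the same bound \<open>M\<close>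
  because every finite weighted sum passes to the limit.\<close>

lemma convolution_tendsto:
  fixes a b :: "nat \<Rightarrow> int^'n::finite \<Rightarrow> complex"
  assumes a: "\<And>m F. finite F \<Longrightarrow> (\<Sum>\<eta>\<in>F. (rho \<eta> * cmod (a m \<eta>))\<^sup>2) \<le> M"
    and b: "\<And>m F. finite F \<Longrightarrow> (\<Sum>\<eta>\<in>F. (rho \<eta> * cmod (b m \<eta>))\<^sup>2) \<le> M"
    and la: "\<And>\<eta>. (\<lambda>m. a m \<eta>) \<longlonglongrightarrow> a' \<eta>" and lb: "\<And>\<eta>. (\<lambda>m. b m \<eta>) \<longlonglongrightarrow> b' \<eta>"
  shows "(\<lambda>m. convolution (a m) (b m) \<xi>) \<longlonglongrightarrow> convolution a' b' \<xi>"
proof (rule LIMSEQ_I)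
  fix e :: real assume e: "e > 0"
  have M: "M \<ge> 0" using a[of "{}"] by simp
  \<comment> \<open>The left side is nonnegative, so the strict inequality gives
    \<open>N > 0\<close> even when \<open>M = 0\<close>.\<close>
  obtain N :: nat where "3 * M / e < real N" using reals_Archimedean2 by blast
  moreover have "3 * M / e \<ge> 0" using M e by simp
  ultimately have "N > 0" "3 * M / e < real N" by (cases N; simp)+
  then have N: "N > 0" "M / real N < e / 3" using e by (auto simp: field_simps)
  define P where "P a b = (\<Sum>\<eta>\<in>lattice_box N. a (\<xi> - \<eta>) * b \<eta>)" for a b :: "int^'n \<Rightarrow> complex"
  have Plim: "(\<lambda>m. P (a m) (b m)) \<longlonglongrightarrow> P a' b'"
    unfolding P_def by (rule tendsto_sum[OF tendsto_mult[OF la lb]])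
  obtain m0 where m0: "\<And>m. m \<ge> m0 \<Longrightarrow> norm (P (a m) (b m) - P a' b') < e / 3"
    using LIMSEQ_D[OF Plim, of "e / 3"] e by auto
  have "norm (convolution (a m) (b m) \<xi> - convolution a' b' \<xi>) < e" if "m \<ge> m0" for m
  proof -
    have t1: "norm (convolution (a m) (b m) \<xi> - P (a m) (b m)) < e / 3"
      unfolding P_def by (rule le_less_trans[OF convolution_tail[OF a b N(1)] N(2)])
    have t2: "norm (convolution a' b' \<xi> - P a' b') < e / 3"
      unfolding P_def by (rule le_less_trans[OF convolution_tail
            [OF weighted_l2_limit[OF a la] weighted_l2_limit[OF b lb] N(1)] N(2)])
    have tri: "norm (x - y) < e" if "norm (x - p) < e / 3" "norm (p - q) < e / 3" "norm (y - q) < e / 3"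
      for x y p q :: complex using that
      using norm_triangle_ineq4[of "(x - p) + (p - q)" "y - q"] norm_triangle_ineq[of "x - p" "p - q"] by simp
    show ?thesis by (rule tri[OF t1 m0[OF that] t2])
  qed
  then show "\<exists>no. \<forall>n\<ge>no. norm (convolution (a n) (b n) \<xi> - convolution a' b' \<xi>) < e"
    by (intro exI[of _ m0] allI impI)
qed

section \<open>Periodic test functions and trigonometric polynomials\<close>

text \<open>The periods of \<open>f\<close> form an additive group containing the unit vectors,
  hence all integer vectors.\<close>

lemma periodic_add_lattice_vec:
  assumes "periodic f"
  shows "f (x + lattice_vec \<xi>) = f x"
proof -
  define H where "H = {v. \<forall>x. f (x + v) = f x}"
  have add: "u + v \<in> H" if "u \<in> H" "v \<in> H" for u v
    using that by (simp add: H_def flip: add.assoc)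
  have minus: "- u \<in> H" if "u \<in> H" for u
  proof -
    have "f (x - u + u) = f (x - u)" for x using that unfolding H_def by blast
    then show ?thesis by (simp add: H_def)
  qed
  have zero: "0 \<in> H" by (simp add: H_def)
  have ax: "axis i 1 \<in> H" for i using assms by (simp add: periodic_def H_def)
  have nat: "real k *\<^sub>R axis i 1 \<in> H" for k i
    by (induction k) (auto simp: zero scaleR_add_left ax add)
  have int: "real_of_int k *\<^sub>R axis i 1 \<in> H" for k i
    using nat[of "nat k" i] minus[OF nat[of "nat (- k)" i]] by (cases "k \<ge> 0") auto
  have "finite F \<Longrightarrow> (\<Sum>i\<in>F. real_of_int (\<xi> $ i) *\<^sub>R axis i 1) \<in> H" for F
    by (induction F rule: finite_induct) (auto intro: add zero int)
  then have "(\<Sum>i\<in>UNIV. real_of_int (\<xi> $ i) *\<^sub>R axis i 1) \<in> H" by simp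
  moreover have "(\<Sum>i\<in>UNIV. real_of_int (\<xi> $ i) *\<^sub>R axis i 1) = lattice_vec \<xi>"
    by (simp add: vec_eq_iff axis_def if_distrib sum.delta cong: if_cong)
  ultimately have "lattice_vec \<xi> \<in> H" by simp
  then show ?thesis by (simp add: H_def)
qed

lemma partials_Nil [simp]: "partials [] f = f"
  and partials_Cons [simp]: "partials (i # ds) f = partial i (partials ds f)"
  and partials_snoc: "partials (ds @ [i]) f = partials ds (partial i f)"
  by (simp_all add: partials_def)

lemma smooth_differentiable: "smooth f \<Longrightarrow> f differentiable (at x)"
  by (auto simp: smooth_def dest: spec[of _ "[]"])

lemma smooth_continuous: "smooth f \<Longrightarrow> continuous_on S f"
  by (intro continuous_at_imp_continuous_on ballI differentiable_imp_continuous_within smooth_differentiable)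

lemma smooth_partial: "smooth f \<Longrightarrow> smooth (partial i f)"
  by (simp add: smooth_def flip: partials_snoc)

lemma smooth_partials: "smooth f \<Longrightarrow> smooth (partials ds f)"
  by (induction ds) (auto simp: smooth_partial)

lemma partial_eqI:
  assumes "\<And>x. (f has_derivative D x) (at x)"
  shows "partial i f = (\<lambda>x. D x (axis i 1))"
  unfolding partial_def using frechet_derivative_at[OF assms] by simp

lemma has_derivative_partial:
  fixes f :: "real^'n::finite \<Rightarrow> real"
  assumes "f differentiable (at x)"
  shows "(f has_derivative (\<lambda>v. \<Sum>i\<in>UNIV. v $ i * partial i f x)) (at x)"
proof -
  have D: "(f has_derivative frechet_derivative f (at x)) (at x)"
    using assms by (simp add: frechet_derivative_works)
  then interpret linear "frechet_derivative f (at x)" by (rule has_derivative_linear)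
  have "frechet_derivative f (at x) v = (\<Sum>i\<in>UNIV. v $ i * partial i f x)" for v
  proof -
    have "v = (\<Sum>i\<in>UNIV. v $ i *\<^sub>R axis i 1)"
      by (simp add: vec_eq_iff axis_def if_distrib sum.delta cong: if_cong)
    then have "frechet_derivative f (at x) v = frechet_derivative f (at x) (\<Sum>i\<in>UNIV. v $ i *\<^sub>R axis i 1)"
      by simp
    then show ?thesis by (simp add: sum scaleR partial_def)
  qed
  then have "frechet_derivative f (at x) = (\<lambda>v. \<Sum>i\<in>UNIV. v $ i * partial i f x)" by blast
  with D show ?thesis by simp
qed

lemma partial_shift:
  fixes f :: "real^'n::finite \<Rightarrow> real"
  assumes "\<And>x. f differentiable (at x)"
  shows "partial i (\<lambda>x. f (x + v)) = (\<lambda>x. partial i f (x + v))"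
proof -
  have "((\<lambda>x. f (x + v)) has_derivative (\<lambda>w. \<Sum>j\<in>UNIV. w $ j * partial j f (x + v))) (at x)" for x
    using has_derivative_compose[of "\<lambda>x. x + v" "\<lambda>x. x" x UNIV f, OF _ has_derivative_partial[OF assms]]
    by (simp add: has_derivative_add_const)
  from partial_eqI[OF this] show ?thesis
    by (simp add: axis_def if_distrib[of "\<lambda>x. x * _"] sum.delta cong: if_cong)
qed

lemma partial_lincomb:
  fixes f g :: "real^'n::finite \<Rightarrow> real"
  assumes "\<And>x. f differentiable (at x)" "\<And>x. g differentiable (at x)"
  shows "partial i (\<lambda>x. a * f x + b * g x) = (\<lambda>x. a * partial i f x + b * partial i g x)"
proof -
  have "((\<lambda>x. a * f x + b * g x) has_derivative (\<lambda>v. a * (\<Sum>i\<in>UNIV. v $ i * partial i f x)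
      + b * (\<Sum>i\<in>UNIV. v $ i * partial i g x))) (at x)" for x
    by (intro derivative_intros has_derivative_partial assms)
  from partial_eqI[OF this] show ?thesis
    by (simp add: axis_def if_distrib[of "\<lambda>x. x * _"] sum.delta cong: if_cong)
qed

lemma partials_lincomb:
  fixes f g :: "real^'n::finite \<Rightarrow> real"
  assumes "smooth f" "smooth g"
  shows "partials ds (\<lambda>x. a * f x + b * g x) = (\<lambda>x. a * partials ds f x + b * partials ds g x)"
proof (induction ds)
  case (Cons i ds)
  then show ?case using assms by (simp add: partial_lincomb smooth_def)
qed simp

lemma smooth_lincomb:
  fixes f g :: "real^'n::finite \<Rightarrow> real"
  assumes "smooth f" "smooth g"
  shows "smooth (\<lambda>x. a * f x + b * g x)"
  unfolding smooth_def partials_lincomb[OF assms]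
  using assms by (auto simp: smooth_def intro!: derivative_intros)

lemma periodic_partial:
  fixes f :: "real^'n::finite \<Rightarrow> real"
  assumes "smooth f" "periodic f"
  shows "periodic (partial i f)"
proof -
  have "partial i f (x + axis j 1) = partial i f x" for x j
    using partial_shift[OF smooth_differentiable[OF assms(1)], of i "axis j 1"] assms(2)
    by (simp add: periodic_def fun_eq_iff)
  then show ?thesis by (simp add: periodic_def)
qed

lemma test_functions_lincomb:
  "f \<in> test_functions \<Longrightarrow> g \<in> test_functions \<Longrightarrow> (\<lambda>x. a * f x + b * g x) \<in> (test_functions :: (real^'n::finite \<Rightarrow> real) set)"
  by (auto simp: test_functions_def smooth_lincomb periodic_def)

lemma test_functions_partial:
  "f \<in> test_functions \<Longrightarrow> partial i f \<in> (test_functions :: (real^'n::finite \<Rightarrow> real) set)"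
  by (auto simp: test_functions_def smooth_partial periodic_partial)

lemma test_functions_partials:
  "f \<in> test_functions \<Longrightarrow> partials ds f \<in> (test_functions :: (real^'n::finite \<Rightarrow> real) set)"
  by (induction ds) (auto intro: test_functions_partial)

lemma test_functions_continuous: "f \<in> test_functions \<Longrightarrow> continuous_on S f"
  by (simp add: test_functions_def smooth_continuous)

text \<open>Distributions act on real functions only, so the exponentials are kept as a cosine and a
  sine. The values on these two are the real part and, up to sign, the imaginary part of a Fourier
  coefficient.\<close>

definition cos_wave :: "int^'n \<Rightarrow> real^'n \<Rightarrow> real" where
  "cos_wave \<xi> = (\<lambda>x. cos (2 * pi * (x \<bullet> lattice_vec \<xi>)))"

definition sin_wave :: "int^'n \<Rightarrow> real^'n \<Rightarrow> real" where
  "sin_wave \<xi> = (\<lambda>x. sin (2 * pi * (x \<bullet> lattice_vec \<xi>)))"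

lemma has_derivative_waves:
  fixes \<xi> :: "int^'n::finite"
  shows "(cos_wave \<xi> has_derivative (\<lambda>v. - sin_wave \<xi> x * (2 * pi * (v \<bullet> lattice_vec \<xi>)))) (at x)"
    and "(sin_wave \<xi> has_derivative (\<lambda>v. cos_wave \<xi> x * (2 * pi * (v \<bullet> lattice_vec \<xi>)))) (at x)"
  unfolding cos_wave_def sin_wave_def
  by (auto intro!: derivative_eq_intros simp: fun_eq_iff mult_ac)

lemma differentiable_waves [simp]:
  fixes \<xi> :: "int^'n::finite"
  shows "cos_wave \<xi> differentiable (at x)" "sin_wave \<xi> differentiable (at x)"
  by (rule differentiableI, rule has_derivative_waves)+

lemma partial_cos_wave: "partial i (cos_wave \<xi>) = (\<lambda>x. - (2 * pi * real_of_int (\<xi> $ i)) * sin_wave \<xi> x)"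
  and partial_sin_wave: "partial i (sin_wave \<xi>) = (\<lambda>x. 2 * pi * real_of_int (\<xi> $ i) * cos_wave \<xi> x)"
  for \<xi> :: "int^'n::finite"
  by (simp_all add: partial_eqI[OF has_derivative_waves(1)] partial_eqI[OF has_derivative_waves(2)]
      inner_axis' mult_ac)

text \<open>Smoothness concerns all iterated partial derivatives, and differentiation exchanges sine
  and cosine. The span of the two waves of one frequency is closed under it, so the induction runs
  over their linear combinations.\<close>

lemma waves_in_test_functions:
  fixes \<xi> :: "int^'n::finite"
  shows "cos_wave \<xi> \<in> test_functions" "sin_wave \<xi> \<in> test_functions"
proof -
  have closed: "\<exists>a' b'. partials ds (\<lambda>x. a * cos_wave \<xi> x + b * sin_wave \<xi> x) =
      (\<lambda>x. a' * cos_wave \<xi> x + b' * sin_wave \<xi> x)" for ds a b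
  proof (induction ds)
    case (Cons i ds)
    then obtain a' b' where "partials ds (\<lambda>x. a * cos_wave \<xi> x + b * sin_wave \<xi> x) =
      (\<lambda>x. a' * cos_wave \<xi> x + b' * sin_wave \<xi> x)" by blast
    then have "partials (i # ds) (\<lambda>x. a * cos_wave \<xi> x + b * sin_wave \<xi> x) =
      partial i (\<lambda>x. a' * cos_wave \<xi> x + b' * sin_wave \<xi> x)" by simp
    also have "\<dots> = (\<lambda>x. (b' * (2 * pi * real_of_int (\<xi> $ i))) * cos_wave \<xi> x +
        (- a' * (2 * pi * real_of_int (\<xi> $ i))) * sin_wave \<xi> x)"
      by (simp add: partial_lincomb partial_cos_wave partial_sin_wave fun_eq_iff algebra_simps)
    finally show ?case by blast
  qed auto
  have diff: "(\<lambda>x. a * cos_wave \<xi> x + b * sin_wave \<xi> x) differentiable (at x)" for a b x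
    by (auto intro!: derivative_intros)
  have "smooth (\<lambda>x. a * cos_wave \<xi> x + b * sin_wave \<xi> x)" for a b
    unfolding smooth_def
  proof (intro allI)
    fix ds x
    obtain a' b' where "partials ds (\<lambda>x. a * cos_wave \<xi> x + b * sin_wave \<xi> x) =
      (\<lambda>x. a' * cos_wave \<xi> x + b' * sin_wave \<xi> x)" using closed by blast
    then show "partials ds (\<lambda>x. a * cos_wave \<xi> x + b * sin_wave \<xi> x) differentiable (at x)"
      by (simp only: diff)
  qed
  from this[of 1 0] this[of 0 1] have "smooth (cos_wave \<xi>)" "smooth (sin_wave \<xi>)" by simp_all
  moreover have "periodic (cos_wave \<xi>)" "periodic (sin_wave \<xi>)"
    by (auto simp: periodic_def cos_wave_def sin_wave_def inner_add_left inner_axis' distrib_left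
        cos_add sin_add)
  ultimately show "cos_wave \<xi> \<in> test_functions" "sin_wave \<xi> \<in> test_functions"
    by (auto simp: test_functions_def)
qed

text \<open>The real linear span of the waves, given inductively so that linear statements need
  checking on the two generators only.\<close>

inductive_set trig_polys :: "(real^'n::finite \<Rightarrow> real) set" where
  cos: "cos_wave \<xi> \<in> trig_polys"
| sin: "sin_wave \<xi> \<in> trig_polys"
| lincomb: "f \<in> trig_polys \<Longrightarrow> g \<in> trig_polys \<Longrightarrow> (\<lambda>x. a * f x + b * g x) \<in> trig_polys"

lemma trig_polys_test_functions: "f \<in> trig_polys \<Longrightarrow> f \<in> test_functions"
  by (induction rule: trig_polys.induct) (auto intro: waves_in_test_functions test_functions_lincomb)

lemma trig_polys_scale: "f \<in> trig_polys \<Longrightarrow> (\<lambda>x. a * f x) \<in> trig_polys"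
  using trig_polys.lincomb[of f f a 0] by simp

lemma trig_polys_add: "f \<in> trig_polys \<Longrightarrow> g \<in> trig_polys \<Longrightarrow> (\<lambda>x. f x + g x) \<in> trig_polys"
  using trig_polys.lincomb[of f g 1 1] by simp

lemma trig_polys_const: "(\<lambda>x. c) \<in> trig_polys"
  using trig_polys_scale[OF trig_polys.cos[of 0], of c] by (simp add: cos_wave_def)

lemma trig_polys_sum: "finite A \<Longrightarrow> (\<And>i. i \<in> A \<Longrightarrow> f i \<in> trig_polys) \<Longrightarrow> (\<lambda>x. \<Sum>i\<in>A. f i x) \<in> trig_polys"
  by (induction rule: finite_induct) (auto intro: trig_polys_add trig_polys_const)

text \<open>By the product-to-sum formulas, a product of two waves is a combination of waves of
  frequencies \<xi> + \<eta> and \<xi> - \<eta>. Closure under products makes the powers of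
  \<open>bump\<close> used as kernels trigonometric polynomials.\<close>

lemma trig_polys_mult:
  assumes "f \<in> trig_polys" "g \<in> trig_polys"
  shows "(\<lambda>x. f x * g x) \<in> (trig_polys :: (real^'n::finite \<Rightarrow> real) set)"
proof -
  have cc: "(\<lambda>x. cos_wave \<xi> x * cos_wave \<eta> x) = (\<lambda>x. 1/2 * cos_wave (\<xi> - \<eta>) x + 1/2 * cos_wave (\<xi> + \<eta>) x)"
    and ss: "(\<lambda>x. sin_wave \<xi> x * sin_wave \<eta> x) = (\<lambda>x. 1/2 * cos_wave (\<xi> - \<eta>) x + (-1/2) * cos_wave (\<xi> + \<eta>) x)"
    and sc: "(\<lambda>x. sin_wave \<xi> x * cos_wave \<eta> x) = (\<lambda>x. 1/2 * sin_wave (\<xi> + \<eta>) x + 1/2 * sin_wave (\<xi> - \<eta>) x)"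
    for \<xi> \<eta> :: "int^'n"
    by (simp_all add: fun_eq_iff cos_wave_def sin_wave_def lattice_vec_diff lattice_vec_add inner_diff_right
        inner_add_right distrib_left right_diff_distrib cos_add cos_diff sin_add sin_diff field_simps)
  have wave: "(\<lambda>x. cos_wave \<xi> x * g x) \<in> trig_polys \<and> (\<lambda>x. sin_wave \<xi> x * g x) \<in> trig_polys" for \<xi>
    using assms(2)
  proof (induction rule: trig_polys.induct)
    case (cos \<eta>)
    then show ?case unfolding cc sc by (intro conjI trig_polys.intros)
  next
    case (sin \<eta>)
    have "(\<lambda>x. cos_wave \<xi> x * sin_wave \<eta> x) = (\<lambda>x. sin_wave \<eta> x * cos_wave \<xi> x)" by (simp add: mult.commute)
    then show ?case unfolding ss by (simp only: sc) (intro conjI trig_polys.intros)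
  next
    case (lincomb f g a b)
    have "(\<lambda>x. h x * (a * f x + b * g x)) = (\<lambda>x. a * (h x * f x) + b * (h x * g x))" for h :: "real^'n \<Rightarrow> real"
      by (simp add: algebra_simps)
    then show ?case using lincomb by (auto intro: trig_polys.lincomb)
  qed
  show ?thesis using assms(1)
  proof (induction rule: trig_polys.induct)
    case (lincomb h k a b)
    have "(\<lambda>x. (a * h x + b * k x) * g x) = (\<lambda>x. a * (h x * g x) + b * (k x * g x))"
      by (simp add: algebra_simps)
    then show ?case using lincomb by (auto intro: trig_polys.lincomb)
  qed (use wave in auto)
qed

lemma trig_polys_power: "f \<in> trig_polys \<Longrightarrow> (\<lambda>x. f x ^ k) \<in> trig_polys"
  by (induction k) (auto intro: trig_polys_const trig_polys_mult)

section \<open>Integrals over the unit cube\<close>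

text \<open>The hyperplane \<open>x $ i = t\<close> cuts the cube into two slabs. The translated
  cube consists of the upper slab and of the lower one moved by a full period, over which
  \<open>h\<close> has the same integral.\<close>

lemma integral_cube_axis_shift:
  fixes h :: "real^'n::finite \<Rightarrow> real"
  assumes h: "continuous_on UNIV h" and per: "\<And>x. h (x + axis i 1) = h x" and t: "0 \<le> t" "t \<le> 1"
  shows "integral (cbox 0 1) (\<lambda>x. h (x + t *\<^sub>R axis i 1)) = integral (cbox 0 1) h"
proof -
  \<comment> \<open>Corners of the slabs: the lower one is \<open>cbox 0 u\<close>, the upper one
    \<open>cbox l 1\<close>. Since \<open>l = t *\<^sub>R axis i 1\<close>, the translated cube is
    \<open>cbox l (1 + l)\<close>.\<close>
  define l where "l = (\<chi> j. if j = i then t else (0::real))"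
  define u where "u = (\<chi> j. if j = i then t else (1::real))"
  have hI: "(h has_integral integral (cbox a b) h) (cbox a b)" for a b
    by (intro integrable_integral integrable_continuous continuous_on_subset[OF h]) auto
  have "(h has_integral (integral (cbox 0 u) h + integral (cbox l 1) h)) (cbox 0 1)"
  proof (rule has_integral_split[where k = "axis i 1" and c = t])
    have "cbox 0 1 \<inter> {x. x \<bullet> axis i 1 \<le> t} = cbox 0 u"
      using interval_split_cart(1)[where a = 0 and b = 1 and k = i and c = t] t
      by (simp add: interval_cbox_cart inner_axis u_def min_def cong: if_cong)
    then show "(h has_integral integral (cbox 0 u) h) (cbox 0 1 \<inter> {x. x \<bullet> axis i 1 \<le> t})"
      using hI by simp
    have "cbox 0 1 \<inter> {x. x \<bullet> axis i 1 \<ge> t} = cbox l 1"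
      using interval_split_cart(2)[where a = 0 and b = 1 and k = i and c = t] t
      by (simp add: interval_cbox_cart inner_axis l_def max_def cong: if_cong)
    then show "(h has_integral integral (cbox l 1) h) (cbox 0 1 \<inter> {x. x \<bullet> axis i 1 \<ge> t})"
      using hI by simp
  qed simp
  then have 1: "integral (cbox 0 1) h = integral (cbox 0 u) h + integral (cbox l 1) h" by blast
  have "(h has_integral (integral (cbox l 1) h + integral (cbox 0 u) h)) (cbox l (1 + l))"
  proof (rule has_integral_split[where k = "axis i 1" and c = 1])
    have "(\<chi> j. if j = i then min ((1 + l) $ i) 1 else (1 + l) $ j) = 1"
      using t by (simp add: vec_eq_iff l_def)
    then have "cbox l (1 + l) \<inter> {x. x \<bullet> axis i 1 \<le> 1} = cbox l 1"
      using interval_split_cart(1)[where a = l and b = "1 + l" and k = i and c = 1] by (simp add: interval_cbox_cart inner_axis)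
    then show "(h has_integral integral (cbox l 1) h) (cbox l (1 + l) \<inter> {x. x \<bullet> axis i 1 \<le> 1})"
      using hI by simp
    have "(h \<circ> (+) (axis i 1)) = h" using per by (simp add: o_def add.commute)
    then have "(h has_integral integral (cbox 0 u) h) (cbox (0 + axis i 1) (u + axis i 1))"
      using has_integral_shift_cbox_iff[of h "axis i 1" _ 0 u] hI by metis
    moreover have "(\<chi> j. if j = i then max (l $ i) 1 else l $ j) = 0 + axis i 1" "1 + l = u + axis i 1"
      using t by (auto simp: vec_eq_iff l_def u_def axis_def)
    then have "cbox l (1 + l) \<inter> {x. x \<bullet> axis i 1 \<ge> 1} = cbox (0 + axis i 1) (u + axis i 1)"
      using interval_split_cart(2)[where a = l and b = "1 + l" and k = i and c = 1] by (simp add: interval_cbox_cart inner_axis)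
    ultimately show "(h has_integral integral (cbox 0 u) h) (cbox l (1 + l) \<inter> {x. x \<bullet> axis i 1 \<ge> 1})"
      by simp
  qed simp
  moreover have "l = t *\<^sub>R axis i 1" by (simp add: l_def vec_eq_iff axis_def)
  ultimately have "((h \<circ> (+) (t *\<^sub>R axis i 1)) has_integral (integral (cbox l 1) h + integral (cbox 0 u) h)) (cbox 0 1)"
    using has_integral_shift_cbox_iff[of h "t *\<^sub>R axis i 1" _ 0 1] by simp
  then have "integral (cbox 0 1) (h \<circ> (+) (t *\<^sub>R axis i 1)) = integral (cbox l 1) h + integral (cbox 0 u) h" by blast
  with 1 show ?thesis by (simp add: o_def add.commute)
qed

lemma frac_decomposition:
  fixes v :: "real^'n::finite"
  shows "v = (\<Sum>i\<in>UNIV. frac (v $ i) *\<^sub>R axis i 1) + lattice_vec (\<chi> i. \<lfloor>v $ i\<rfloor>)"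
  by (simp add: vec_eq_iff axis_def if_distrib sum.delta frac_def cong: if_cong)

text \<open>The vector \<open>v\<close> is split into its fractional parts, which are handled one
  axis at a time, and an integer vector, which periodicity absorbs.\<close>

lemma integral_cube_shift:
  fixes h :: "real^'n::finite \<Rightarrow> real"
  assumes "continuous_on UNIV h" and per: "periodic h"
  shows "integral (cbox 0 1) (\<lambda>x. h (x + v)) = integral (cbox 0 1) h"
proof -
  have step: "integral (cbox 0 1) (\<lambda>x. h (x + (\<Sum>i\<in>F. frac (v $ i) *\<^sub>R axis i 1))) = integral (cbox 0 1) h"
    if "finite F" for F
    using that
  proof induction
    case (insert i F)
    define w :: "real^'n" where "w = (\<Sum>i\<in>F. frac (v $ i) *\<^sub>R axis i 1)"
    have "integral (cbox 0 1) (\<lambda>x. (\<lambda>x. h (x + w)) (x + frac (v $ i) *\<^sub>R axis i 1)) = integral (cbox 0 1) (\<lambda>x. h (x + w))"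
    proof (rule integral_cube_axis_shift)
      show "continuous_on UNIV (\<lambda>x. h (x + w))"
        by (intro continuous_on_compose2[OF assms(1)] continuous_intros) auto
      show "h (x + axis i 1 + w) = h (x + w)" for x
        using per[unfolded periodic_def, rule_format, of "x + w" i] by (simp add: ac_simps)
    qed (auto simp: frac_ge_0 frac_lt_1 less_imp_le)
    then show ?case using insert by (simp add: w_def add.assoc)
  qed simp
  have "integral (cbox 0 1) (\<lambda>x. h (x + (\<Sum>i\<in>UNIV. frac (v $ i) *\<^sub>R axis i 1))) = integral (cbox 0 1) h"
    by (rule step) simp
  moreover have "h (x + v) = h (x + (\<Sum>i\<in>UNIV. frac (v $ i) *\<^sub>R axis i 1))" for x
    using periodic_add_lattice_vec[OF per, of "x + (\<Sum>i\<in>UNIV. frac (v $ i) *\<^sub>R axis i 1)" "\<chi> i. \<lfloor>v $ i\<rfloor>"]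
    by (subst (1) frac_decomposition[of v]) (simp only: add.assoc)
  ultimately show ?thesis by simp
qed

section \<open>Density of trigonometric polynomials\<close>

text \<open>The correlation form \<open>f (x + y)\<close> lets every derivative fall on
  \<open>f\<close>, so that mollification commutes with \<open>partials\<close>. The change of
  variables \<open>z = x + y\<close>, permitted by periodicity, moves x into the kernel
  instead.\<close>

definition mollify :: "(real^'n::finite \<Rightarrow> real) \<Rightarrow> (real^'n \<Rightarrow> real) \<Rightarrow> real^'n \<Rightarrow> real" where
  "mollify K f x = integral (cbox 0 1) (\<lambda>y. K y * f (x + y))"

lemma integrable_cube: "continuous_on UNIV h \<Longrightarrow> h integrable_on cbox a b"
  for h :: "'a::euclidean_space \<Rightarrow> 'b::banach"
  by (rule integrable_continuous, erule continuous_on_subset) simp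

lemma continuous_on_translate:
  fixes f :: "'a::real_normed_vector \<Rightarrow> 'b::topological_space"
  assumes "continuous_on UNIV f"
  shows "continuous_on S (\<lambda>y. f (x + y))" "continuous_on S (\<lambda>y. f (y + x))" "continuous_on S (\<lambda>y. f (y - x))"
  by (auto intro!: continuous_on_compose2[OF assms] continuous_intros)

lemma mollify_has_derivative:
  assumes K: "continuous_on UNIV K" and f: "smooth f"
  shows "(mollify K f has_derivative (\<lambda>v. \<Sum>i\<in>UNIV. v $ i * mollify K (partial i f) x)) (at x)"
proof -
  \<comment> \<open>The Leibniz rule takes the derivative of the integrand as a bounded linear
    operator, continuous in both arguments; this is the gradient in that form.\<close>
  define fx where "fx x t = (\<Sum>i\<in>UNIV. (K t * partial i f (x + t)) *\<^sub>R blinfun_inner_right (axis i (1::real)))"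
    for x t :: "real^'a"
  have fx_apply: "blinfun_apply (fx x t) v = (\<Sum>i\<in>UNIV. K t * partial i f (x + t) * v $ i)" for x t v
    by (simp add: fx_def blinfun.sum_left blinfun.scaleR_left inner_axis')
  have cpf: "continuous_on UNIV (partial i f)" for i
    by (rule smooth_continuous[OF smooth_partial[OF f]])
  have "((\<lambda>x. integral (cbox 0 1) (\<lambda>t. K t * f (x + t))) has_derivative
      blinfun_apply (integral (cbox 0 1) (fx x))) (at x within UNIV)"
  proof (rule leibniz_rule)
    fix x t :: "real^'a"
    have "((\<lambda>x. f (x + t)) has_derivative (\<lambda>v. \<Sum>i\<in>UNIV. v $ i * partial i f (x + t))) (at x)"
      using has_derivative_compose[of "\<lambda>x. x + t" "\<lambda>x. x" x UNIV f,
          OF _ has_derivative_partial[OF smooth_differentiable[OF f]]]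
      by (simp add: has_derivative_add_const)
    then have "((\<lambda>x. K t * f (x + t)) has_derivative (\<lambda>v. K t * (\<Sum>i\<in>UNIV. v $ i * partial i f (x + t)))) (at x)"
      by (rule has_derivative_mult_right)
    then show "((\<lambda>x. K t * f (x + t)) has_derivative blinfun_apply (fx x t)) (at x within UNIV)"
      by (simp add: fx_apply[abs_def] sum_distrib_left mult_ac)
  next
    fix x :: "real^'a"
    show "(\<lambda>t. K t * f (x + t)) integrable_on cbox 0 1"
      by (intro integrable_cube continuous_on_mult K continuous_on_translate smooth_continuous f)
  next
    have "continuous_on (UNIV \<times> cbox 0 1) (\<lambda>p. fx (fst p) (snd p))"
      unfolding fx_def
      by (intro continuous_on_sum continuous_on_scaleR continuous_on_mult continuous_on_const
          continuous_on_compose2[OF K] continuous_on_compose2[OF cpf] continuous_intros) auto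
    then show "continuous_on (UNIV \<times> cbox 0 1) (\<lambda>(x, t). fx x t)" by (simp add: case_prod_unfold)
  qed auto
  moreover have "blinfun_apply (integral (cbox 0 1) (fx x)) v = (\<Sum>i\<in>UNIV. v $ i * mollify K (partial i f) x)" for v
  proof -
    have ci: "continuous_on UNIV (\<lambda>t. K t * partial i f (x + t))" for i
      by (intro continuous_on_mult K continuous_on_translate cpf)
    have "continuous_on UNIV (fx x)"
      unfolding fx_def by (intro continuous_on_sum continuous_on_scaleR ci continuous_on_const)
    then have "fx x integrable_on cbox 0 1" by (rule integrable_cube)
    then have "blinfun_apply (integral (cbox 0 1) (fx x)) v = integral (cbox 0 1) (\<lambda>t. blinfun_apply (fx x t) v)"
      using integral_linear[OF _ blinfun.bounded_linear_left[of v], of "fx x" "cbox 0 1"] by (simp add: o_def)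
    also have "\<dots> = (\<Sum>i\<in>UNIV. integral (cbox 0 1) (\<lambda>t. K t * partial i f (x + t) * v $ i))"
      unfolding fx_apply by (intro integral_sum integrable_cube continuous_on_mult ci continuous_on_const) auto
    also have "\<dots> = (\<Sum>i\<in>UNIV. v $ i * mollify K (partial i f) x)"
      by (simp add: mollify_def mult.commute)
    finally show ?thesis .
  qed
  then have "blinfun_apply (integral (cbox 0 1) (fx x)) = (\<lambda>v. \<Sum>i\<in>UNIV. v $ i * mollify K (partial i f) x)"
    by blast
  ultimately have "((\<lambda>x. integral (cbox 0 1) (\<lambda>t. K t * f (x + t))) has_derivative
      (\<lambda>v. \<Sum>i\<in>UNIV. v $ i * mollify K (partial i f) x)) (at x)" by simp
  then show ?thesis by (simp only: mollify_def[of K f, abs_def])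
qed

lemma partial_mollify:
  assumes "continuous_on UNIV K" "smooth f"
  shows "partial i (mollify K f) = mollify K (partial i f)"
  using partial_eqI[OF mollify_has_derivative[OF assms], of i]
  by (simp add: axis_def if_distrib[of "\<lambda>x. x * _"] sum.delta cong: if_cong)

lemma partials_mollify:
  assumes "continuous_on UNIV K" "smooth f"
  shows "partials ds (mollify K f) = mollify K (partials ds f)"
  by (induction ds) (simp_all add: partial_mollify assms smooth_partials)

text \<open>Translation invariance over a period rewrites the integral with the kernel
  \<open>K (z - x)\<close>. For a wave, the addition formulas separate z from x and leave a
  combination of waves in x with integrals as coefficients.\<close>

lemma mollify_trig_polys:
  assumes K: "K \<in> trig_polys" and f: "continuous_on UNIV f" "periodic f"
  shows "mollify K f \<in> trig_polys"
proof -
  have cK: "continuous_on UNIV K" using K by (intro test_functions_continuous trig_polys_test_functions)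
  have "mollify K f x = integral (cbox 0 1) (\<lambda>z. K (z - x) * f z)" for x
  proof -
    have "integral (cbox 0 1) (\<lambda>y. (\<lambda>z. K (z - x) * f z) (y + x)) = integral (cbox 0 1) (\<lambda>z. K (z - x) * f z)"
    proof (rule integral_cube_shift)
      show "continuous_on UNIV (\<lambda>z. K (z - x) * f z)"
        by (intro continuous_on_mult continuous_on_translate cK f)
      have "K (z + axis i 1 - x) = K (z - x)" for z i
      proof -
        have "K ((z - x) + axis i 1) = K (z - x)"
          using trig_polys_test_functions[OF K] unfolding test_functions_def periodic_def by blast
        then show ?thesis by (simp add: algebra_simps)
      qed
      then show "periodic (\<lambda>z. K (z - x) * f z)" using f(2) by (simp add: periodic_def)
    qed
    then show ?thesis by (simp add: mollify_def add.commute)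
  qed
  then have "mollify K f = (\<lambda>x. integral (cbox 0 1) (\<lambda>z. K (z - x) * f z))" by blast
  also have "\<dots> \<in> trig_polys"
    using K
  proof (induction rule: trig_polys.induct)
    case (cos \<xi>)
    define A where "A = integral (cbox 0 1) (\<lambda>z. cos_wave \<xi> z * f z)"
    define B where "B = integral (cbox 0 1) (\<lambda>z. sin_wave \<xi> z * f z)"
    have AB: "((\<lambda>z. cos_wave \<xi> z * f z) has_integral A) (cbox 0 1)" "((\<lambda>z. sin_wave \<xi> z * f z) has_integral B) (cbox 0 1)"
      unfolding A_def B_def
      by (intro integrable_integral integrable_cube continuous_on_mult f test_functions_continuous waves_in_test_functions)+
    have "integral (cbox 0 1) (\<lambda>z. cos_wave \<xi> (z - x) * f z) = A * cos_wave \<xi> x + B * sin_wave \<xi> x" for x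
    proof (rule integral_unique)
      have "cos_wave \<xi> (z - x) * f z = cos_wave \<xi> z * f z * cos_wave \<xi> x + sin_wave \<xi> z * f z * sin_wave \<xi> x" for z
        by (simp add: cos_wave_def sin_wave_def inner_diff_left right_diff_distrib cos_diff algebra_simps)
      with has_integral_add[OF has_integral_mult_left[OF AB(1)] has_integral_mult_left[OF AB(2)]]
      show "((\<lambda>z. cos_wave \<xi> (z - x) * f z) has_integral A * cos_wave \<xi> x + B * sin_wave \<xi> x) (cbox 0 1)" by simp
    qed
    then show ?case by (simp add: trig_polys.intros)
  next
    case (sin \<xi>)
    define A where "A = integral (cbox 0 1) (\<lambda>z. sin_wave \<xi> z * f z)"
    define B where "B = - integral (cbox 0 1) (\<lambda>z. cos_wave \<xi> z * f z)"
    have AB: "((\<lambda>z. sin_wave \<xi> z * f z) has_integral A) (cbox 0 1)" "((\<lambda>z. - (cos_wave \<xi> z * f z)) has_integral B) (cbox 0 1)"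
      unfolding A_def B_def
      by (intro has_integral_neg integrable_integral integrable_cube continuous_on_mult f
          test_functions_continuous waves_in_test_functions)+
    have "integral (cbox 0 1) (\<lambda>z. sin_wave \<xi> (z - x) * f z) = A * cos_wave \<xi> x + B * sin_wave \<xi> x" for x
    proof (rule integral_unique)
      have "sin_wave \<xi> (z - x) * f z = sin_wave \<xi> z * f z * cos_wave \<xi> x + - (cos_wave \<xi> z * f z) * sin_wave \<xi> x" for z
        by (simp add: cos_wave_def sin_wave_def inner_diff_left right_diff_distrib sin_diff algebra_simps)
      with has_integral_add[OF has_integral_mult_left[OF AB(1)] has_integral_mult_left[OF AB(2)]]
      show "((\<lambda>z. sin_wave \<xi> (z - x) * f z) has_integral A * cos_wave \<xi> x + B * sin_wave \<xi> x) (cbox 0 1)" by simp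
    qed
    then show ?case by (simp add: trig_polys.intros)
  next
    case (lincomb g h a b)
    have c: "continuous_on UNIV (\<lambda>z. k (z - x) * f z)" if "k \<in> trig_polys" for k x
      using that by (intro continuous_on_mult f continuous_on_translate test_functions_continuous trig_polys_test_functions)
    have "integral (cbox 0 1) (\<lambda>z. (a * g (z - x) + b * h (z - x)) * f z) =
      a * integral (cbox 0 1) (\<lambda>z. g (z - x) * f z) + b * integral (cbox 0 1) (\<lambda>z. h (z - x) * f z)" for x
    proof (rule integral_unique)
      note I = integrable_integral[OF integrable_cube[OF c]]
      have "(a * g (z - x) + b * h (z - x)) * f z = a * (g (z - x) * f z) + b * (h (z - x) * f z)" for z
        by (simp add: algebra_simps)
      with has_integral_add[OF has_integral_mult_right[OF I[OF lincomb(1)], of a x 0 1]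
          has_integral_mult_right[OF I[OF lincomb(2)], of b x 0 1]]
      show "((\<lambda>z. (a * g (z - x) + b * h (z - x)) * f z) has_integral
         a * integral (cbox 0 1) (\<lambda>z. g (z - x) * f z) + b * integral (cbox 0 1) (\<lambda>z. h (z - x) * f z)) (cbox 0 1)"
        by simp
    qed
    then show ?case using lincomb.IH by (simp add: trig_polys.lincomb)
  qed
  finally show ?thesis .
qed

section \<open>Periodic functions reduced to the unit cube\<close>

lemma cube_representative:
  obtains x' where "x' \<in> cbox 0 (1::real^'n::finite)" "\<And>f :: real^'n \<Rightarrow> real. \<And>y. periodic f \<Longrightarrow> f (x + y) = f (x' + y)"
proof
  define x' where "x' = (\<chi> i. frac (x $ i))"
  show "x' \<in> cbox 0 1" by (auto simp: x'_def mem_box_cart frac_ge_0 frac_lt_1 less_imp_le)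
  have x: "x = x' + lattice_vec (\<chi> i. \<lfloor>x $ i\<rfloor>)" by (simp add: x'_def vec_eq_iff frac_def)
  fix f :: "real^'n \<Rightarrow> real" and y assume "periodic f"
  from periodic_add_lattice_vec[OF this, of "x' + y" "\<chi> i. \<lfloor>x $ i\<rfloor>"]
  show "f (x + y) = f (x' + y)" by (subst x) (simp add: ac_simps)
qed

lemma periodic_bounded:
  fixes f :: "real^'n::finite \<Rightarrow> real"
  assumes "continuous_on UNIV f" "periodic f"
  obtains B where "B > 0" "\<And>x. \<bar>f x\<bar> \<le> B"
proof -
  have "compact (f ` cbox 0 1)"
    by (intro compact_continuous_image continuous_on_subset[OF assms(1)]) auto
  then obtain B where B: "B > 0" "\<And>y. y \<in> f ` cbox 0 1 \<Longrightarrow> norm y \<le> B"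
    using compact_imp_bounded bounded_pos by metis
  have "\<bar>f x\<bar> \<le> B" for x
  proof -
    obtain x' where "x' \<in> cbox 0 1" "f (x + 0) = f (x' + 0)" using cube_representative assms(2) by metis
    then show ?thesis using B(2) by auto
  qed
  with B(1) show ?thesis using that by blast
qed

lemma periodic_uniformly_continuous:
  fixes f :: "real^'n::finite \<Rightarrow> real"
  assumes f: "continuous_on UNIV f" "periodic f" and e: "e > 0"
  obtains d where "d > 0" "\<And>x y. norm y < d \<Longrightarrow> \<bar>f (x + y) - f x\<bar> < e"
proof -
  \<comment> \<open>The cube enlarged by a unit ball is compact and contains both the representative
    \<open>x'\<close> and \<open>x' + y\<close> when \<open>norm y < 1\<close>; hence the final
    radius \<open>min d 1\<close>.\<close>
  define S where "S = {u + v |u v. u \<in> cbox 0 (1::real^'n) \<and> v \<in> cball 0 1}"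
  have "compact S" unfolding S_def by (intro compact_sums compact_cbox compact_cball)
  then have "uniformly_continuous_on S f"
    by (intro compact_uniformly_continuous continuous_on_subset[OF f(1)]) auto
  then obtain d where d: "d > 0" "\<And>x y. x \<in> S \<Longrightarrow> y \<in> S \<Longrightarrow> dist y x < d \<Longrightarrow> dist (f y) (f x) < e"
    unfolding uniformly_continuous_on_def using e by metis
  have "\<bar>f (x + y) - f x\<bar> < e" if y: "norm y < min d 1" for x y
  proof -
    obtain x' where x': "x' \<in> cbox 0 1" "\<And>y. f (x + y) = f (x' + y)"
      using cube_representative[of x] f(2) by metis
    have "x' + y \<in> S" using x' y by (force simp: S_def)
    moreover have "x' \<in> S" using x'(1) unfolding S_def by (intro CollectI exI[of _ x'] exI[of _ 0]) auto
    ultimately have "dist (f (x' + y)) (f x') < e" using y by (intro d) (auto simp: dist_norm)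
    then show ?thesis using x'(2)[of y] x'(2)[of 0] by (simp add: dist_real_def)
  qed
  then show ?thesis using that[of "min d 1"] d(1) by simp
qed

text \<open>The normalized powers of this function concentrate at the lattice points, where it is 1.\<close>

definition bump :: "real^'n::finite \<Rightarrow> real" where
  "bump y = (\<Sum>i\<in>UNIV. (1/2 + 1/2 * cos_wave (axis i 1) y) / real CARD('n))"

lemma bump_trig_polys: "bump \<in> trig_polys"
proof -
  have "(\<lambda>y. (1/2 + 1/2 * cos_wave (axis i 1) y) / real CARD('a)) \<in> (trig_polys :: (real^'a \<Rightarrow> real) set)" for i
    using trig_polys_scale[OF trig_polys_add[OF trig_polys_const trig_polys_scale[OF trig_polys.cos]],
        of "1 / real CARD('a)" "1/2" "1/2" "axis i 1"] by simp
  then show ?thesis unfolding bump_def[abs_def] by (intro trig_polys_sum) auto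
qed

lemma bump_continuous: "continuous_on S bump"
  by (intro test_functions_continuous trig_polys_test_functions bump_trig_polys)

lemma bump_range: "0 \<le> bump y" "bump y \<le> 1"
proof -
  have c: "- 1 \<le> cos_wave \<xi> y" "cos_wave \<xi> y \<le> 1" for \<xi> by (simp_all add: cos_wave_def)
  have "0 \<le> 1/2 + 1/2 * cos_wave (axis i 1) y" for i using c[of "axis i 1"] by simp
  then show "0 \<le> bump y" unfolding bump_def by (intro sum_nonneg divide_nonneg_nonneg) auto
  have "bump y \<le> (\<Sum>i\<in>(UNIV::'a set). 1 / real CARD('a))" unfolding bump_def
  proof (intro sum_mono divide_right_mono)
    fix i show "1/2 + 1/2 * cos_wave (axis i 1) y \<le> 1" using c(2)[of "axis i 1"] by simp
  qed simp
  then show "bump y \<le> 1" by simp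
qed

lemma bump_0: "bump 0 = 1"
  by (simp add: bump_def cos_wave_def)

text \<open>\<open>bump\<close> averages terms that are at most 1, so the value 1 forces every term,
  and thus every cosine, to be 1.\<close>

lemma bump_eq_1_imp_lattice:
  fixes y :: "real^'n::finite"
  assumes "bump y = 1"
  shows "\<exists>\<xi>. y = lattice_vec \<xi>"
proof -
  have "\<exists>k::int. y $ i = k" for i
  proof -
    have "(\<Sum>i\<in>(UNIV::'n set). (1/2 - 1/2 * cos_wave (axis i 1) y) / real CARD('n)) =
      (\<Sum>i\<in>(UNIV::'n set). 1 / real CARD('n)) - bump y"
      unfolding bump_def by (simp only: sum_subtractf[symmetric]) (simp add: field_simps)
    also have "\<dots> = 0" using assms by simp
    finally have "\<forall>i\<in>UNIV. (1/2 - 1/2 * cos_wave (axis i 1) y) / real CARD('n) = 0"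
      by (subst (asm) sum_nonneg_eq_0_iff) (auto simp: cos_wave_def)
    then have "cos (2 * pi * (y \<bullet> lattice_vec (axis i 1))) = 1" by (simp add: cos_wave_def)
    moreover have "lattice_vec (axis i 1) = axis i 1" by (simp add: vec_eq_iff axis_def)
    ultimately have "cos (2 * pi * y $ i) = 1" by (simp add: inner_axis)
    then show ?thesis unfolding cos_one_2pi_int by (auto simp: field_simps)
  qed
  then obtain k where "\<And>i. y $ i = of_int (k i)" by metis
  then have "y = lattice_vec (\<chi> i. k i)" by (simp add: vec_eq_iff)
  then show ?thesis by blast
qed

definition bump_kernel :: "nat \<Rightarrow> real^'n::finite \<Rightarrow> real" where
  "bump_kernel m y = 1 / integral (cbox 0 1) (\<lambda>y::real^'n. bump y ^ m) * bump y ^ m"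

lemma bump_kernel_trig_polys: "bump_kernel m \<in> trig_polys"
  unfolding bump_kernel_def[abs_def] by (intro trig_polys_scale trig_polys_power bump_trig_polys)

lemma bump_kernel_continuous: "continuous_on S (bump_kernel m)"
  by (intro test_functions_continuous trig_polys_test_functions bump_kernel_trig_polys)

lemma content_unit_cube [simp]: "measure lborel (cbox 0 (1::real^'n::finite)) = 1"
  by (subst content_cbox_cart) (auto simp: interval_ne_empty_cart)

text \<open>By continuity at 0, where \<open>bump\<close> is 1, it is at least \<open>s\<close> on a
  small cube \<open>C\<close>. The volume of \<open>C\<close> serves as \<open>v\<close> and is
  independent of the power \<open>m\<close>.\<close>

lemma bump_integral_lower:
  assumes "0 \<le> s" "s < 1"
  obtains v where "v > 0" "\<And>m. integral (cbox 0 (1::real^'n::finite)) (\<lambda>y. bump y ^ m) \<ge> v * s ^ m"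
proof -
  have "isCont (bump :: real^'n \<Rightarrow> real) 0"
    using bump_continuous[of "UNIV :: (real^'n) set"] by (simp add: continuous_on_eq_continuous_at)
  note near = this[unfolded continuous_at_eps_delta, rule_format, of "1 - s"]
  obtain d where d: "d > 0" "\<And>y::real^'n. dist y 0 < d \<Longrightarrow> dist (bump y) (bump (0::real^'n)) < 1 - s"
    using near assms by (metis diff_gt_0_iff_gt)
  \<comment> \<open>The norm is at most the sum of the absolute coordinates, so this side length
    keeps \<open>C\<close> within distance \<open>d / 2\<close> of 0; the cap 1 keeps it inside the
    unit cube.\<close>
  define \<eta> where "\<eta> = min 1 (d / (2 * real CARD('n)))"
  have \<eta>: "\<eta> > 0" "\<eta> \<le> 1" using d(1) by (auto simp: \<eta>_def)
  define C where "C = cbox 0 (\<chi> i. \<eta> :: real^'n)"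
  have C_sub: "C \<subseteq> cbox 0 1"
    using \<eta>(2) by (auto simp: C_def mem_box_cart) (meson order_trans)
  have low: "s \<le> bump y" if "y \<in> C" for y
  proof -
    have "norm y \<le> (\<Sum>i\<in>UNIV. \<bar>y $ i\<bar>)" by (rule norm_le_l1_cart)
    also have "\<dots> \<le> (\<Sum>i\<in>(UNIV::'n set). \<eta>)"
      using that by (intro sum_mono) (auto simp: C_def mem_box_cart)
    also have "\<dots> \<le> d / 2" using d(1) by (simp add: \<eta>_def min_def field_simps)
    finally have "norm y < d" using d(1) by simp
    then show ?thesis using d(2)[of y] by (auto simp: dist_real_def bump_0)
  qed
  have "measure lborel C * s ^ m \<le> integral (cbox 0 (1::real^'n)) (\<lambda>y. bump y ^ m)" for m
  proof -
    have i: "(\<lambda>y. bump y ^ m) integrable_on cbox a b" for a b :: "real^'n"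
      by (intro integrable_cube continuous_on_power bump_continuous)
    have "measure lborel C * s ^ m = integral C (\<lambda>y. s ^ m)" by (simp add: C_def)
    also have "\<dots> \<le> integral C (\<lambda>y. bump y ^ m)"
      unfolding C_def by (intro integral_le i power_mono assms low) (auto simp: C_def)
    also have "\<dots> \<le> integral (cbox 0 (1::real^'n)) (\<lambda>y. bump y ^ m)"
      by (intro integral_subset_le C_sub i) (auto simp: C_def i bump_range)
    finally show ?thesis .
  qed
  moreover have "measure lborel C > 0"
    unfolding C_def by (subst content_cbox_cart) (use \<eta> in \<open>auto simp: interval_ne_empty_cart intro!: prod_pos\<close>)
  ultimately show ?thesis using that by blast
qed

lemma bump_integral_pos: "integral (cbox 0 (1::real^'n::finite)) (\<lambda>y. bump y ^ m) > 0"
proof -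
  obtain v where v: "v > 0" "\<And>m. integral (cbox 0 (1::real^'n)) (\<lambda>y. bump y ^ m) \<ge> v * (1/2) ^ m"
    using bump_integral_lower[of "1/2"] by auto
  have "0 < v * (1/2) ^ m" using v(1) by simp
  also have "\<dots> \<le> integral (cbox 0 (1::real^'n)) (\<lambda>y. bump y ^ m)" by (rule v(2))
  finally show ?thesis .
qed

lemma bump_kernel_nonneg: "bump_kernel m y \<ge> 0"
  unfolding bump_kernel_def using bump_integral_pos[where 'n = 'a]
  by (intro mult_nonneg_nonneg divide_nonneg_nonneg zero_le_power bump_range) (auto simp: less_imp_le)

lemma bump_kernel_integral: "integral (cbox 0 1) (bump_kernel m) = 1"
  using bump_integral_pos[of m, where 'n = 'a] by (simp add: bump_kernel_def[abs_def])

text \<open>Away from the lattice, \<open>bump\<close> is at most some \<open>r < 1\<close> by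
  compactness. The normalizing integral is at least \<open>v * s ^ m\<close> for an \<open>s\<close>
  strictly between \<open>r\<close> and 1, so the quotient is at most a multiple of
  \<open>(r / s) ^ m\<close>.\<close>

lemma bump_kernel_away:
  assumes d: "d > 0"
  obtains \<epsilon> :: "nat \<Rightarrow> real" where "\<epsilon> \<longlonglongrightarrow> 0" "\<And>m. \<epsilon> m \<ge> 0"
    "\<And>m y. y \<in> cbox 0 (1::real^'n::finite) \<Longrightarrow> (\<And>\<xi>. norm (y - lattice_vec \<xi>) \<ge> d) \<Longrightarrow> bump_kernel m y \<le> \<epsilon> m"
proof -
  \<comment> \<open>All lattice points are excluded, not just 0: the closed cube contains its other
    corners as well, and \<open>bump\<close> is 1 at each of them.\<close>
  define F where "F = cbox 0 (1::real^'n) - (\<Union>\<xi>. ball (lattice_vec \<xi>) d)"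
  have "compact F" unfolding F_def by (intro compact_diff compact_cbox open_UN) auto
  have "\<exists>r. 0 \<le> r \<and> r < 1 \<and> (\<forall>y\<in>F. bump y \<le> r)"
  proof (cases "F = {}")
    case False
    obtain z where z: "z \<in> F" "\<And>y. y \<in> F \<Longrightarrow> bump y \<le> bump z"
      using continuous_attains_sup[OF \<open>compact F\<close> False bump_continuous] by blast
    have "bump z \<noteq> 1"
    proof
      assume "bump z = 1"
      then obtain \<xi> where "z = lattice_vec \<xi>" using bump_eq_1_imp_lattice by blast
      moreover have "z \<notin> ball (lattice_vec \<xi>) d" using z(1) by (auto simp: F_def)
      ultimately show False using d by simp
    qed
    then show ?thesis using z(2) bump_range[of z] by (intro exI[of _ "bump z"]) auto
  qed (auto intro: exI[of _ 0])
  then obtain r where r: "0 \<le> r" "r < 1" "\<And>y. y \<in> F \<Longrightarrow> bump y \<le> r" by blast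
  define s where "s = (1 + r) / 2"
  have s: "0 < s" "s < 1" "r < s" using r by (auto simp: s_def)
  obtain v where v: "v > 0" "\<And>m. integral (cbox 0 (1::real^'n)) (\<lambda>y. bump y ^ m) \<ge> v * s ^ m"
    using bump_integral_lower[of s] s by (metis less_imp_le)
  show ?thesis
  proof (rule that[of "\<lambda>m. 1 / v * (r / s) ^ m"])
    have "(\<lambda>m. (r / s) ^ m) \<longlonglongrightarrow> 0" using r s by (intro LIMSEQ_realpow_zero) auto
    from tendsto_mult_left[OF this, of "1 / v"] show "(\<lambda>m. 1 / v * (r / s) ^ m) \<longlonglongrightarrow> 0" by simp
    show "1 / v * (r / s) ^ m \<ge> 0" for m using r s v(1) by simp
  next
    fix m and y :: "real^'n" assume "y \<in> cbox 0 1" "\<And>\<xi>. norm (y - lattice_vec \<xi>) \<ge> d"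
    then have "y \<in> F" by (auto simp: F_def dist_norm norm_minus_commute not_less)
    then have "bump y ^ m \<le> r ^ m" using r bump_range[of y] by (intro power_mono) auto
    have "bump_kernel m y = bump y ^ m / integral (cbox 0 (1::real^'n)) (\<lambda>y. bump y ^ m)"
      by (simp add: bump_kernel_def)
    also have "\<dots> \<le> r ^ m / (v * s ^ m)"
      using \<open>bump y ^ m \<le> r ^ m\<close> v s r bump_range[of y] by (intro frac_le) auto
    also have "\<dots> = 1 / v * (r / s) ^ m" by (simp add: power_divide)
    finally show "bump_kernel m y \<le> 1 / v * (r / s) ^ m" .
  qed
qed

text \<open>An approximate identity on the torus. If y is close to a lattice point, periodicity
  turns \<open>f (x + y)\<close> into a value of \<open>f\<close> close to x, and the kernel has
  integral 1. Elsewhere the kernel is uniformly small and \<open>f\<close> is bounded.\<close>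

lemma mollify_bump_kernel_uniform_limit:
  fixes f :: "real^'n::finite \<Rightarrow> real"
  assumes f: "continuous_on UNIV f" "periodic f"
  shows "uniform_limit UNIV (\<lambda>m. mollify (bump_kernel m) f) f sequentially"
proof (rule uniform_limitI)
  fix e :: real assume e: "e > 0"
  obtain B where B: "B > 0" "\<And>x. \<bar>f x\<bar> \<le> B" using periodic_bounded[OF f] by blast
  obtain d where d: "d > 0" "\<And>x y. norm y < d \<Longrightarrow> \<bar>f (x + y) - f x\<bar> < e / 2"
    using periodic_uniformly_continuous[OF f, of "e / 2"] e by auto
  obtain \<epsilon> :: "nat \<Rightarrow> real" where \<epsilon>: "\<epsilon> \<longlonglongrightarrow> 0" "\<And>m. \<epsilon> m \<ge> 0"
    "\<And>m y. y \<in> cbox 0 (1::real^'n) \<Longrightarrow> (\<And>\<xi>. norm (y - lattice_vec \<xi>) \<ge> d) \<Longrightarrow> bump_kernel m y \<le> \<epsilon> m"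
    using bump_kernel_away[OF d(1)] by blast
  have bound: "\<bar>mollify (bump_kernel m) f x - f x\<bar> \<le> e / 2 + 2 * B * \<epsilon> m" for m x
  proof -
    have Kint: "((bump_kernel m :: real^'n \<Rightarrow> real) has_integral 1) (cbox 0 1)"
      using integrable_integral[OF integrable_cube[OF bump_kernel_continuous]] bump_kernel_integral by metis
    have "((\<lambda>y. bump_kernel m y * f (x + y)) has_integral mollify (bump_kernel m) f x) (cbox 0 1)"
      unfolding mollify_def
      by (intro integrable_integral integrable_cube continuous_on_mult bump_kernel_continuous continuous_on_translate f)
    from has_integral_diff[OF this has_integral_mult_left[OF Kint, of "f x"]]
    have I: "((\<lambda>y. bump_kernel m y * (f (x + y) - f x)) has_integral mollify (bump_kernel m) f x - f x) (cbox 0 1)"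
      by (simp add: right_diff_distrib)
    have "((\<lambda>y. 2 * B * \<epsilon> m) has_integral 2 * B * \<epsilon> m) (cbox 0 (1::real^'n))"
      using has_integral_const[of "2 * B * \<epsilon> m" 0 "1::real^'n"] by simp
    from has_integral_add[OF has_integral_mult_left[OF Kint, of "e / 2"] this]
    have J: "((\<lambda>y. bump_kernel m y * (e / 2) + 2 * B * \<epsilon> m) has_integral e / 2 + 2 * B * \<epsilon> m) (cbox 0 (1::real^'n))"
      by simp
    have "norm (integral (cbox 0 1) (\<lambda>y. bump_kernel m y * (f (x + y) - f x))) \<le>
        integral (cbox 0 (1::real^'n)) (\<lambda>y. bump_kernel m y * (e / 2) + 2 * B * \<epsilon> m)"
    proof (rule integral_norm_bound_integral)
      fix y :: "real^'n" assume y: "y \<in> cbox 0 1"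
      have K0: "bump_kernel m y \<ge> 0" by (rule bump_kernel_nonneg)
      show "norm (bump_kernel m y * (f (x + y) - f x)) \<le> bump_kernel m y * (e / 2) + 2 * B * \<epsilon> m"
      proof (cases "\<exists>\<xi>. norm (y - lattice_vec \<xi>) < d")
        case True
        then obtain \<xi> where \<xi>: "norm (y - lattice_vec \<xi>) < d" by blast
        have "f (x + y) = f (x + (y - lattice_vec \<xi>))"
          using periodic_add_lattice_vec[OF f(2), of "x + (y - lattice_vec \<xi>)" \<xi>] by simp
        then have "\<bar>f (x + y) - f x\<bar> \<le> e / 2" using d(2)[OF \<xi>, of x] by simp
        then have "bump_kernel m y * \<bar>f (x + y) - f x\<bar> \<le> bump_kernel m y * (e / 2)"
          using K0 by (rule mult_left_mono)
        moreover have "2 * B * \<epsilon> m \<ge> 0" using B \<epsilon>(2)[of m] by simp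
        ultimately show ?thesis using K0 by (simp add: abs_mult)
      next
        case False
        then have "bump_kernel m y \<le> \<epsilon> m" by (intro \<epsilon>(3)[OF y]) (auto simp: not_less)
        moreover have "\<bar>f (x + y) - f x\<bar> \<le> 2 * B" using B(2)[of x] B(2)[of "x + y"] by simp
        ultimately have "bump_kernel m y * \<bar>f (x + y) - f x\<bar> \<le> \<epsilon> m * (2 * B)"
          using K0 \<epsilon>(2)[of m] by (intro mult_mono) auto
        moreover have "bump_kernel m y * (e / 2) \<ge> 0" using K0 e by simp
        ultimately show ?thesis using K0 by (simp add: abs_mult mult_ac)
      qed
    qed (use I J in \<open>auto simp: has_integral_iff\<close>)
    then show ?thesis using I J by (simp add: has_integral_iff)
  qed
  have "(\<lambda>m. 2 * B * \<epsilon> m) \<longlonglongrightarrow> 0" using tendsto_mult_left[OF \<epsilon>(1), of "2 * B"] by simp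
  then have "\<forall>\<^sub>F m in sequentially. 2 * B * \<epsilon> m < e / 2" using e by (intro order_tendstoD) auto
  then show "\<forall>\<^sub>F m in sequentially. \<forall>x\<in>UNIV. dist (mollify (bump_kernel m) f x) (f x) < e"
  proof (rule eventually_mono)
    fix m assume m: "2 * B * \<epsilon> m < e / 2"
    show "\<forall>x\<in>UNIV. dist (mollify (bump_kernel m) f x) (f x) < e"
    proof
      fix x show "dist (mollify (bump_kernel m) f x) (f x) < e"
        using bound[of m x] m unfolding dist_real_def by linarith
    qed
  qed
qed

text \<open>Convergence of test functions means uniform convergence of every derivative. As
  mollification commutes with \<open>partials\<close>, each continuous periodic derivative is
  approximated by its own mollification.\<close>

lemma trig_polys_dense:
  fixes \<phi> :: "real^'n::finite \<Rightarrow> real"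
  assumes \<phi>: "\<phi> \<in> test_functions"
  shows "\<exists>\<Phi>. (\<forall>m. \<Phi> m \<in> trig_polys) \<and> test_converges \<Phi> \<phi>"
proof (intro exI conjI allI)
  have s: "smooth \<phi>" "periodic \<phi>" using \<phi> by (auto simp: test_functions_def)
  show "mollify (bump_kernel m) \<phi> \<in> trig_polys" for m
    by (intro mollify_trig_polys bump_kernel_trig_polys test_functions_continuous \<phi> s)
  show "test_converges (\<lambda>m. mollify (bump_kernel m) \<phi>) \<phi>"
    unfolding test_converges_def partials_mollify[OF bump_kernel_continuous s(1)]
    using test_functions_partials[OF \<phi>]
    by (intro allI mollify_bump_kernel_uniform_limit test_functions_continuous)
      (auto simp: test_functions_def)
qed

lemma periodic_distributions_lincomb:
  "g \<in> periodic_distributions \<Longrightarrow> \<phi> \<in> test_functions \<Longrightarrow> \<psi> \<in> test_functions \<Longrightarrow>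
    g (\<lambda>x. a * \<phi> x + b * \<psi> x) = a * g \<phi> + b * g \<psi>"
  unfolding periodic_distributions_def by blast

lemma periodic_distributions_tendsto:
  "g \<in> periodic_distributions \<Longrightarrow> \<phi> \<in> test_functions \<Longrightarrow> (\<And>m. \<Phi> m \<in> test_functions) \<Longrightarrow>
    test_converges \<Phi> \<phi> \<Longrightarrow> (\<lambda>m. g (\<Phi> m)) \<longlonglongrightarrow> g \<phi>"
  unfolding periodic_distributions_def by blast

lemma fourier_waves: "fourier g \<xi> = Complex (g (cos_wave \<xi>)) (- g (sin_wave \<xi>))"
  by (simp add: fourier_def cos_wave_def sin_wave_def)

theorem dist_eq_if_fourier_eq:
  assumes g: "g \<in> periodic_distributions" and h: "h \<in> periodic_distributions"
    and eq: "\<And>\<xi>. fourier g \<xi> = fourier h \<xi>"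
  shows "g \<doteq> h"
  unfolding dist_eq_def
proof
  have tp: "g f = h f" if "f \<in> trig_polys" for f
    using that
  proof induction
    case (lincomb f k a b)
    then show ?case using g h
      by (simp add: periodic_distributions_lincomb trig_polys_test_functions)
  qed (use eq in \<open>auto simp: fourier_waves\<close>)
  fix \<phi> :: "real^'a \<Rightarrow> real" assume \<phi>: "\<phi> \<in> test_functions"
  then obtain \<Phi> where \<Phi>: "\<And>m. \<Phi> m \<in> trig_polys" "test_converges \<Phi> \<phi>" using trig_polys_dense by blast
  have "(\<lambda>m. g (\<Phi> m)) \<longlonglongrightarrow> g \<phi>"
    by (rule periodic_distributions_tendsto[OF g \<phi> trig_polys_test_functions[OF \<Phi>(1)] \<Phi>(2)])
  moreover have "(\<lambda>m. g (\<Phi> m)) \<longlonglongrightarrow> h \<phi>"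
    unfolding tp[OF \<Phi>(1)]
    by (rule periodic_distributions_tendsto[OF h \<phi> trig_polys_test_functions[OF \<Phi>(1)] \<Phi>(2)])
  ultimately show "g \<phi> = h \<phi>" by (rule LIMSEQ_unique)
qed

section \<open>Square-integrable functions\<close>

lemma integrable_mult_l2:
  fixes f g :: "'a \<Rightarrow> real"
  assumes [measurable]: "f \<in> borel_measurable M" "g \<in> borel_measurable M"
    and f: "integrable M (\<lambda>x. (f x)\<^sup>2)" and g: "integrable M (\<lambda>x. (g x)\<^sup>2)"
  shows "integrable M (\<lambda>x. f x * g x)"
proof (rule Bochner_Integration.integrable_bound)
  show "integrable M (\<lambda>x. (f x)\<^sup>2 + (g x)\<^sup>2)" using f g by simp
  have "\<bar>a * b\<bar> \<le> a\<^sup>2 + b\<^sup>2" for a b :: real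
    using sum_squares_bound[of "\<bar>a\<bar>" "\<bar>b\<bar>"] zero_le_power2[of a] zero_le_power2[of b]
    unfolding abs_mult power2_abs by linarith
  then show "AE x in M. norm (f x * g x) \<le> norm ((f x)\<^sup>2 + (g x)\<^sup>2)" by simp
qed simp

lemma integral_Cauchy_Schwarz:
  fixes f g :: "'a \<Rightarrow> real"
  assumes m: "f \<in> borel_measurable M" "g \<in> borel_measurable M"
    and f: "integrable M (\<lambda>x. (f x)\<^sup>2)" and g: "integrable M (\<lambda>x. (g x)\<^sup>2)"
  shows "(\<integral>x. f x * g x \<partial>M)\<^sup>2 \<le> (\<integral>x. (f x)\<^sup>2 \<partial>M) * (\<integral>x. (g x)\<^sup>2 \<partial>M)"
proof -
  define A where "A = (\<integral>x. (f x)\<^sup>2 \<partial>M)"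
  define B where "B = (\<integral>x. (g x)\<^sup>2 \<partial>M)"
  define C where "C = (\<integral>x. f x * g x \<partial>M)"
  have fg: "integrable M (\<lambda>x. f x * g x)" by (rule integrable_mult_l2[OF m f g])
  have q: "0 \<le> A + 2 * t * C + t\<^sup>2 * B" for t
  proof -
    have "0 \<le> (\<integral>x. (f x + t * g x)\<^sup>2 \<partial>M)" by (rule integral_nonneg_AE) simp
    also have "(\<lambda>x. (f x + t * g x)\<^sup>2) = (\<lambda>x. (f x)\<^sup>2 + 2 * t * (f x * g x) + t\<^sup>2 * (g x)\<^sup>2)"
      by (simp add: fun_eq_iff power2_eq_square algebra_simps)
    also have "(\<integral>x. \<dots> x \<partial>M) = A + 2 * t * C + t\<^sup>2 * B"
      using f g fg by (simp add: A_def B_def C_def)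
    finally show ?thesis .
  qed
  have "B \<ge> 0" unfolding B_def by (rule integral_nonneg_AE) simp
  have "C\<^sup>2 \<le> A * B"
  proof (cases "B = 0")
    case True
    have "C = 0"
    proof (rule ccontr)
      assume "C \<noteq> 0"
      \<comment> \<open>With \<open>B = 0\<close> the quadratic is affine in t, and this t gives it
        the value -1.\<close>
      then show False using q[of "- (A + 1) / (2 * C)"] True by (simp add: field_simps)
    qed
    then show ?thesis using True by simp
  next
    case False
    then have "B > 0" using \<open>B \<ge> 0\<close> by simp
    have "0 \<le> B * (A + 2 * (- C / B) * C + (- C / B)\<^sup>2 * B)"
      using q[of "- C / B"] \<open>B > 0\<close> by (intro mult_nonneg_nonneg) auto
    also have "\<dots> = A * B - C\<^sup>2" using \<open>B > 0\<close> by (simp add: field_simps power2_eq_square)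
    finally show ?thesis by simp
  qed
  then show ?thesis by (simp add: A_def B_def C_def)
qed

lemma integrable_power2_diff:
  fixes f g :: "'a \<Rightarrow> real"
  assumes m: "f \<in> borel_measurable M" "g \<in> borel_measurable M"
    and f: "integrable M (\<lambda>x. (f x)\<^sup>2)" and g: "integrable M (\<lambda>x. (g x)\<^sup>2)"
  shows "integrable M (\<lambda>x. (f x - g x)\<^sup>2)"
  using f g integrable_mult_l2[OF m f g] by (simp add: power2_diff mult.assoc)

text \<open>Pointwise \<open>\<bar>d k x\<bar> \<le> (1/2)^k + 2^k * (d k x)^2\<close>, according to
  whether the left side is below \<open>(1/2)^k\<close>. With squared norms at most
  \<open>(1/4)^k\<close> on a finite measure space, both terms integrate to multiples of
  \<open>(1/2)^k\<close>, so the sum of the absolute values has a finite integral.\<close>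

lemma (in finite_measure) AE_convergent_if_summable_L2:
  fixes d :: "nat \<Rightarrow> 'a \<Rightarrow> real"
  assumes m[measurable]: "\<And>k. d k \<in> borel_measurable M"
    and i: "\<And>k. integrable M (\<lambda>x. (d k x)\<^sup>2)"
    and le: "\<And>k. (\<integral>x. (d k x)\<^sup>2 \<partial>M) \<le> (1/4) ^ k"
  shows "AE x in M. summable (\<lambda>k. \<bar>d k x\<bar>)"
proof -
  define K where "K = measure M (space M) + 1"
  have "(\<integral>\<^sup>+x. ennreal \<bar>d k x\<bar> \<partial>M) \<le> ennreal (K * (1/2) ^ k)" for k
  proof -
    have le1: "\<bar>d k x\<bar> \<le> (1/2) ^ k + 2 ^ k * (d k x)\<^sup>2" for x
    proof (cases "\<bar>d k x\<bar> \<le> (1/2) ^ k")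
      case False
      then have "1 \<le> 2 ^ k * \<bar>d k x\<bar>" by (simp add: field_simps power_divide)
      then have "1 * \<bar>d k x\<bar> \<le> 2 ^ k * \<bar>d k x\<bar> * \<bar>d k x\<bar>" by (intro mult_right_mono) auto
      also have "\<dots> = 2 ^ k * (d k x)\<^sup>2" by (simp add: power2_eq_square mult.assoc)
      finally have "\<bar>d k x\<bar> \<le> 2 ^ k * (d k x)\<^sup>2" by simp
      moreover have "(1/2::real) ^ k \<ge> 0" by simp
      ultimately show ?thesis by linarith
    qed (simp add: add_increasing2)
    have "(\<integral>\<^sup>+x. ennreal \<bar>d k x\<bar> \<partial>M) \<le> (\<integral>\<^sup>+x. ennreal ((1/2) ^ k + 2 ^ k * (d k x)\<^sup>2) \<partial>M)"
      by (intro nn_integral_mono ennreal_leI le1)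
    also have "\<dots> = ennreal (\<integral>x. (1/2) ^ k + 2 ^ k * (d k x)\<^sup>2 \<partial>M)"
      using i by (intro nn_integral_eq_integral) auto
    also have "(\<integral>x. (1/2) ^ k + 2 ^ k * (d k x)\<^sup>2 \<partial>M) = measure M (space M) * (1/2) ^ k + 2 ^ k * (\<integral>x. (d k x)\<^sup>2 \<partial>M)"
      using i by simp
    also have "ennreal \<dots> \<le> ennreal (K * (1/2) ^ k)"
    proof (rule ennreal_leI)
      have "2 ^ k * (\<integral>x. (d k x)\<^sup>2 \<partial>M) \<le> 2 ^ k * (1/4) ^ k" using le by (intro mult_left_mono) auto
      also have "(2::real) ^ k * (1/4) ^ k = (1/2) ^ k" by (simp flip: power_mult_distrib)
      finally show "measure M (space M) * (1/2) ^ k + 2 ^ k * (\<integral>x. (d k x)\<^sup>2 \<partial>M) \<le> K * (1/2) ^ k"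
        by (simp add: K_def algebra_simps)
    qed
    finally show ?thesis .
  qed
  then have "(\<Sum>k. \<integral>\<^sup>+x. ennreal \<bar>d k x\<bar> \<partial>M) \<le> (\<Sum>k. ennreal (K * (1/2) ^ k))"
    by (intro suminf_le) auto
  also have "\<dots> = ennreal (\<Sum>k. K * (1/2) ^ k)"
    by (intro suminf_ennreal2 summable_mult summable_geometric) (auto simp: K_def)
  finally have "(\<integral>\<^sup>+x. (\<Sum>k. ennreal \<bar>d k x\<bar>) \<partial>M) < \<infinity>"
    by (subst nn_integral_suminf) (auto simp: le_less_trans)
  then have "AE x in M. (\<Sum>k. ennreal \<bar>d k x\<bar>) \<noteq> \<infinity>"
    by (intro nn_integral_PInf_AE) auto
  then show ?thesis by eventually_elim (auto intro: summable_suminf_not_top)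
qed

text \<open>A subsequence with squared increments below \<open>(1/4)^k\<close> converges almost
  everywhere, and Fatou's lemma compares its limit with every \<open>h j\<close>. The bound by
  \<open>\<delta> j\<close> thus holds along the full sequence.\<close>

lemma (in finite_measure) L2_complete:
  fixes h :: "nat \<Rightarrow> 'a \<Rightarrow> real"
  assumes m[measurable]: "\<And>k. h k \<in> borel_measurable M"
    and i: "\<And>k. integrable M (\<lambda>x. (h k x)\<^sup>2)"
    and cauchy: "\<And>m k. k \<le> m \<Longrightarrow> (\<integral>x. (h m x - h k x)\<^sup>2 \<partial>M) \<le> \<delta> k"
    and \<delta>: "\<delta> \<longlonglongrightarrow> 0"
  obtains G where "G \<in> borel_measurable M" "integrable M (\<lambda>x. (G x)\<^sup>2)"
    "(\<lambda>k. \<integral>x. (G x - h k x)\<^sup>2 \<partial>M) \<longlonglongrightarrow> 0"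
proof -
  have idiff: "integrable M (\<lambda>x. (h j x - h k x)\<^sup>2)" for j k
    by (rule integrable_power2_diff[OF m m i i])
  have "\<exists>N. \<forall>n\<ge>N. \<delta> n < (1/4) ^ k" for k
    using order_tendstoD(2)[OF \<delta>, of "(1/4) ^ k"] by (simp add: eventually_sequentially)
  then obtain N where N: "\<And>k n. n \<ge> N k \<Longrightarrow> \<delta> n < (1/4) ^ k" by metis
  \<comment> \<open>Adding k and all thresholds up to k makes \<open>r\<close> increasing and at
    least both k and \<open>N k\<close>.\<close>
  define r where "r k = k + (\<Sum>i\<le>k. N i)" for k
  have r: "r k \<ge> k" "r k \<ge> N k" "r k \<le> r (Suc k)" for k
    using member_le_sum[of k "{..k}" N] by (auto simp: r_def)
  define d where "d k x = h (r (Suc k)) x - h (r k) x" for k x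
  have "AE x in M. summable (\<lambda>k. \<bar>d k x\<bar>)"
  proof (rule AE_convergent_if_summable_L2)
    show "(\<integral>x. (d k x)\<^sup>2 \<partial>M) \<le> (1/4) ^ k" for k
      using cauchy[OF r(3)[of k]] N[OF r(2)[of k]] unfolding d_def by linarith
  qed (use idiff in \<open>auto simp: d_def[abs_def]\<close>)
  then have conv: "AE x in M. convergent (\<lambda>k. h (r k) x)"
  proof eventually_elim
    case (elim x)
    then have "summable (\<lambda>k. d k x)" by (rule summable_rabs_cancel)
    then have "(\<lambda>n. h (r 0) x + (\<Sum>k<n. d k x)) \<longlonglongrightarrow> h (r 0) x + (\<Sum>k. d k x)"
      by (intro tendsto_intros summable_LIMSEQ)
    moreover have "h (r 0) x + (\<Sum>k<n. d k x) = h (r n) x" for n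
      unfolding d_def by (induction n) auto
    ultimately show ?case by (auto simp: convergent_def)
  qed
  define G where "G x = lim (\<lambda>k. h (r k) x)" for x
  have Gm[measurable]: "G \<in> borel_measurable M"
    unfolding G_def[abs_def] by (intro borel_measurable_lim_metric m)
  have nn: "(\<integral>\<^sup>+x. ennreal ((G x - h j x)\<^sup>2) \<partial>M) \<le> ennreal (\<delta> j)" for j
  proof -
    have "(\<integral>\<^sup>+x. ennreal ((G x - h j x)\<^sup>2) \<partial>M) = (\<integral>\<^sup>+x. liminf (\<lambda>k. ennreal ((h (r k) x - h j x)\<^sup>2)) \<partial>M)"
    proof (rule nn_integral_cong_AE)
      show "AE x in M. ennreal ((G x - h j x)\<^sup>2) = liminf (\<lambda>k. ennreal ((h (r k) x - h j x)\<^sup>2))"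
        using conv
      proof eventually_elim
        case (elim x)
        then have "(\<lambda>k. h (r k) x) \<longlonglongrightarrow> G x" by (simp add: G_def convergent_LIMSEQ_iff)
        then have "(\<lambda>k. ennreal ((h (r k) x - h j x)\<^sup>2)) \<longlonglongrightarrow> ennreal ((G x - h j x)\<^sup>2)"
          by (intro tendsto_intros tendsto_ennrealI)
        then show ?case by (intro lim_imp_Liminf[symmetric]) auto
      qed
    qed
    also have "\<dots> \<le> liminf (\<lambda>k. \<integral>\<^sup>+x. ennreal ((h (r k) x - h j x)\<^sup>2) \<partial>M)"
      by (rule nn_integral_liminf) measurable
    also have "\<dots> \<le> ennreal (\<delta> j)"
    proof (rule Liminf_le)
      show "\<forall>\<^sub>F k in sequentially. (\<integral>\<^sup>+x. ennreal ((h (r k) x - h j x)\<^sup>2) \<partial>M) \<le> ennreal (\<delta> j)"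
        using eventually_ge_at_top[of j]
      proof eventually_elim
        case (elim k)
        then have "j \<le> r k" using r(1)[of k] by simp
        from cauchy[OF this] show ?case
          using idiff by (subst nn_integral_eq_integral) (auto intro: ennreal_leI)
      qed
    qed simp
    finally show ?thesis .
  qed
  have iG: "integrable M (\<lambda>x. (G x - h j x)\<^sup>2)" for j
    using nn[of j] by (intro integrableI_nonneg) (auto simp: le_less_trans)
  have le: "(\<integral>x. (G x - h j x)\<^sup>2 \<partial>M) \<le> \<delta> j" for j
  proof -
    have "\<delta> j \<ge> 0" using cauchy[of j j] by simp
    then show ?thesis using nn[of j] by (subst (asm) nn_integral_eq_integral[OF iG]) auto
  qed
  have "integrable M (\<lambda>x. ((G x - h 0 x) - (- h 0 x))\<^sup>2)"
    by (rule integrable_power2_diff[OF _ _ iG[of 0]]) (use i[of 0] in auto)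
  then have "integrable M (\<lambda>x. (G x)\<^sup>2)" by simp
  moreover have "(\<lambda>k. \<integral>x. (G x - h k x)\<^sup>2 \<partial>M) \<longlonglongrightarrow> 0"
  proof (rule tendsto_sandwich[OF _ _ tendsto_const \<delta>])
    show "\<forall>\<^sub>F k in sequentially. 0 \<le> (\<integral>x. (G x - h k x)\<^sup>2 \<partial>M)" by (auto intro!: integral_nonneg_AE)
  qed (use le in auto)
  ultimately show ?thesis using that Gm by blast
qed

section \<open>Fourier expansions on the torus\<close>

abbreviation torus_measure :: "(real^'n::finite) measure" where
  "torus_measure \<equiv> lebesgue_on torus"

lemma torus_bounds: "box 0 1 \<subseteq> (torus :: (real^'n::finite) set)" "torus \<subseteq> cbox 0 (1 :: real^'n)"
  by (auto simp: torus_def mem_box_cart less_imp_le)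

lemma torus_sets [measurable]: "(torus :: (real^'n::finite) set) \<in> sets lebesgue"
proof -
  have "negligible (torus - box 0 1 :: (real^'n) set)"
    by (rule negligible_subset[OF negligible_frontier_interval[of 0 1]]) (use torus_bounds(2) in auto)
  then have "torus - box 0 1 \<in> sets (lebesgue :: (real^'n) measure)" by (rule negligible_imp_sets)
  moreover have "torus = box 0 1 \<union> (torus - box 0 1 :: (real^'n) set)" using torus_bounds(1) by auto
  ultimately show ?thesis by (metis sets.Un lmeasurable_box fmeasurableD)
qed

lemma torus_lmeasurable: "(torus :: (real^'n::finite) set) \<in> lmeasurable"
  by (rule bounded_set_imp_lmeasurable[OF bounded_subset[OF bounded_cbox torus_bounds(2)] torus_sets])

lemma finite_measure_torus: "finite_measure (torus_measure :: (real^'n::finite) measure)"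
  by (rule finite_measure_lebesgue_on[OF torus_lmeasurable])

lemma set_integrable_torus: "set_integrable lebesgue torus f \<longleftrightarrow> integrable torus_measure f"
  for f :: "real^'n::finite \<Rightarrow> real"
  by (simp add: set_integrable_def integrable_restrict_space torus_sets)

lemma set_integral_torus: "(LINT x:torus|lebesgue. f x) = integral\<^sup>L torus_measure f"
  for f :: "real^'n::finite \<Rightarrow> real"
  by (simp add: set_lebesgue_integral_def integral_restrict_space torus_sets)

lemma continuous_measurable_torus:
  fixes f :: "real^'n::finite \<Rightarrow> 'b::topological_space"
  assumes "continuous_on UNIV f"
  shows "f \<in> borel_measurable torus_measure"
  using assms by (intro measurable_restrict_space1 measurable_completion) (simp add: borel_measurable_continuous_onI)

lemma integrable_torus_bounded:
  fixes f :: "real^'n::finite \<Rightarrow> 'b::{banach, second_countable_topology}"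
  assumes "f \<in> borel_measurable torus_measure" "\<And>x. norm (f x) \<le> B"
  shows "integrable torus_measure f"
  using assms by (intro finite_measure.integrable_const_bound[OF finite_measure_torus, of _ B]) auto

lemma integral_torus_eq_cube:
  fixes f :: "real^'n::finite \<Rightarrow> real"
  assumes "integrable torus_measure f"
  shows "integral\<^sup>L torus_measure f = integral (cbox 0 1) f"
proof -
  have "integral\<^sup>L torus_measure f = integral torus f"
    by (rule lebesgue_integral_eq_integral[OF assms torus_sets])
  also have "\<dots> = integral (cbox 0 1) f"
  proof (rule integral_spike_set)
    show "negligible {x \<in> torus - cbox 0 1. f x \<noteq> 0}"
      using torus_bounds(2) by (auto intro: negligible_subset[of "{}"])
    show "negligible {x \<in> cbox 0 1 - torus. f x \<noteq> 0}"
      using torus_bounds(1) by (intro negligible_subset[OF negligible_frontier_interval[of 0 1]]) auto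
  qed
  finally show ?thesis .
qed

section \<open>Complex exponentials, orthogonality and Parseval's identity\<close>

definition wave :: "int^'n \<Rightarrow> real^'n \<Rightarrow> complex" where
  "wave \<xi> x = Complex (cos_wave \<xi> x) (sin_wave \<xi> x)"

lemma wave_cis: "wave \<xi> x = cis (2 * pi * (x \<bullet> lattice_vec \<xi>))"
  by (simp add: wave_def cis_conv_exp cos_wave_def sin_wave_def complex_eq_iff Re_exp Im_exp)

lemma norm_wave [simp]: "norm (wave \<xi> x) = 1"
  by (simp add: wave_cis)

lemma wave_add: "wave (\<xi> + \<eta>) x = wave \<xi> x * wave \<eta> x"
  by (simp add: wave_cis cis_mult lattice_vec_add inner_add_right distrib_left)

lemma cnj_wave: "cnj (wave \<xi> x) = wave (- \<xi>) x"
  by (simp add: wave_cis cis_cnj)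

lemma wave_continuous: "continuous_on S (wave \<xi>)"
  unfolding wave_cis[abs_def] by (intro continuous_intros continuous_on_cis)

lemma wave_measurable [measurable]: "wave \<xi> \<in> borel_measurable torus_measure"
  by (rule continuous_measurable_torus[OF wave_continuous])

lemma wave_integrable: "integrable torus_measure (wave \<xi>)"
  by (rule integrable_torus_bounded[of _ 1]) auto

text \<open>For a nonzero frequency, translation by half a wavelength along an axis reverses the
  sign of both waves, while the integral over a period is translation invariant.\<close>

lemma integral_wave: "integral\<^sup>L torus_measure (wave \<xi>) = (if \<xi> = 0 then 1 else 0)"
  for \<xi> :: "int^'n::finite"
proof -
  have cs: "integrable torus_measure (cos_wave \<xi>)" "integrable torus_measure (sin_wave \<xi>)"
    using integrable_Re[OF wave_integrable[of \<xi>]] integrable_Im[OF wave_integrable[of \<xi>]] by (simp_all add: wave_def)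
  have Re: "Re (integral\<^sup>L torus_measure (wave \<xi>)) = integral (cbox 0 1) (cos_wave \<xi>)"
    using integral_Re[OF wave_integrable[of \<xi>]] integral_torus_eq_cube[OF cs(1)] by (simp add: wave_def)
  have Im: "Im (integral\<^sup>L torus_measure (wave \<xi>)) = integral (cbox 0 1) (sin_wave \<xi>)"
    using integral_Im[OF wave_integrable[of \<xi>]] integral_torus_eq_cube[OF cs(2)] by (simp add: wave_def)
  show ?thesis
  proof (cases "\<xi> = 0")
    case True
    have "cos_wave (0::int^'n) = (\<lambda>x. 1)" "sin_wave (0::int^'n) = (\<lambda>x. 0)"
      by (simp_all add: cos_wave_def sin_wave_def)
    then show ?thesis using Re Im True by (simp add: complex_eq_iff)
  next
    case False
    then obtain i where i: "\<xi> $ i \<noteq> 0" by (auto simp: vec_eq_iff)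
    define v where "v = (1 / (2 * real_of_int (\<xi> $ i))) *\<^sub>R axis i (1::real)"
    have v: "2 * pi * (v \<bullet> lattice_vec \<xi>) = pi" using i by (simp add: v_def inner_axis')
    have "cos_wave \<xi> (x + v) = - cos_wave \<xi> x" "sin_wave \<xi> (x + v) = - sin_wave \<xi> x" for x
      unfolding cos_wave_def sin_wave_def inner_add_left distrib_left v by simp_all
    moreover have "integral (cbox 0 1) (\<lambda>x. f (x + v)) = integral (cbox 0 1) f" if "f \<in> test_functions" for f
      using that by (intro integral_cube_shift test_functions_continuous) (auto simp: test_functions_def)
    ultimately have "integral (cbox 0 1) (cos_wave \<xi>) = 0" "integral (cbox 0 1) (sin_wave \<xi>) = 0"
      using waves_in_test_functions[of \<xi>] by (metis (no_types, lifting) ext integral_neg neg_equal_zero)+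
    then show ?thesis using Re Im False by (simp add: complex_eq_iff)
  qed
qed

definition trig_sum :: "(int^'n \<Rightarrow> complex) \<Rightarrow> (int^'n) set \<Rightarrow> real^'n \<Rightarrow> complex" where
  "trig_sum c S x = (\<Sum>\<xi>\<in>S. c \<xi> * wave \<xi> x)"

text \<open>Orthogonality with an additional frequency: \<open>\<zeta> = 0\<close> yields Parseval's
  identity, and a general \<zeta> yields the Fourier coefficient of a product at
  \<open>- \<zeta>\<close>.\<close>

lemma integral_trig_sums:
  fixes c d :: "int^'n::finite \<Rightarrow> complex"
  shows "(\<integral>x. trig_sum c S x * trig_sum d T x * wave \<zeta> x \<partial>torus_measure) =
    (\<Sum>\<xi>\<in>S. \<Sum>\<eta>\<in>T. if \<xi> + \<eta> + \<zeta> = 0 then c \<xi> * d \<eta> else 0)"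
proof -
  have "trig_sum c S x * trig_sum d T x * wave \<zeta> x = (\<Sum>\<xi>\<in>S. \<Sum>\<eta>\<in>T. (c \<xi> * d \<eta>) * wave (\<xi> + \<eta> + \<zeta>) x)" for x
  proof -
    have "trig_sum c S x * trig_sum d T x = (\<Sum>\<xi>\<in>S. \<Sum>\<eta>\<in>T. (c \<xi> * wave \<xi> x) * (d \<eta> * wave \<eta> x))"
      by (simp only: trig_sum_def sum_product)
    then have "trig_sum c S x * trig_sum d T x * wave \<zeta> x =
        (\<Sum>\<xi>\<in>S. \<Sum>\<eta>\<in>T. (c \<xi> * wave \<xi> x) * (d \<eta> * wave \<eta> x) * wave \<zeta> x)"
      by (simp only: sum_distrib_right)
    also have "\<dots> = (\<Sum>\<xi>\<in>S. \<Sum>\<eta>\<in>T. (c \<xi> * d \<eta>) * wave (\<xi> + \<eta> + \<zeta>) x)"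
      by (intro sum.cong refl) (simp add: wave_add)
    finally show ?thesis .
  qed
  then have "(\<integral>x. trig_sum c S x * trig_sum d T x * wave \<zeta> x \<partial>torus_measure) =
    (\<Sum>\<xi>\<in>S. \<Sum>\<eta>\<in>T. c \<xi> * d \<eta> * integral\<^sup>L torus_measure (wave (\<xi> + \<eta> + \<zeta>)))"
    by (simp add: wave_integrable)
  also have "\<dots> = (\<Sum>\<xi>\<in>S. \<Sum>\<eta>\<in>T. if \<xi> + \<eta> + \<zeta> = 0 then c \<xi> * d \<eta> else 0)"
    unfolding integral_wave by (intro sum.cong refl) auto
  finally show ?thesis .
qed

text \<open>Reindexing by negation turns the sum into its own conjugate.\<close>

lemma trig_sum_real:
  assumes c: "\<And>\<xi>. c (- \<xi>) = cnj (c \<xi>)" and S: "\<And>\<xi>. \<xi> \<in> S \<Longrightarrow> - \<xi> \<in> S"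
  shows "trig_sum c S x = complex_of_real (Re (trig_sum c S x))"
proof -
  have "bij_betw uminus S S" using S by (intro bij_betw_byWitness[where f' = uminus]) auto
  then have "trig_sum c S x = (\<Sum>\<xi>\<in>S. c (- \<xi>) * wave (- \<xi>) x)"
    unfolding trig_sum_def by (rule sum.reindex_bij_betw[symmetric])
  also have "\<dots> = cnj (trig_sum c S x)" by (simp add: trig_sum_def c cnj_wave)
  finally show ?thesis by (metis complex_eq_iff cnj.sel complex_of_real_def complex.sel equation_minus_iff neg_equal_zero)
qed

lemma trig_sum_measurable [measurable]: "(\<lambda>x. Re (trig_sum c S x)) \<in> borel_measurable torus_measure"
  unfolding trig_sum_def by measurable

lemma norm_trig_sum_le: "norm (trig_sum c S x) \<le> (\<Sum>\<xi>\<in>S. norm (c \<xi>))"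
  unfolding trig_sum_def by (rule order_trans[OF norm_sum]) (simp add: norm_mult)

lemma trig_sum_square_integrable: "integrable torus_measure (\<lambda>x. (Re (trig_sum c S x))\<^sup>2)"
proof (rule integrable_torus_bounded)
  fix x
  have "\<bar>Re (trig_sum c S x)\<bar> \<le> (\<Sum>\<xi>\<in>S. norm (c \<xi>))"
    using abs_Re_le_cmod norm_trig_sum_le order_trans by blast
  then have "\<bar>Re (trig_sum c S x)\<bar>\<^sup>2 \<le> (\<Sum>\<xi>\<in>S. norm (c \<xi>))\<^sup>2" by (intro power_mono) auto
  then show "norm ((Re (trig_sum c S x))\<^sup>2) \<le> (\<Sum>\<xi>\<in>S. norm (c \<xi>))\<^sup>2" by simp
qed measurable

lemma integral_trig_sum_square:
  fixes c :: "int^'n::finite \<Rightarrow> complex"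
  assumes c: "\<And>\<xi>. c (- \<xi>) = cnj (c \<xi>)" and S: "\<And>\<xi>. \<xi> \<in> S \<Longrightarrow> - \<xi> \<in> S" "finite S"
  shows "(\<integral>x. (Re (trig_sum c S x))\<^sup>2 \<partial>torus_measure) = (\<Sum>\<xi>\<in>S. (cmod (c \<xi>))\<^sup>2)"
proof -
  have "complex_of_real (\<integral>x. (Re (trig_sum c S x))\<^sup>2 \<partial>torus_measure) =
      (\<integral>x. complex_of_real ((Re (trig_sum c S x))\<^sup>2) \<partial>torus_measure)"
    by (rule integral_complex_of_real[symmetric])
  also have "\<dots> = (\<integral>x. trig_sum c S x * trig_sum c S x * wave 0 x \<partial>torus_measure)"
  proof (intro Bochner_Integration.integral_cong refl)
    fix x
    have "trig_sum c S x = complex_of_real (Re (trig_sum c S x))"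
      by (rule trig_sum_real, rule c, rule S(1))
    then obtain r where "trig_sum c S x = complex_of_real r" by blast
    then show "complex_of_real ((Re (trig_sum c S x))\<^sup>2) = trig_sum c S x * trig_sum c S x * wave 0 x"
      by (simp add: power2_eq_square wave_cis)
  qed
  also have "\<dots> = (\<Sum>\<xi>\<in>S. \<Sum>\<eta>\<in>S. if \<eta> = - \<xi> then c \<xi> * c \<eta> else 0)"
    unfolding integral_trig_sums by (intro sum.cong refl if_cong) (auto simp: add_eq_0_iff)
  also have "\<dots> = (\<Sum>\<xi>\<in>S. c \<xi> * c (- \<xi>))" using S by (simp add: sum.delta)
  also have "\<dots> = complex_of_real (\<Sum>\<xi>\<in>S. (cmod (c \<xi>))\<^sup>2)"
    unfolding of_real_sum by (intro sum.cong refl) (simp only: c complex_norm_square)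
  finally show ?thesis by (simp only: of_real_eq_iff)
qed

text \<open>Mean-square convergence of the box partial sums, stated with integrals so that
  \<open>G\<close> is an actual function. For conjugate-symmetric coefficients the partial sums are
  real, so taking real parts loses nothing.\<close>

definition L2_expansion :: "(real^'n::finite \<Rightarrow> real) \<Rightarrow> (int^'n \<Rightarrow> complex) \<Rightarrow> bool" where
  "L2_expansion G c \<longleftrightarrow> G \<in> borel_measurable torus_measure \<and> integrable torus_measure (\<lambda>x. (G x)\<^sup>2) \<and>
     (\<lambda>N. \<integral>x. (G x - Re (trig_sum c (lattice_box N) x))\<^sup>2 \<partial>torus_measure) \<longlonglongrightarrow> 0"

theorem Riesz_Fischer:
  fixes c :: "int^'n::finite \<Rightarrow> complex"
  assumes c: "\<And>\<xi>. c (- \<xi>) = cnj (c \<xi>)" and l2: "(\<lambda>\<xi>. (cmod (c \<xi>))\<^sup>2) summable_on UNIV"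
  obtains G where "L2_expansion G c"
proof -
  define I where "I = (\<Sum>\<^sub>\<infinity>\<xi>. (cmod (c \<xi>))\<^sup>2)"
  \<comment> \<open>The tail of the coefficient sum. By Parseval's identity it bounds the squared
    distance from the k-th partial sum to any later one.\<close>
  define \<delta> where "\<delta> k = I - (\<Sum>\<xi>\<in>lattice_box k. (cmod (c \<xi>))\<^sup>2)" for k
  have "(\<lambda>k. \<Sum>\<xi>\<in>lattice_box k. (cmod (c \<xi>))\<^sup>2) \<longlonglongrightarrow> I"
    unfolding I_def by (rule filterlim_compose[OF infsum_tendsto[OF l2] filterlim_lattice_box])
  from tendsto_diff[OF tendsto_const[of I] this] have \<delta>: "\<delta> \<longlonglongrightarrow> 0" by (simp add: \<delta>_def[abs_def])
  obtain G where "G \<in> borel_measurable (torus_measure :: (real^'n) measure)" "integrable torus_measure (\<lambda>x. (G x)\<^sup>2)"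
    "(\<lambda>k. \<integral>x. (G x - Re (trig_sum c (lattice_box k) x))\<^sup>2 \<partial>torus_measure) \<longlonglongrightarrow> 0"
  proof (rule finite_measure.L2_complete[OF finite_measure_torus, of "\<lambda>k x. Re (trig_sum c (lattice_box k) x)" \<delta>])
    fix m k :: nat assume km: "k \<le> m"
    have sub: "lattice_box k \<subseteq> (lattice_box m :: (int^'n) set)" by (rule lattice_box_mono[OF km])
    have "Re (trig_sum c (lattice_box m) x) - Re (trig_sum c (lattice_box k) x) =
        Re (trig_sum c (lattice_box m - lattice_box k) x)" for x
      unfolding trig_sum_def by (subst sum_diff[OF _ sub]) auto
    then have "(\<integral>x. (Re (trig_sum c (lattice_box m) x) - Re (trig_sum c (lattice_box k) x))\<^sup>2 \<partial>torus_measure)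
        = (\<Sum>\<xi>\<in>lattice_box m - lattice_box k. (cmod (c \<xi>))\<^sup>2)"
      using c by (simp only:) (subst integral_trig_sum_square, auto)
    also have "\<dots> = (\<Sum>\<xi>\<in>lattice_box m. (cmod (c \<xi>))\<^sup>2) - (\<Sum>\<xi>\<in>lattice_box k. (cmod (c \<xi>))\<^sup>2)"
      by (rule sum_diff[OF _ sub]) simp
    also have "\<dots> \<le> \<delta> k"
      unfolding \<delta>_def I_def using finite_sum_le_infsum[OF l2, of "lattice_box m"] by simp
    finally show "(\<integral>x. (Re (trig_sum c (lattice_box m) x) - Re (trig_sum c (lattice_box k) x))\<^sup>2 \<partial>torus_measure) \<le> \<delta> k" .
  qed (use \<delta> trig_sum_square_integrable in auto)
  then show ?thesis using that by (auto simp: L2_expansion_def)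
qed

lemma L2_expansion_integrable:
  assumes "L2_expansion G c"
  shows "integrable torus_measure G"
proof -
  have "integrable torus_measure (\<lambda>x. G x * 1)"
    using assms by (intro integrable_mult_l2)
      (auto simp: L2_expansion_def finite_measure.integrable_const[OF finite_measure_torus])
  then show ?thesis by simp
qed

lemma L2_expansion_mult_integrable:
  assumes "L2_expansion G c" "L2_expansion H d"
  shows "integrable torus_measure (\<lambda>x. G x * H x)"
  using integrable_mult_l2[of G torus_measure H] assms by (auto simp: L2_expansion_def)

text \<open>The coefficients of 1 are the unit of convolution. With 1 as second factor, the
  coefficients of a single function become a special case of those of a product.\<close>

lemma L2_expansion_const:
  "L2_expansion (\<lambda>x. 1) (\<lambda>\<xi>. if \<xi> = 0 then 1 else 0)"
proof -
  have "(0::int^'a) \<in> lattice_box N" for N by (simp add: lattice_box_def)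
  then have "trig_sum (\<lambda>\<xi>. if \<xi> = 0 then 1 else 0) (lattice_box N) x = 1" for N and x :: "real^'a"
    by (simp add: trig_sum_def if_distrib[of "\<lambda>c. c * _"] sum.delta wave_cis cong: if_cong)
  then show ?thesis by (simp add: L2_expansion_def finite_measure.integrable_const[OF finite_measure_torus])
qed

text \<open>The error splits as \<open>(f - fN) * (g - gN) - f * (g - gN) - (f - fN) * g\<close>,
  and Cauchy-Schwarz bounds each part by a product in which at least one factor tends to 0. The
  weight \<open>w\<close> stands for a wave.\<close>

lemma tendsto_integral_mult_l2:
  fixes f g :: "'a \<Rightarrow> real" and w :: "'a \<Rightarrow> complex"
  assumes m[measurable]: "f \<in> borel_measurable M" "g \<in> borel_measurable M" "w \<in> borel_measurable M"
      "\<And>N. fN N \<in> borel_measurable M" "\<And>N. gN N \<in> borel_measurable M"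
    and w: "\<And>x. norm (w x) \<le> 1"
    and i: "integrable M (\<lambda>x. (f x)\<^sup>2)" "integrable M (\<lambda>x. (g x)\<^sup>2)"
      "\<And>N. integrable M (\<lambda>x. (fN N x)\<^sup>2)" "\<And>N. integrable M (\<lambda>x. (gN N x)\<^sup>2)"
    and lim: "(\<lambda>N. \<integral>x. (f x - fN N x)\<^sup>2 \<partial>M) \<longlonglongrightarrow> 0" "(\<lambda>N. \<integral>x. (g x - gN N x)\<^sup>2 \<partial>M) \<longlonglongrightarrow> 0"
  shows "(\<lambda>N. \<integral>x. complex_of_real (fN N x * gN N x) * w x \<partial>M) \<longlonglongrightarrow> (\<integral>x. complex_of_real (f x * g x) * w x \<partial>M)"
proof -
  define A where "A = (\<integral>x. (f x)\<^sup>2 \<partial>M)"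
  define B where "B = (\<integral>x. (g x)\<^sup>2 \<partial>M)"
  define a where "a N = (\<integral>x. (f x - fN N x)\<^sup>2 \<partial>M)" for N
  define b where "b N = (\<integral>x. (g x - gN N x)\<^sup>2 \<partial>M)" for N
  have int: "integrable M (\<lambda>x. complex_of_real (u x * v x) * w x)"
    if "u \<in> borel_measurable M" "v \<in> borel_measurable M" "integrable M (\<lambda>x. (u x)\<^sup>2)" "integrable M (\<lambda>x. (v x)\<^sup>2)" for u v
  proof (rule Bochner_Integration.integrable_bound[OF integrable_mult_l2[OF that]])
    show "AE x in M. norm (complex_of_real (u x * v x) * w x) \<le> norm (u x * v x)"
      using w by (auto simp: norm_mult abs_mult intro!: mult_left_le)
  qed (use that in measurable)
  have bound: "norm (\<integral>x. complex_of_real (u x * v x) * w x \<partial>M) \<le> sqrt ((\<integral>x. (u x)\<^sup>2 \<partial>M) * (\<integral>x. (v x)\<^sup>2 \<partial>M))"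
    if u: "u \<in> borel_measurable M" "v \<in> borel_measurable M" "integrable M (\<lambda>x. (u x)\<^sup>2)" "integrable M (\<lambda>x. (v x)\<^sup>2)" for u v
  proof -
    have "norm (\<integral>x. complex_of_real (u x * v x) * w x \<partial>M) \<le> (\<integral>x. norm (complex_of_real (u x * v x) * w x) \<partial>M)"
      by (rule integral_norm_bound)
    also have "\<dots> \<le> (\<integral>x. \<bar>u x\<bar> * \<bar>v x\<bar> \<partial>M)"
    proof (rule integral_mono_AE)
      show "integrable M (\<lambda>x. norm (complex_of_real (u x * v x) * w x))" using int[OF u] by simp
      show "integrable M (\<lambda>x. \<bar>u x\<bar> * \<bar>v x\<bar>)" using integrable_abs[OF integrable_mult_l2[OF u]] by (simp add: abs_mult)
      show "AE x in M. norm (complex_of_real (u x * v x) * w x) \<le> \<bar>u x\<bar> * \<bar>v x\<bar>"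
        using w by (auto simp: norm_mult abs_mult intro!: mult_left_le)
    qed
    also have "\<dots> \<le> sqrt ((\<integral>x. (u x)\<^sup>2 \<partial>M) * (\<integral>x. (v x)\<^sup>2 \<partial>M))"
      using integral_Cauchy_Schwarz[of "\<lambda>x. \<bar>u x\<bar>" M "\<lambda>x. \<bar>v x\<bar>"] u by (intro real_le_rsqrt) simp
    finally show ?thesis .
  qed
  have "norm ((\<integral>x. complex_of_real (fN N x * gN N x) * w x \<partial>M) - (\<integral>x. complex_of_real (f x * g x) * w x \<partial>M))
      \<le> sqrt (a N * b N) + sqrt (A * b N) + sqrt (a N * B)" for N
  proof -
    define X where "X = (\<integral>x. complex_of_real ((f x - fN N x) * (g x - gN N x)) * w x \<partial>M)"
    define Y where "Y = (\<integral>x. complex_of_real (f x * (g x - gN N x)) * w x \<partial>M)"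
    define Z where "Z = (\<integral>x. complex_of_real ((f x - fN N x) * g x) * w x \<partial>M)"
    have d: "(\<lambda>x. f x - fN N x) \<in> borel_measurable M" "(\<lambda>x. g x - gN N x) \<in> borel_measurable M" by measurable
    have id: "integrable M (\<lambda>x. (f x - fN N x)\<^sup>2)" "integrable M (\<lambda>x. (g x - gN N x)\<^sup>2)"
      by (intro integrable_power2_diff m i)+
    have "(\<integral>x. complex_of_real (fN N x * gN N x) * w x \<partial>M) - (\<integral>x. complex_of_real (f x * g x) * w x \<partial>M)
       = (\<integral>x. complex_of_real (fN N x * gN N x) * w x - complex_of_real (f x * g x) * w x \<partial>M)"
      by (intro Bochner_Integration.integral_diff[symmetric] int m i)
    also have "\<dots> = (\<integral>x. complex_of_real ((f x - fN N x) * (g x - gN N x)) * w x - complex_of_real (f x * (g x - gN N x)) * w x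
        - complex_of_real ((f x - fN N x) * g x) * w x \<partial>M)"
      by (intro Bochner_Integration.integral_cong refl) (simp add: algebra_simps)
    also have "\<dots> = X - Y - Z"
      unfolding X_def Y_def Z_def
      using int[OF d id] int[OF m(1) d(2) i(1) id(2)] int[OF d(1) m(2) id(1) i(2)] by simp
    finally have "norm ((\<integral>x. complex_of_real (fN N x * gN N x) * w x \<partial>M) - (\<integral>x. complex_of_real (f x * g x) * w x \<partial>M))
       \<le> norm X + norm Y + norm Z"
      using norm_triangle_ineq4[of "X - Y" Z] norm_triangle_ineq4[of X Y] by simp
    moreover have "norm X \<le> sqrt (a N * b N)" unfolding X_def a_def b_def by (rule bound[OF d id])
    moreover have "norm Y \<le> sqrt (A * b N)" unfolding Y_def A_def b_def by (rule bound[OF m(1) d(2) i(1) id(2)])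
    moreover have "norm Z \<le> sqrt (a N * B)" unfolding Z_def a_def B_def by (rule bound[OF d(1) m(2) id(1) i(2)])
    ultimately show ?thesis by linarith
  qed
  then have "\<forall>\<^sub>F N in sequentially. norm ((\<integral>x. complex_of_real (fN N x * gN N x) * w x \<partial>M) - (\<integral>x. complex_of_real (f x * g x) * w x \<partial>M))
      \<le> sqrt (a N * b N) + sqrt (A * b N) + sqrt (a N * B)" by simp
  moreover have "(\<lambda>N. sqrt (a N * b N) + sqrt (A * b N) + sqrt (a N * B)) \<longlonglongrightarrow> sqrt (0 * 0) + sqrt (A * 0) + sqrt (0 * B)"
    using lim unfolding a_def b_def by (intro tendsto_intros)
  then have "(\<lambda>N. sqrt (a N * b N) + sqrt (A * b N) + sqrt (a N * B)) \<longlonglongrightarrow> 0" by simp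
  ultimately have "(\<lambda>N. (\<integral>x. complex_of_real (fN N x * gN N x) * w x \<partial>M) - (\<integral>x. complex_of_real (f x * g x) * w x \<partial>M)) \<longlonglongrightarrow> 0"
    by (rule Lim_null_comparison)
  then show ?thesis by (rule LIM_zero_cancel)
qed

text \<open>For partial sums both sides are finite sums that agree by orthogonality. The integrals
  converge because multiplication is continuous in mean square, the sums because the convolution
  series is absolutely summable.\<close>

lemma L2_expansion_mult:
  fixes c d :: "int^'n::finite \<Rightarrow> complex"
  assumes G: "L2_expansion G c" and H: "L2_expansion H d"
    and c: "\<And>\<xi>. c (- \<xi>) = cnj (c \<xi>)" "(\<lambda>\<xi>. (cmod (c \<xi>))\<^sup>2) summable_on UNIV"
    and d: "\<And>\<xi>. d (- \<xi>) = cnj (d \<xi>)" "(\<lambda>\<xi>. (cmod (d \<xi>))\<^sup>2) summable_on UNIV"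
  shows "(\<integral>x. complex_of_real (G x * H x) * wave (- \<zeta>) x \<partial>torus_measure) = convolution c d \<zeta>"
proof (rule LIMSEQ_unique)
  define gN where "gN N x = Re (trig_sum c (lattice_box N) x)" for N x
  define hN where "hN N x = Re (trig_sum d (lattice_box N) x)" for N x
  show "(\<lambda>N. \<integral>x. complex_of_real (gN N x * hN N x) * wave (- \<zeta>) x \<partial>torus_measure) \<longlonglongrightarrow>
      (\<integral>x. complex_of_real (G x * H x) * wave (- \<zeta>) x \<partial>torus_measure)"
    using G H by (intro tendsto_integral_mult_l2) (auto simp: L2_expansion_def gN_def[abs_def] hN_def[abs_def] trig_sum_square_integrable)
  \<comment> \<open>The frequencies for which both factors survive the truncation. These sets need
    not be boxes, but they still exhaust the lattice.\<close>
  define B where "B N = lattice_box N \<inter> {\<eta>. \<zeta> - \<eta> \<in> lattice_box N}" for N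
  have "(\<integral>x. complex_of_real (gN N x * hN N x) * wave (- \<zeta>) x \<partial>torus_measure) = (\<Sum>\<eta>\<in>B N. c (\<zeta> - \<eta>) * d \<eta>)" for N
  proof -
    have "(\<integral>x. complex_of_real (gN N x * hN N x) * wave (- \<zeta>) x \<partial>torus_measure) =
      (\<integral>x. trig_sum c (lattice_box N) x * trig_sum d (lattice_box N) x * wave (- \<zeta>) x \<partial>torus_measure)"
    proof (intro Bochner_Integration.integral_cong refl)
      fix x
      have "trig_sum c (lattice_box N) x = complex_of_real (gN N x)"
        unfolding gN_def by (rule trig_sum_real, rule c(1), simp)
      moreover have "trig_sum d (lattice_box N) x = complex_of_real (hN N x)"
        unfolding hN_def by (rule trig_sum_real, rule d(1), simp)
      ultimately show "complex_of_real (gN N x * hN N x) * wave (- \<zeta>) x =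
          trig_sum c (lattice_box N) x * trig_sum d (lattice_box N) x * wave (- \<zeta>) x" by simp
    qed
    also have "\<dots> = (\<Sum>\<eta>\<in>lattice_box N. \<Sum>\<xi>\<in>lattice_box N. if \<xi> = \<zeta> - \<eta> then c \<xi> * d \<eta> else 0)"
      unfolding integral_trig_sums by (subst sum.swap) (intro sum.cong refl if_cong, auto simp: algebra_simps)
    also have "\<dots> = (\<Sum>\<eta>\<in>lattice_box N. if \<zeta> - \<eta> \<in> lattice_box N then c (\<zeta> - \<eta>) * d \<eta> else 0)"
      by (intro sum.cong refl) (simp add: sum.delta)
    also have "\<dots> = (\<Sum>\<eta>\<in>B N. c (\<zeta> - \<eta>) * d \<eta>)"
      unfolding B_def by (simp add: sum.inter_restrict[symmetric] sum.If_cases Int_def)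
    finally show ?thesis .
  qed
  moreover have B: "filterlim B (finite_subsets_at_top UNIV) sequentially"
    unfolding filterlim_finite_subsets_at_top
  proof (intro allI impI)
    fix X :: "(int^'n) set" assume X: "finite X \<and> X \<subseteq> UNIV"
    then obtain M where M: "X \<union> (\<lambda>\<eta>. \<zeta> - \<eta>) ` X \<subseteq> lattice_box M"
      using finite_subset_lattice_box[of "X \<union> (\<lambda>\<eta>. \<zeta> - \<eta>) ` X"] by auto
    show "\<forall>\<^sub>F N in sequentially. finite (B N) \<and> X \<subseteq> B N \<and> B N \<subseteq> UNIV"
      using eventually_ge_at_top[of M]
    proof eventually_elim
      case (elim N)
      then have "lattice_box M \<subseteq> (lattice_box N :: (int^'n) set)" by (rule lattice_box_mono)
      then have "X \<union> (\<lambda>\<eta>. \<zeta> - \<eta>) ` X \<subseteq> lattice_box N" using M by (rule subset_trans[rotated])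
      then show ?case by (auto simp: B_def)
    qed
  qed
  have sm: "(\<lambda>\<eta>. c (\<zeta> - \<eta>) * d \<eta>) summable_on UNIV"
    by (rule abs_summable_summable[OF abs_summable_convolution[OF c(2) d(2)]])
  have "(\<lambda>N. \<Sum>\<eta>\<in>B N. c (\<zeta> - \<eta>) * d \<eta>) \<longlonglongrightarrow> convolution c d \<zeta>"
    unfolding convolution_def by (rule filterlim_compose[OF infsum_tendsto[OF sm] B])
  ultimately show "(\<lambda>N. \<integral>x. complex_of_real (gN N x * hN N x) * wave (- \<zeta>) x \<partial>torus_measure) \<longlonglongrightarrow> convolution c d \<zeta>"
    by simp
qed

section \<open>Distributions given by functions\<close>

definition dist_of :: "(real^'n::finite \<Rightarrow> real) \<Rightarrow> 'n dist" where
  "dist_of G = (\<lambda>\<phi>. LINT x:torus|lebesgue. G x * \<phi> x)"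

lemma dist_of_eq: "dist_of G \<phi> = (\<integral>x. G x * \<phi> x \<partial>torus_measure)"
  by (simp add: dist_of_def set_integral_torus)

lemma integrable_mult_continuous_periodic:
  fixes G \<phi> :: "real^'n::finite \<Rightarrow> real"
  assumes G: "integrable torus_measure G" and \<phi>: "\<phi> \<in> test_functions"
  shows "integrable torus_measure (\<lambda>x. G x * \<phi> x)"
proof -
  obtain B where B: "B > 0" "\<And>x. \<bar>\<phi> x\<bar> \<le> B"
    using periodic_bounded[of \<phi>] \<phi> test_functions_continuous by (auto simp: test_functions_def)
  show ?thesis
  proof (rule Bochner_Integration.integrable_bound)
    show "integrable torus_measure (\<lambda>x. B * G x)" using G by simp
    show "(\<lambda>x. G x * \<phi> x) \<in> borel_measurable torus_measure"
      using G continuous_measurable_torus[OF test_functions_continuous[OF \<phi>]] by measurable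
    have "\<bar>G x\<bar> * \<bar>\<phi> x\<bar> \<le> B * \<bar>G x\<bar>" for x
      using mult_left_mono[OF B(2), of "\<bar>G x\<bar>" x] by (simp add: mult.commute)
    then show "AE x in torus_measure. norm (G x * \<phi> x) \<le> norm (B * G x)" using B(1) by (simp add: abs_mult)
  qed
qed

lemma dist_of_periodic_distribution:
  fixes G :: "real^'n::finite \<Rightarrow> real"
  assumes G: "integrable torus_measure G"
  shows "dist_of G \<in> periodic_distributions"
  unfolding periodic_distributions_def
proof (intro CollectI conjI ballI allI impI)
  fix \<phi> \<psi> :: "real^'n \<Rightarrow> real" and a b assume "\<phi> \<in> test_functions" "\<psi> \<in> test_functions"
  then have "integrable torus_measure (\<lambda>x. G x * \<phi> x)" "integrable torus_measure (\<lambda>x. G x * \<psi> x)"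
    using integrable_mult_continuous_periodic[OF G] by auto
  moreover have "(\<lambda>x. G x * (a * \<phi> x + b * \<psi> x)) = (\<lambda>x. a * (G x * \<phi> x) + b * (G x * \<psi> x))"
    by (simp add: fun_eq_iff algebra_simps)
  ultimately show "dist_of G (\<lambda>x. a * \<phi> x + b * \<psi> x) = a * dist_of G \<phi> + b * dist_of G \<psi>"
    by (simp add: dist_of_eq)
next
  fix \<Phi> :: "nat \<Rightarrow> real^'n \<Rightarrow> real" and \<phi>
  assume \<phi>: "\<phi> \<in> test_functions" and \<Phi>: "\<forall>m. \<Phi> m \<in> test_functions" and "test_converges \<Phi> \<phi>"
  then have "uniform_limit UNIV (\<lambda>m. partials [] (\<Phi> m)) (partials [] \<phi>) sequentially"
    unfolding test_converges_def by blast
  then have ul: "uniform_limit UNIV \<Phi> \<phi> sequentially" by simp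
  define I where "I = (\<integral>x. \<bar>G x\<bar> \<partial>torus_measure)"
  have I: "I \<ge> 0" unfolding I_def by (rule integral_nonneg_AE) simp
  show "(\<lambda>m. dist_of G (\<Phi> m)) \<longlonglongrightarrow> dist_of G \<phi>"
  proof (rule LIMSEQ_I)
    fix e :: real assume e: "e > 0"
    define e' where "e' = e / (I + 1)"
    have e': "e' > 0" using e I by (simp add: e'_def)
    obtain m0 where m0: "\<And>m x. m \<ge> m0 \<Longrightarrow> dist (\<Phi> m x) (\<phi> x) < e'"
      using uniform_limitD[OF ul e'] by (auto simp: eventually_sequentially)
    have "norm (dist_of G (\<Phi> m) - dist_of G \<phi>) < e" if "m \<ge> m0" for m
    proof -
      have i: "integrable torus_measure (\<lambda>x. G x * \<Phi> m x)" "integrable torus_measure (\<lambda>x. G x * \<phi> x)"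
        using \<phi> \<Phi> integrable_mult_continuous_periodic[OF G] by auto
      have "dist_of G (\<Phi> m) - dist_of G \<phi> = (\<integral>x. G x * (\<Phi> m x - \<phi> x) \<partial>torus_measure)"
        using i by (simp add: dist_of_eq right_diff_distrib)
      also have "norm \<dots> \<le> (\<integral>x. e' * \<bar>G x\<bar> \<partial>torus_measure)"
      proof (rule order_trans[OF integral_norm_bound integral_mono])
        show "integrable torus_measure (\<lambda>x. norm (G x * (\<Phi> m x - \<phi> x)))"
          using i by (intro integrable_norm) (simp add: right_diff_distrib)
        show "integrable torus_measure (\<lambda>x. e' * \<bar>G x\<bar>)" using G by simp
        fix x
        have "\<bar>G x\<bar> * \<bar>\<Phi> m x - \<phi> x\<bar> \<le> \<bar>G x\<bar> * e'"
          using m0[OF that, of x] by (intro mult_left_mono) (auto simp: dist_real_def)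
        then show "norm (G x * (\<Phi> m x - \<phi> x)) \<le> e' * \<bar>G x\<bar>" by (simp add: abs_mult mult.commute)
      qed
      also have "\<dots> = e' * I" by (simp add: I_def)
      also have "\<dots> < e" using e I by (simp add: e'_def field_simps)
      finally show ?thesis .
    qed
    then show "\<exists>no. \<forall>n\<ge>no. norm (dist_of G (\<Phi> n) - dist_of G \<phi>) < e" by (intro exI[of _ m0] allI impI)
  qed
qed

lemma represents_dist_of:
  "integrable torus_measure G \<Longrightarrow> g \<doteq> dist_of G \<Longrightarrow> represents G g"
  by (simp add: represents_def set_integrable_torus dist_of_def)

lemma fourier_dist_of:
  fixes G :: "real^'n::finite \<Rightarrow> real"
  assumes G: "integrable torus_measure G"
  shows "fourier (dist_of G) \<xi> = (\<integral>x. complex_of_real (G x) * wave (- \<xi>) x \<partial>torus_measure)"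
proof -
  have i: "integrable torus_measure (\<lambda>x. complex_of_real (G x) * wave (- \<xi>) x)"
  proof (rule Bochner_Integration.integrable_bound[OF G])
    show "(\<lambda>x. complex_of_real (G x) * wave (- \<xi>) x) \<in> borel_measurable torus_measure"
      using G by measurable
  qed (simp add: norm_mult)
  have "cos_wave (- \<xi>) = cos_wave \<xi>" "sin_wave (- \<xi>) = (\<lambda>x. - sin_wave \<xi> x)"
    by (simp_all add: cos_wave_def sin_wave_def)
  then show ?thesis
    using integral_Re[OF i] integral_Im[OF i]
    by (simp add: complex_eq_iff fourier_waves dist_of_eq wave_def)
qed

lemma fourier_dist_of_mult:
  fixes c d :: "int^'n::finite \<Rightarrow> complex"
  assumes "L2_expansion G c" "L2_expansion H d"
    and "\<And>\<xi>. c (- \<xi>) = cnj (c \<xi>)" "(\<lambda>\<xi>. (cmod (c \<xi>))\<^sup>2) summable_on UNIV"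
    and "\<And>\<xi>. d (- \<xi>) = cnj (d \<xi>)" "(\<lambda>\<xi>. (cmod (d \<xi>))\<^sup>2) summable_on UNIV"
  shows "fourier (dist_of (\<lambda>x. G x * H x)) = convolution c d"
  using L2_expansion_mult[OF assms] fourier_dist_of[OF L2_expansion_mult_integrable[OF assms(1,2)]]
  by (simp add: fun_eq_iff)

lemma fourier_dist_of_expansion:
  fixes c :: "int^'n::finite \<Rightarrow> complex"
  assumes "L2_expansion G c" "\<And>\<xi>. c (- \<xi>) = cnj (c \<xi>)" "(\<lambda>\<xi>. (cmod (c \<xi>))\<^sup>2) summable_on UNIV"
  shows "fourier (dist_of G) = c"
proof -
  define d :: "int^'n \<Rightarrow> complex" where "d \<xi> = (if \<xi> = 0 then 1 else 0)" for \<xi>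
  have s: "(f has_sum f x) UNIV" if "\<And>y. y \<noteq> x \<Longrightarrow> f y = 0" for f :: "int^'n \<Rightarrow> 'b::{t2_space, topological_comm_monoid_add}" and x
    using that by (intro has_sum_finite_neutralI[of "{x}"]) auto
  have "((\<lambda>\<xi>. (cmod (d \<xi>))\<^sup>2) has_sum (cmod (d 0))\<^sup>2) UNIV" by (rule s) (simp add: d_def)
  then have d2: "(\<lambda>\<xi>. (cmod (d \<xi>))\<^sup>2) summable_on UNIV" by (rule has_sum_imp_summable)
  have "convolution c d \<xi> = c \<xi>" for \<xi>
    unfolding convolution_def using infsumI[OF s[of 0 "\<lambda>\<eta>. c (\<xi> - \<eta>) * d \<eta>"]] by (simp add: d_def)
  moreover have "fourier (dist_of (\<lambda>x. G x * 1)) = convolution c d"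
    using d2 L2_expansion_const by (intro fourier_dist_of_mult assms) (auto simp: d_def[abs_def])
  ultimately show ?thesis by auto
qed

section \<open>Galerkin approximation on the Fourier side\<close>

text \<open>Bilinear, without conjugation: up to the factor \<open>2 * pi * \<i>\<close> this is the
  Fourier coefficient of the divergence.\<close>

definition cdot :: "int^'n::finite \<Rightarrow> complex^'n \<Rightarrow> complex" where
  "cdot \<xi> w = (\<Sum>j\<in>UNIV. of_int (\<xi> $ j) * w $ j)"

text \<open>The condition \<open>u (- \<xi>) = vcnj (u \<xi>)\<close> expresses that the field with
  coefficients \<open>u\<close> is real.\<close>

definition vcnj :: "complex^'n::finite \<Rightarrow> complex^'n" where
  "vcnj w = (\<chi> j. cnj (w $ j))"

text \<open>At \<open>\<xi> = 0\<close> this is the identity, as division by 0 gives 0.\<close>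

definition leray :: "int^'n::finite \<Rightarrow> complex^'n \<Rightarrow> complex^'n" where
  "leray \<xi> w = (\<chi> k. w $ k - of_int (\<xi> $ k) * (cdot \<xi> w / of_real ((norm (lattice_vec \<xi>))\<^sup>2)))"

text \<open>The symbol of the negative of the viscous operator.\<close>

definition viscous_symbol :: "('n::finite) tensor \<Rightarrow> int^'n \<Rightarrow> complex^'n \<Rightarrow> complex^'n" where
  "viscous_symbol a \<xi> w = (\<chi> k. of_real (4 * pi\<^sup>2) *
     (\<Sum>j\<in>UNIV. (\<Sum>\<alpha>\<in>UNIV. \<Sum>\<beta>\<in>UNIV. of_real (a k j \<alpha> \<beta> * real_of_int (\<xi> $ \<alpha>) * real_of_int (\<xi> $ \<beta>))) * w $ j))"

text \<open>The convective term is written in divergence form.\<close>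

definition advection :: "(int^'n::finite) set \<Rightarrow> (int^'n \<Rightarrow> complex^'n) \<Rightarrow> int^'n \<Rightarrow> complex^'n" where
  "advection \<Lambda> u \<xi> = (\<chi> k. \<Sum>j\<in>UNIV. 2 * of_real pi * \<i> * of_int (\<xi> $ j) * (\<Sum>\<eta>\<in>\<Lambda>. u (\<xi> - \<eta>) $ j * u \<eta> $ k))"

lemma norm_lattice_vec_squared: "(norm (lattice_vec \<xi>))\<^sup>2 = (\<Sum>j\<in>UNIV. (real_of_int (\<xi> $ j))\<^sup>2)"
  by (simp add: norm_vec_def L2_set_def sum_nonneg)

lemma cdot_diff_left: "cdot (\<xi> - \<eta>) v = cdot \<xi> v - cdot \<eta> v"
  and cdot_minus_left [simp]: "cdot (- \<xi>) v = - cdot \<xi> v"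
  and cdot_0_right [simp]: "cdot \<xi> 0 = 0"
  and cdot_vcnj: "cdot \<xi> (vcnj v) = cnj (cdot \<xi> v)"
  by (simp_all add: cdot_def vcnj_def distrib_left right_diff_distrib left_diff_distrib sum.distrib
      sum_subtractf sum_negf)

lemma vcnj_nth [simp]: "vcnj w $ j = cnj (w $ j)"
  by (simp add: vcnj_def)

lemma vcnj_vcnj [simp]: "vcnj (vcnj w) = w"
  and vcnj_0 [simp]: "vcnj 0 = 0"
  and vcnj_add: "vcnj (v + w) = vcnj v + vcnj w"
  and vcnj_diff: "vcnj (v - w) = vcnj v - vcnj w"
  and vcnj_scaleR: "vcnj (r *\<^sub>R w) = r *\<^sub>R vcnj w"
  by (simp_all add: vec_eq_iff)

text \<open>The inner product of this type is the real part of the Hermitian one, so energy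
  identities come out as real parts.\<close>

lemma inner_complex_vec: "v \<bullet> w = (\<Sum>k\<in>UNIV. Re (v $ k * cnj (w $ k)))" for v w :: "complex^'n::finite"
  by (simp add: inner_vec_def inner_complex_def)

lemma inner_vcnj: "vcnj v \<bullet> vcnj w = v \<bullet> w"
  by (simp add: inner_complex_vec)

lemma cdot_leray: "\<xi> \<noteq> 0 \<Longrightarrow> cdot \<xi> (leray \<xi> w) = 0"
proof -
  assume "\<xi> \<noteq> 0"
  then have n: "(norm (lattice_vec \<xi>))\<^sup>2 \<noteq> 0" using norm_lattice_vec_ge_1[of \<xi>] by auto
  define t where "t = cdot \<xi> w / of_real ((norm (lattice_vec \<xi>))\<^sup>2)"
  have "leray \<xi> w = (\<chi> k. w $ k - of_int (\<xi> $ k) * t)" by (simp add: leray_def t_def)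
  then have "cdot \<xi> (leray \<xi> w) = cdot \<xi> w - (\<Sum>j\<in>UNIV. of_int (\<xi> $ j) * of_int (\<xi> $ j)) * t"
    by (simp add: cdot_def right_diff_distrib sum_subtractf sum_distrib_right mult.assoc)
  also have "(\<Sum>j\<in>UNIV. of_int (\<xi> $ j) * of_int (\<xi> $ j)) = complex_of_real ((norm (lattice_vec \<xi>))\<^sup>2)"
    unfolding norm_lattice_vec_squared by (simp add: power2_eq_square)
  finally show ?thesis using n by (simp add: t_def)
qed

lemma vcnj_leray: "vcnj (leray \<xi> w) = leray (- \<xi>) (vcnj w)"
  by (simp add: vec_eq_iff leray_def cdot_vcnj)

text \<open>\<open>leray\<close> removes a complex multiple of the real vector \<xi>, and
  \<open>v\<close> is orthogonal to every such multiple.\<close>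

lemma inner_leray:
  assumes "cdot \<xi> v = 0"
  shows "leray \<xi> w \<bullet> v = w \<bullet> v"
proof -
  define t where "t = cdot \<xi> w / of_real ((norm (lattice_vec \<xi>))\<^sup>2)"
  have "(\<Sum>k\<in>UNIV. of_int (\<xi> $ k) * t * cnj (v $ k)) = t * cnj (cdot \<xi> v)"
    by (simp add: cdot_def sum_distrib_left mult_ac)
  then have "(\<Sum>k\<in>UNIV. of_int (\<xi> $ k) * t * cnj (v $ k)) = 0" using assms by simp
  then have "Re (\<Sum>k\<in>UNIV. of_int (\<xi> $ k) * t * cnj (v $ k)) = 0" by (simp only: zero_complex.sel)
  then have "(\<Sum>k\<in>UNIV. Re (of_int (\<xi> $ k) * t * cnj (v $ k))) = 0" by (simp only: Re_sum)
  moreover have "leray \<xi> w \<bullet> v = (\<Sum>k\<in>UNIV. Re (w $ k * cnj (v $ k)) - Re (of_int (\<xi> $ k) * t * cnj (v $ k)))"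
    unfolding inner_complex_vec leray_def t_def[symmetric] by (simp add: left_diff_distrib)
  ultimately show ?thesis by (simp add: sum_subtractf inner_complex_vec)
qed

lemma leray_eq_0:
  assumes "leray \<xi> w = 0"
  shows "w $ k = of_int (\<xi> $ k) * (cdot \<xi> w / of_real ((norm (lattice_vec \<xi>))\<^sup>2))"
proof -
  have "leray \<xi> w $ k = 0" using assms by simp
  then show ?thesis by (simp add: leray_def)
qed

subsection \<open>Coercivity of the viscous term\<close>

text \<open>This exchange and the next one mirror the two symmetries of the viscosity tensor, each
  of which swaps a lower with an upper index.\<close>

lemma sum4_swap_13:
  fixes X :: "'n::finite \<Rightarrow> 'n \<Rightarrow> 'n \<Rightarrow> 'n \<Rightarrow> 'b::comm_monoid_add"
  shows "(\<Sum>k\<in>UNIV. \<Sum>j\<in>UNIV. \<Sum>\<alpha>\<in>UNIV. \<Sum>\<beta>\<in>UNIV. X k j \<alpha> \<beta>) =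
    (\<Sum>k\<in>UNIV. \<Sum>j\<in>UNIV. \<Sum>\<alpha>\<in>UNIV. \<Sum>\<beta>\<in>UNIV. X \<alpha> j k \<beta>)"
proof -
  have inner: "(\<Sum>k\<in>UNIV. \<Sum>j\<in>UNIV. \<Sum>\<alpha>\<in>UNIV. \<Sum>\<beta>\<in>UNIV. Y k j \<alpha> \<beta>) =
    (\<Sum>k\<in>UNIV. \<Sum>\<alpha>\<in>UNIV. \<Sum>j\<in>UNIV. \<Sum>\<beta>\<in>UNIV. Y k j \<alpha> \<beta>)" for Y :: "'n \<Rightarrow> 'n \<Rightarrow> 'n \<Rightarrow> 'n \<Rightarrow> 'b"
    by (rule sum.cong[OF refl], rule sum.swap)
  have "(\<Sum>k\<in>UNIV. \<Sum>j\<in>UNIV. \<Sum>\<alpha>\<in>UNIV. \<Sum>\<beta>\<in>UNIV. X k j \<alpha> \<beta>) =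
    (\<Sum>k\<in>UNIV. \<Sum>\<alpha>\<in>UNIV. \<Sum>j\<in>UNIV. \<Sum>\<beta>\<in>UNIV. X k j \<alpha> \<beta>)" by (rule inner)
  also have "\<dots> = (\<Sum>\<alpha>\<in>UNIV. \<Sum>k\<in>UNIV. \<Sum>j\<in>UNIV. \<Sum>\<beta>\<in>UNIV. X k j \<alpha> \<beta>)" by (rule sum.swap)
  also have "\<dots> = (\<Sum>k\<in>UNIV. \<Sum>j\<in>UNIV. \<Sum>\<alpha>\<in>UNIV. \<Sum>\<beta>\<in>UNIV. X \<alpha> j k \<beta>)"
    by (rule inner[of "\<lambda>k j \<alpha> \<beta>. X \<alpha> j k \<beta>", symmetric])
  finally show ?thesis .
qed

lemma sum4_swap_24:
  fixes X :: "'n::finite \<Rightarrow> 'n \<Rightarrow> 'n \<Rightarrow> 'n \<Rightarrow> 'b::comm_monoid_add"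
  shows "(\<Sum>k\<in>UNIV. \<Sum>j\<in>UNIV. \<Sum>\<alpha>\<in>UNIV. \<Sum>\<beta>\<in>UNIV. X k j \<alpha> \<beta>) =
    (\<Sum>k\<in>UNIV. \<Sum>j\<in>UNIV. \<Sum>\<alpha>\<in>UNIV. \<Sum>\<beta>\<in>UNIV. X k \<beta> \<alpha> j)"
proof (rule sum.cong[OF refl])
  fix k :: 'n
  have "(\<Sum>j\<in>UNIV. \<Sum>\<alpha>\<in>UNIV. \<Sum>\<beta>\<in>UNIV. X k j \<alpha> \<beta>) = (\<Sum>\<alpha>\<in>UNIV. \<Sum>j\<in>UNIV. \<Sum>\<beta>\<in>UNIV. X k j \<alpha> \<beta>)"
    by (rule sum.swap)
  also have "\<dots> = (\<Sum>\<alpha>\<in>UNIV. \<Sum>\<beta>\<in>UNIV. \<Sum>j\<in>UNIV. X k j \<alpha> \<beta>)"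
    by (rule sum.cong[OF refl], rule sum.swap)
  also have "\<dots> = (\<Sum>\<beta>\<in>UNIV. \<Sum>\<alpha>\<in>UNIV. \<Sum>j\<in>UNIV. X k j \<alpha> \<beta>)"
    by (rule sum.swap)
  finally show "(\<Sum>j\<in>UNIV. \<Sum>\<alpha>\<in>UNIV. \<Sum>\<beta>\<in>UNIV. X k j \<alpha> \<beta>) = (\<Sum>j\<in>UNIV. \<Sum>\<alpha>\<in>UNIV. \<Sum>\<beta>\<in>UNIV. X k \<beta> \<alpha> j)" .
qed

text \<open>On a divergence-free mode the trace of the symmetrized gradient vanishes, so that relaxed
  ellipticity applies to it.\<close>

lemma elliptic_mode:
  fixes a :: "('n::finite) tensor" and x v :: "real^'n"
  assumes sym: "symmetric_tensor a"
    and ell: "\<And>\<zeta>::real^'n^'n. transpose \<zeta> = \<zeta> \<Longrightarrow> trace \<zeta> = 0 \<Longrightarrow>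
        (\<Sum>k\<in>UNIV. \<Sum>j\<in>UNIV. \<Sum>\<alpha>\<in>UNIV. \<Sum>\<beta>\<in>UNIV. a k j \<alpha> \<beta> * \<zeta> $ k $ \<alpha> * \<zeta> $ j $ \<beta>)
          \<ge> inverse C * (\<Sum>k\<in>UNIV. \<Sum>\<alpha>\<in>UNIV. (\<zeta> $ k $ \<alpha>)\<^sup>2)"
    and orth: "(\<Sum>k\<in>UNIV. x $ k * v $ k) = 0"
  shows "(\<Sum>k\<in>UNIV. \<Sum>j\<in>UNIV. \<Sum>\<alpha>\<in>UNIV. \<Sum>\<beta>\<in>UNIV. a k j \<alpha> \<beta> * (x $ \<alpha> * v $ k) * (x $ \<beta> * v $ j))
    \<ge> inverse C / 2 * ((\<Sum>k\<in>UNIV. (x $ k)\<^sup>2) * (\<Sum>k\<in>UNIV. (v $ k)\<^sup>2))"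
proof -
  define T where "T f g = (\<Sum>k\<in>UNIV. \<Sum>j\<in>UNIV. \<Sum>\<alpha>\<in>UNIV. \<Sum>\<beta>\<in>UNIV. a k j \<alpha> \<beta> * f k \<alpha> * g j \<beta>)"
    for f g :: "'n \<Rightarrow> 'n \<Rightarrow> real"
  have s1: "a \<alpha> j k \<beta> = a k j \<alpha> \<beta>" and s2: "a k \<beta> \<alpha> j = a k j \<alpha> \<beta>" for k j \<alpha> \<beta>
    using sym unfolding symmetric_tensor_def by metis+
  \<comment> \<open>By the two symmetries of \<open>a\<close>, the form ignores antisymmetric parts
    in either argument, so \<open>F\<close> may be replaced by its symmetrization
    \<open>\<zeta>\<close>.\<close>
  have T1: "T (\<lambda>k \<alpha>. f \<alpha> k) g = T f g" for f g
    unfolding T_def by (subst sum4_swap_13) (simp only: s1)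
  have T2: "T f (\<lambda>j \<beta>. g \<beta> j) = T f g" for f g
    unfolding T_def by (subst sum4_swap_24) (simp only: s2)
  have Tadd: "T (\<lambda>k \<alpha>. f k \<alpha> + f' k \<alpha>) g = T f g + T f' g" "T f (\<lambda>k \<alpha>. g k \<alpha> + g' k \<alpha>) = T f g + T f g'" for f f' g g'
    by (simp_all add: T_def distrib_left distrib_right sum.distrib)
  define F where "F k \<alpha> = x $ \<alpha> * v $ k" for k \<alpha>
  define \<zeta> :: "real^'n^'n" where "\<zeta> = (\<chi> k \<alpha>. (F k \<alpha> + F \<alpha> k) / 2)"
  have "transpose \<zeta> = \<zeta>" by (simp add: vec_eq_iff transpose_def \<zeta>_def add.commute)
  moreover have "trace \<zeta> = 0" using orth by (simp add: trace_def \<zeta>_def F_def mult.commute)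
  ultimately have "inverse C * (\<Sum>k\<in>UNIV. \<Sum>\<alpha>\<in>UNIV. (\<zeta> $ k $ \<alpha>)\<^sup>2) \<le> T (\<lambda>k \<alpha>. \<zeta> $ k $ \<alpha>) (\<lambda>k \<alpha>. \<zeta> $ k $ \<alpha>)"
    unfolding T_def by (rule ell)
  also have "T (\<lambda>k \<alpha>. \<zeta> $ k $ \<alpha>) (\<lambda>k \<alpha>. \<zeta> $ k $ \<alpha>) = T (\<lambda>k \<alpha>. F k \<alpha> + F \<alpha> k) (\<lambda>k \<alpha>. F k \<alpha> + F \<alpha> k) / 4"
    by (simp add: T_def \<zeta>_def sum_divide_distrib)
  also have "\<dots> = T F F"
    unfolding Tadd using T1[of F] T2[of _ F] by simp
  \<comment> \<open>Expanding the square gives half the product of the squared norms of x and v plus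
    half the square of their inner product. The latter vanishes, and the former is the source of the
    factor 1/2 in the bound.\<close>
  also have "(\<Sum>k\<in>UNIV. \<Sum>\<alpha>\<in>UNIV. (\<zeta> $ k $ \<alpha>)\<^sup>2) =
      1/2 * ((\<Sum>k\<in>UNIV. (x $ k)\<^sup>2) * (\<Sum>k\<in>UNIV. (v $ k)\<^sup>2))"
  proof -
    have "(\<Sum>k\<in>UNIV. \<Sum>\<alpha>\<in>UNIV. (\<zeta> $ k $ \<alpha>)\<^sup>2) =
      (\<Sum>k\<in>UNIV. \<Sum>\<alpha>\<in>UNIV. 1/4 * ((v $ k)\<^sup>2 * (x $ \<alpha>)\<^sup>2) + 1/4 * ((x $ k)\<^sup>2 * (v $ \<alpha>)\<^sup>2) +
        1/2 * ((x $ k * v $ k) * (x $ \<alpha> * v $ \<alpha>)))"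
      by (intro sum.cong refl) (simp add: \<zeta>_def F_def power2_eq_square field_simps)
    also have "\<dots> = 1/4 * ((\<Sum>k\<in>UNIV. (v $ k)\<^sup>2) * (\<Sum>\<alpha>\<in>UNIV. (x $ \<alpha>)\<^sup>2)) + 1/4 * ((\<Sum>k\<in>UNIV. (x $ k)\<^sup>2) * (\<Sum>\<alpha>\<in>UNIV. (v $ \<alpha>)\<^sup>2))
       + 1/2 * ((\<Sum>k\<in>UNIV. x $ k * v $ k) * (\<Sum>\<alpha>\<in>UNIV. x $ \<alpha> * v $ \<alpha>))"
      unfolding sum.distrib sum_product by (simp only: sum_distrib_left)
    finally show ?thesis using orth by simp
  qed
  finally show ?thesis unfolding T_def F_def by simp
qed

text \<open>Frequency and tensor are real, so the real and imaginary parts of \<open>w\<close> are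
  separately orthogonal to \<xi> and contribute separately to the form. The constant is
  \<open>4 * pi^2\<close> from two derivatives times the 1/2 from the symmetrized gradient.\<close>

lemma viscous_symbol_coercive:
  fixes a :: "('n::finite) tensor"
  assumes sym: "symmetric_tensor a"
    and ell: "\<And>\<zeta>::real^'n^'n. transpose \<zeta> = \<zeta> \<Longrightarrow> trace \<zeta> = 0 \<Longrightarrow>
        (\<Sum>k\<in>UNIV. \<Sum>j\<in>UNIV. \<Sum>\<alpha>\<in>UNIV. \<Sum>\<beta>\<in>UNIV. a k j \<alpha> \<beta> * \<zeta> $ k $ \<alpha> * \<zeta> $ j $ \<beta>)
          \<ge> inverse C * (\<Sum>k\<in>UNIV. \<Sum>\<alpha>\<in>UNIV. (\<zeta> $ k $ \<alpha>)\<^sup>2)"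
    and div: "cdot \<xi> w = 0"
  shows "viscous_symbol a \<xi> w \<bullet> w \<ge> 2 * pi\<^sup>2 * inverse C * (norm (lattice_vec \<xi>) * norm w)\<^sup>2"
proof -
  define x where "x = lattice_vec \<xi>"
  define p where "p = (\<chi> k. Re (w $ k))"
  define q where "q = (\<chi> k. Im (w $ k))"
  define B where "B v = (\<Sum>k\<in>UNIV. \<Sum>j\<in>UNIV. \<Sum>\<alpha>\<in>UNIV. \<Sum>\<beta>\<in>UNIV. a k j \<alpha> \<beta> * (x $ \<alpha> * v $ k) * (x $ \<beta> * v $ j))"
    for v :: "real^'n"
  have "Re (cdot \<xi> w) = 0" "Im (cdot \<xi> w) = 0" using div by simp_all
  then have orth: "(\<Sum>k\<in>UNIV. x $ k * p $ k) = 0" "(\<Sum>k\<in>UNIV. x $ k * q $ k) = 0"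
    by (simp_all add: cdot_def x_def p_def q_def)
  have "Re (viscous_symbol a \<xi> w $ k * cnj (w $ k)) = 4 * pi\<^sup>2 *
      ((\<Sum>j\<in>UNIV. \<Sum>\<alpha>\<in>UNIV. \<Sum>\<beta>\<in>UNIV. a k j \<alpha> \<beta> * (x $ \<alpha> * p $ k) * (x $ \<beta> * p $ j)) +
       (\<Sum>j\<in>UNIV. \<Sum>\<alpha>\<in>UNIV. \<Sum>\<beta>\<in>UNIV. a k j \<alpha> \<beta> * (x $ \<alpha> * q $ k) * (x $ \<beta> * q $ j)))" for k
  proof -
    define S where "S j = (\<Sum>\<alpha>\<in>UNIV. \<Sum>\<beta>\<in>UNIV. a k j \<alpha> \<beta> * x $ \<alpha> * x $ \<beta>)" for j
    have "viscous_symbol a \<xi> w $ k = of_real (4 * pi\<^sup>2) * (\<Sum>j\<in>UNIV. of_real (S j) * w $ j)"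
      by (simp add: viscous_symbol_def S_def x_def)
    then have "Re (viscous_symbol a \<xi> w $ k * cnj (w $ k)) =
        4 * pi\<^sup>2 * ((\<Sum>j\<in>UNIV. S j * p $ j) * p $ k + (\<Sum>j\<in>UNIV. S j * q $ j) * q $ k)"
      by (simp add: p_def q_def algebra_simps)
    moreover have "(\<Sum>j\<in>UNIV. S j * v $ j) * v $ k =
        (\<Sum>j\<in>UNIV. \<Sum>\<alpha>\<in>UNIV. \<Sum>\<beta>\<in>UNIV. a k j \<alpha> \<beta> * (x $ \<alpha> * v $ k) * (x $ \<beta> * v $ j))" for v :: "real^'n"
      unfolding S_def sum_distrib_right by (intro sum.cong refl) (simp add: mult_ac)
    ultimately show ?thesis by simp
  qed
  then have "viscous_symbol a \<xi> w \<bullet> w = 4 * pi\<^sup>2 * (B p + B q)"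
    unfolding inner_complex_vec B_def by (simp add: sum_distrib_left sum.distrib distrib_left)
  moreover have "inverse C / 2 * ((\<Sum>k\<in>UNIV. (x $ k)\<^sup>2) * (\<Sum>k\<in>UNIV. (p $ k)\<^sup>2)) \<le> B p"
    "inverse C / 2 * ((\<Sum>k\<in>UNIV. (x $ k)\<^sup>2) * (\<Sum>k\<in>UNIV. (q $ k)\<^sup>2)) \<le> B q"
    unfolding B_def using orth by (intro elliptic_mode[OF sym ell]; simp)+
  then have "4 * pi\<^sup>2 * (inverse C / 2 * ((\<Sum>k\<in>UNIV. (x $ k)\<^sup>2) * (\<Sum>k\<in>UNIV. (p $ k)\<^sup>2)) +
      inverse C / 2 * ((\<Sum>k\<in>UNIV. (x $ k)\<^sup>2) * (\<Sum>k\<in>UNIV. (q $ k)\<^sup>2))) \<le> 4 * pi\<^sup>2 * (B p + B q)"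
    by (intro mult_left_mono add_mono) auto
  moreover have "(norm w)\<^sup>2 = (\<Sum>k\<in>UNIV. (p $ k)\<^sup>2) + (\<Sum>k\<in>UNIV. (q $ k)\<^sup>2)"
    by (simp add: norm_vec_def L2_set_def sum_nonneg cmod_power2 p_def q_def sum.distrib)
  moreover have "(norm (lattice_vec \<xi>))\<^sup>2 = (\<Sum>k\<in>UNIV. (x $ k)\<^sup>2)"
    by (simp add: norm_lattice_vec_squared x_def)
  ultimately show ?thesis by (simp add: power_mult_distrib algebra_simps)
qed

subsection \<open>The convective term does no work\<close>

text \<open>Coefficient families of real divergence-free trigonometric vector fields with
  frequencies in \<Lambda>.\<close>

definition solenoidal_modes :: "(int^'n::finite) set \<Rightarrow> (int^'n \<Rightarrow> complex^'n) set" where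
  "solenoidal_modes \<Lambda> = {u. (\<forall>\<xi>. \<xi> \<notin> \<Lambda> \<longrightarrow> u \<xi> = 0) \<and> (\<forall>\<xi>. cdot \<xi> (u \<xi>) = 0) \<and> (\<forall>\<xi>. u (- \<xi>) = vcnj (u \<xi>))}"

lemma sum_uminus:
  assumes "\<And>\<xi>. - \<xi> \<in> \<Lambda> \<longleftrightarrow> \<xi> \<in> (\<Lambda> :: 'a::group_add set)"
  shows "(\<Sum>\<xi>\<in>\<Lambda>. g (- \<xi>)) = (\<Sum>\<xi>\<in>\<Lambda>. g \<xi>)"
proof (rule sum.reindex_bij_betw)
  show "bij_betw uminus \<Lambda> \<Lambda>" using assms by (intro bij_betw_byWitness[where f' = uminus]) auto
qed

text \<open>Replacing \<open>(\<xi>, \<eta>)\<close> by \<open>(- \<eta>, - \<xi>)\<close> preserves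
  \<xi> - \<eta> and reverses the sign of each summand: \<open>u (\<xi> - \<eta>)\<close> is
  orthogonal to its own frequency, so \<xi> and \<eta> have the same product with it. For symmetric
  \<Lambda> the double sum therefore equals its negative. The cancellation is exact on truncated
  families, and the bound uniform in \<Lambda> rests on this.\<close>

lemma advection_cancel:
  fixes u :: "int^'n::finite \<Rightarrow> complex^'n"
  assumes sym: "\<And>\<xi>. - \<xi> \<in> \<Lambda> \<longleftrightarrow> \<xi> \<in> \<Lambda>" and u: "u \<in> solenoidal_modes \<Lambda>"
  shows "(\<Sum>\<xi>\<in>\<Lambda>. advection \<Lambda> u \<xi> \<bullet> u \<xi>) = 0"
proof -
  have div: "cdot \<xi> (u \<xi>) = 0" and cn: "u (- \<xi>) = vcnj (u \<xi>)" for \<xi>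
    using u by (auto simp: solenoidal_modes_def)
  define D where "D v w = (\<Sum>k\<in>UNIV. v $ k * w $ k)" for v w :: "complex^'n"
  define E where "E \<xi> \<eta> = cdot \<xi> (u (\<xi> - \<eta>)) * D (u \<eta>) (u (- \<xi>))" for \<xi> \<eta>
  define S where "S = (\<Sum>\<xi>\<in>\<Lambda>. \<Sum>\<eta>\<in>\<Lambda>. E \<xi> \<eta>)"
  have "E (- \<eta>) (- \<xi>) = - E \<xi> \<eta>" for \<xi> \<eta>
  proof -
    have "cdot \<eta> (u (\<xi> - \<eta>)) = cdot \<xi> (u (\<xi> - \<eta>))"
      using div[of "\<xi> - \<eta>"] by (simp add: cdot_diff_left)
    then show ?thesis by (simp add: E_def D_def mult.commute)
  qed
  then have "- S = (\<Sum>\<xi>\<in>\<Lambda>. \<Sum>\<eta>\<in>\<Lambda>. E (- \<eta>) (- \<xi>))" by (simp add: S_def sum_negf)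
  also have "\<dots> = (\<Sum>\<xi>\<in>\<Lambda>. \<Sum>\<eta>\<in>\<Lambda>. E \<eta> (- \<xi>))"
    by (rule sum.cong[OF refl], rule sum_uminus[OF sym])
  also have "\<dots> = (\<Sum>\<xi>\<in>\<Lambda>. \<Sum>\<eta>\<in>\<Lambda>. E \<eta> \<xi>)"
    by (rule sum_uminus[OF sym, where g = "\<lambda>\<xi>. \<Sum>\<eta>\<in>\<Lambda>. E \<eta> \<xi>"])
  also have "\<dots> = S" unfolding S_def by (rule sum.swap)
  finally have "S = 0" by simp
  have "advection \<Lambda> u \<xi> \<bullet> u \<xi> = Re (2 * of_real pi * \<i> * (\<Sum>\<eta>\<in>\<Lambda>. E \<xi> \<eta>))" for \<xi>
  proof -
    have "(\<Sum>\<eta>\<in>\<Lambda>. E \<xi> \<eta>) = (\<Sum>\<eta>\<in>\<Lambda>. \<Sum>j\<in>UNIV. \<Sum>k\<in>UNIV. of_int (\<xi> $ j) * u (\<xi> - \<eta>) $ j * (u \<eta> $ k * cnj (u \<xi> $ k)))"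
      unfolding E_def D_def cdot_def sum_product cn by simp
    also have "\<dots> = (\<Sum>j\<in>UNIV. \<Sum>\<eta>\<in>\<Lambda>. \<Sum>k\<in>UNIV. of_int (\<xi> $ j) * u (\<xi> - \<eta>) $ j * (u \<eta> $ k * cnj (u \<xi> $ k)))"
      by (rule sum.swap)
    also have "\<dots> = (\<Sum>j\<in>UNIV. \<Sum>k\<in>UNIV. \<Sum>\<eta>\<in>\<Lambda>. of_int (\<xi> $ j) * u (\<xi> - \<eta>) $ j * (u \<eta> $ k * cnj (u \<xi> $ k)))"
      by (rule sum.cong[OF refl], rule sum.swap)
    also have "\<dots> = (\<Sum>k\<in>UNIV. \<Sum>j\<in>UNIV. \<Sum>\<eta>\<in>\<Lambda>. of_int (\<xi> $ j) * u (\<xi> - \<eta>) $ j * (u \<eta> $ k * cnj (u \<xi> $ k)))"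
      by (rule sum.swap)
    finally have "2 * of_real pi * \<i> * (\<Sum>\<eta>\<in>\<Lambda>. E \<xi> \<eta>) =
       (\<Sum>k\<in>UNIV. advection \<Lambda> u \<xi> $ k * cnj (u \<xi> $ k))"
      by (simp add: advection_def sum_distrib_left sum_distrib_right mult_ac)
    then show ?thesis by (simp only: inner_complex_vec Re_sum)
  qed
  then have "(\<Sum>\<xi>\<in>\<Lambda>. advection \<Lambda> u \<xi> \<bullet> u \<xi>) = Re (2 * of_real pi * \<i> * S)"
    unfolding S_def sum_distrib_left Re_sum by simp
  then show ?thesis using \<open>S = 0\<close> by simp
qed

lemma vcnj_viscous_symbol: "vcnj (viscous_symbol a \<xi> w) = viscous_symbol a (- \<xi>) (vcnj w)"
  by (simp add: vec_eq_iff viscous_symbol_def)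

lemma vcnj_advection:
  assumes sym: "\<And>\<xi>. - \<xi> \<in> \<Lambda> \<longleftrightarrow> \<xi> \<in> \<Lambda>" and u: "\<And>\<xi>. u (- \<xi>) = vcnj (u \<xi>)"
  shows "vcnj (advection \<Lambda> u \<xi>) = advection \<Lambda> u (- \<xi>)"
proof -
  have "(\<Sum>\<eta>\<in>\<Lambda>. cnj (u (\<xi> - \<eta>) $ j) * cnj (u \<eta> $ k)) = (\<Sum>\<eta>\<in>\<Lambda>. u (- \<xi> - \<eta>) $ j * u \<eta> $ k)" for j k
  proof -
    have "(\<Sum>\<eta>\<in>\<Lambda>. cnj (u (\<xi> - \<eta>) $ j) * cnj (u \<eta> $ k)) = (\<Sum>\<eta>\<in>\<Lambda>. u (- \<xi> - (- \<eta>)) $ j * u (- \<eta>) $ k)"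
    proof (rule sum.cong[OF refl])
      fix \<eta>
      have "u (- \<xi> - (- \<eta>)) = vcnj (u (\<xi> - \<eta>))" using u[of "\<xi> - \<eta>"] by simp
      then show "cnj (u (\<xi> - \<eta>) $ j) * cnj (u \<eta> $ k) = u (- \<xi> - (- \<eta>)) $ j * u (- \<eta>) $ k"
        by (simp only: u vcnj_nth)
    qed
    also have "\<dots> = (\<Sum>\<eta>\<in>\<Lambda>. u (- \<xi> - \<eta>) $ j * u \<eta> $ k)"
      by (rule sum_uminus[OF sym, where g = "\<lambda>\<eta>. u (- \<xi> - \<eta>) $ j * u \<eta> $ k"])
    finally show ?thesis .
  qed
  then show ?thesis by (simp add: vec_eq_iff advection_def)
qed

subsection \<open>Solution of the Galerkin system\<close>

text \<open>The orthogonal projection onto \<open>solenoidal_modes \<Lambda>\<close>: averaging with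
  the conjugate reflection enforces reality, and \<open>leray\<close> enforces zero
  divergence.\<close>

definition real_solenoidal_part :: "(int^'n::finite) set \<Rightarrow> (int^'n \<Rightarrow> complex^'n) \<Rightarrow> int^'n \<Rightarrow> complex^'n" where
  "real_solenoidal_part \<Lambda> x \<xi> = (if \<xi> \<in> \<Lambda> then leray \<xi> ((1/2) *\<^sub>R (x \<xi> + vcnj (x (- \<xi>)))) else 0)"

lemma real_solenoidal_part:
  assumes "\<And>\<xi>. - \<xi> \<in> \<Lambda> \<longleftrightarrow> \<xi> \<in> \<Lambda>" "0 \<notin> \<Lambda>"
  shows "real_solenoidal_part \<Lambda> x \<in> solenoidal_modes \<Lambda>"
proof -
  have "cdot \<xi> (real_solenoidal_part \<Lambda> x \<xi>) = 0" for \<xi>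
    using assms(2) cdot_leray by (cases "\<xi> = 0") (auto simp: real_solenoidal_part_def)
  then show ?thesis
    by (auto simp: solenoidal_modes_def real_solenoidal_part_def assms(1) vcnj_leray vcnj_scaleR vcnj_add add.commute)
qed

text \<open>\<open>leray\<close> does not change products with a solenoidal \<open>v\<close>, and
  reflecting the sum shows that \<open>x\<close> and its conjugate reflection have the same product
  with a real \<open>v\<close>.\<close>

lemma real_solenoidal_part_orthogonal:
  assumes sym: "\<And>\<xi>. - \<xi> \<in> \<Lambda> \<longleftrightarrow> \<xi> \<in> \<Lambda>" and v: "v \<in> solenoidal_modes \<Lambda>"
  shows "(\<Sum>\<xi>\<in>\<Lambda>. (x \<xi> - real_solenoidal_part \<Lambda> x \<xi>) \<bullet> v \<xi>) = 0"
proof -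
  have div: "cdot \<xi> (v \<xi>) = 0" and cn: "v (- \<xi>) = vcnj (v \<xi>)" for \<xi>
    using v by (auto simp: solenoidal_modes_def)
  have "(\<Sum>\<xi>\<in>\<Lambda>. vcnj (x (- \<xi>)) \<bullet> v \<xi>) = (\<Sum>\<xi>\<in>\<Lambda>. x (- \<xi>) \<bullet> v (- \<xi>))"
    using inner_vcnj[of "x (- _)" "vcnj (v _)"] by (intro sum.cong refl) (metis cn inner_vcnj vcnj_vcnj)
  also have "\<dots> = (\<Sum>\<xi>\<in>\<Lambda>. x \<xi> \<bullet> v \<xi>)" by (rule sum_uminus[OF sym, where g = "\<lambda>\<xi>. x \<xi> \<bullet> v \<xi>"])
  finally have *: "(\<Sum>\<xi>\<in>\<Lambda>. vcnj (x (- \<xi>)) \<bullet> v \<xi>) = (\<Sum>\<xi>\<in>\<Lambda>. x \<xi> \<bullet> v \<xi>)" .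
  have "(\<Sum>\<xi>\<in>\<Lambda>. real_solenoidal_part \<Lambda> x \<xi> \<bullet> v \<xi>) = (\<Sum>\<xi>\<in>\<Lambda>. 1/2 * (x \<xi> \<bullet> v \<xi>) + 1/2 * (vcnj (x (- \<xi>)) \<bullet> v \<xi>))"
    by (intro sum.cong refl) (simp add: real_solenoidal_part_def inner_leray[OF div] inner_add_left)
  also have "\<dots> = (\<Sum>\<xi>\<in>\<Lambda>. x \<xi> \<bullet> v \<xi>)"
    unfolding sum.distrib sum_distrib_left[symmetric] * by simp
  finally show ?thesis by (simp add: inner_diff_left sum_subtractf)
qed

definition galerkin_residual ::
  "('n::finite) tensor \<Rightarrow> (int^'n \<Rightarrow> complex^'n) \<Rightarrow> (int^'n) set \<Rightarrow> (int^'n \<Rightarrow> complex^'n) \<Rightarrow> int^'n \<Rightarrow> complex^'n" where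
  "galerkin_residual a f \<Lambda> u \<xi> = viscous_symbol a \<xi> (u \<xi>) + advection \<Lambda> u \<xi> - f \<xi>"

lemma galerkin_residual_inner:
  fixes u :: "int^'n::finite \<Rightarrow> complex^'n"
  assumes sym: "\<And>\<xi>. - \<xi> \<in> \<Lambda> \<longleftrightarrow> \<xi> \<in> \<Lambda>" and u: "u \<in> solenoidal_modes \<Lambda>"
  shows "(\<Sum>\<xi>\<in>\<Lambda>. leray \<xi> (galerkin_residual a f \<Lambda> u \<xi>) \<bullet> u \<xi>) =
    (\<Sum>\<xi>\<in>\<Lambda>. viscous_symbol a \<xi> (u \<xi>) \<bullet> u \<xi>) - (\<Sum>\<xi>\<in>\<Lambda>. f \<xi> \<bullet> u \<xi>)"
proof -
  have div: "cdot \<xi> (u \<xi>) = 0" for \<xi> using u by (auto simp: solenoidal_modes_def)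
  show ?thesis
    using advection_cancel[OF sym u]
    by (simp add: inner_leray[OF div] galerkin_residual_def inner_add_left inner_diff_left sum.distrib sum_subtractf)
qed

text \<open>Makes the projected residual orthogonal to
  \<open>x - real_solenoidal_part \<Lambda> x\<close>, so that the extended system below has no
  mixed terms.\<close>

lemma galerkin_residual_modes:
  assumes sym: "\<And>\<xi>. - \<xi> \<in> \<Lambda> \<longleftrightarrow> \<xi> \<in> \<Lambda>" "0 \<notin> \<Lambda>" and f: "\<And>\<xi>. f (- \<xi>) = vcnj (f \<xi>)"
    and u: "u \<in> solenoidal_modes \<Lambda>"
  shows "(\<lambda>\<xi>. if \<xi> \<in> \<Lambda> then leray \<xi> (galerkin_residual a f \<Lambda> u \<xi>) else 0) \<in> solenoidal_modes \<Lambda>"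
proof -
  have cn: "u (- \<xi>) = vcnj (u \<xi>)" for \<xi> using u by (auto simp: solenoidal_modes_def)
  have "vcnj (leray \<xi> (galerkin_residual a f \<Lambda> u \<xi>)) = leray (- \<xi>) (galerkin_residual a f \<Lambda> u (- \<xi>))" for \<xi>
    unfolding vcnj_leray galerkin_residual_def vcnj_diff vcnj_add vcnj_viscous_symbol vcnj_advection[where \<Lambda> = \<Lambda> and u = u, OF sym(1) cn] f cn ..
  moreover have "cdot \<xi> (if \<xi> \<in> \<Lambda> then leray \<xi> (galerkin_residual a f \<Lambda> u \<xi>) else 0) = 0" for \<xi>
    using sym(2) cdot_leray by (cases "\<xi> = 0") auto
  ultimately show ?thesis by (simp add: solenoidal_modes_def sym(1))
qed

lemma continuous_on_mode:
  fixes \<eta> :: "'i" and j :: "'n::finite"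
  shows "continuous_on UNIV (\<lambda>u :: 'i \<Rightarrow> complex^'n. u \<eta> $ j)"
  by (rule continuous_on_component[OF continuous_on_product_coordinates])

lemmas continuous_on_mode_intros =
  continuous_on_vec_lambda continuous_on_diff continuous_on_add continuous_on_mult continuous_on_sum
  continuous_on_const continuous_on_mode continuous_on_cnj continuous_on_scaleR

lemma galerkin_residual_continuous:
  fixes a :: "('n::finite) tensor"
  shows "continuous_on UNIV (\<lambda>u. leray \<xi> (galerkin_residual a f \<Lambda> u \<xi>))"
  unfolding leray_def galerkin_residual_def viscous_symbol_def advection_def cdot_def divide_inverse
    vector_add_component vector_minus_component vec_lambda_beta
  by (intro continuous_on_mode_intros)

lemma real_solenoidal_part_continuous:
  "continuous_on UNIV (real_solenoidal_part \<Lambda>)"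
proof (rule continuous_on_coordinatewise_then_product)
  fix \<xi> :: "int^'a"
  have "continuous_on UNIV (\<lambda>x. leray \<xi> ((1/2) *\<^sub>R (x \<xi> + vcnj (x (- \<xi>)))))"
    unfolding leray_def cdot_def vcnj_def divide_inverse vector_add_component vector_scaleR_component vec_lambda_beta
    by (intro continuous_on_mode_intros)
  then show "continuous_on UNIV (\<lambda>x. real_solenoidal_part \<Lambda> x \<xi>)"
    by (cases "\<xi> \<in> \<Lambda>") (simp_all add: real_solenoidal_part_def)
qed

text \<open>Coercivity is available on real solenoidal families only. In the product of
  \<open>F x\<close> with \<open>x\<close>, orthogonality removes the mixed terms and leaves the
  viscous form and the force at \<open>Q x\<close> plus the squared norm of \<open>x - Q x\<close>.
  At a zero of \<open>F\<close>, pairing with \<open>x - Q x\<close> shows that this component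
  vanishes on \<Lambda>, so \<open>Q x\<close> solves the system.\<close>

lemma galerkin_solution:
  fixes a :: "('n::finite) tensor" and f :: "int^'n \<Rightarrow> complex^'n"
  assumes sym: "\<And>\<xi>. - \<xi> \<in> \<Lambda> \<longleftrightarrow> \<xi> \<in> \<Lambda>" and "0 \<notin> \<Lambda>" and fin: "finite \<Lambda>"
    and f: "\<And>\<xi>. f (- \<xi>) = vcnj (f \<xi>)"
    and c: "c > 0" and coer: "\<And>\<xi> w. cdot \<xi> w = 0 \<Longrightarrow> viscous_symbol a \<xi> w \<bullet> w \<ge> c * (norm (lattice_vec \<xi>) * norm w)\<^sup>2"
  obtains u where "u \<in> solenoidal_modes \<Lambda>" "\<And>\<xi>. \<xi> \<in> \<Lambda> \<Longrightarrow> leray \<xi> (galerkin_residual a f \<Lambda> u \<xi>) = 0"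
proof -
  define Q where "Q = real_solenoidal_part \<Lambda>"
  define G where "G u \<xi> = leray \<xi> (galerkin_residual a f \<Lambda> u \<xi>)" for u \<xi>
  \<comment> \<open>The summand \<open>x - Q x\<close> extends the equation from the real solenoidal modes to all families of
    coefficients without creating new zeros.\<close>
  define F where "F x \<xi> = G (Q x) \<xi> + (x \<xi> - Q x \<xi>)" for x \<xi>
  have Qm: "Q x \<in> solenoidal_modes \<Lambda>" for x
    unfolding Q_def by (rule real_solenoidal_part[OF sym \<open>0 \<notin> \<Lambda>\<close>])
  have orth: "(\<Sum>\<xi>\<in>\<Lambda>. (x \<xi> - Q x \<xi>) \<bullet> v \<xi>) = 0" if "v \<in> solenoidal_modes \<Lambda>" for x v
    unfolding Q_def by (rule real_solenoidal_part_orthogonal[OF sym that])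
  have orthG: "(\<Sum>\<xi>\<in>\<Lambda>. (x \<xi> - Q x \<xi>) \<bullet> G (Q x) \<xi>) = 0" for x
    using orth[OF galerkin_residual_modes[where \<Lambda> = \<Lambda> and f = f, OF sym \<open>0 \<notin> \<Lambda>\<close> f Qm], of x a x] by (simp add: G_def cong: sum.cong)
  \<comment> \<open>One constant for both components: the viscous form controls \<open>Q x\<close>
    with \<open>c\<close>, the added summand controls \<open>x - Q x\<close> with 1.\<close>
  define c' where "c' = min c 1"
  have c': "c' > 0" "c' \<le> c" "c' \<le> 1" using c by (auto simp: c'_def)
  define \<Phi> where "\<Phi> = (\<Sum>\<xi>\<in>\<Lambda>. (norm (f \<xi>))\<^sup>2)"
  \<comment> \<open>Chosen so that \<open>\<Phi> / (2 * c') \<le> c' / 2 * R^2\<close>; the left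
    side is what Young's inequality leaves of the force. The summand 1 keeps the radius positive
    when \<open>\<Phi> = 0\<close>.\<close>
  define R where "R = sqrt \<Phi> / c' + 1"
  have \<Phi>: "\<Phi> \<ge> 0" unfolding \<Phi>_def by (intro sum_nonneg) auto
  have R: "R > 0" using c' \<Phi> by (simp add: R_def add_nonneg_pos)
  have "\<exists>x. (\<forall>\<xi>. \<xi> \<notin> \<Lambda> \<longrightarrow> x \<xi> = 0) \<and> (\<forall>\<xi>\<in>\<Lambda>. F x \<xi> = 0)"
  proof (rule coercive_zero[OF fin _ R])
    fix \<xi>
    have cQ: "continuous_on UNIV Q" unfolding Q_def by (rule real_solenoidal_part_continuous)
    have "continuous_on UNIV (\<lambda>x. G (Q x) \<xi>)"
      unfolding G_def by (rule continuous_on_compose2[OF galerkin_residual_continuous cQ]) auto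
    moreover have "continuous_on UNIV (\<lambda>x. Q x \<xi>)"
      by (rule continuous_on_compose2[OF continuous_on_product_coordinates cQ]) auto
    ultimately show "continuous_on UNIV (\<lambda>x. F x \<xi>)"
      unfolding F_def by (intro continuous_intros continuous_on_product_coordinates)
  next
    fix x :: "int^'n \<Rightarrow> complex^'n" assume x: "R\<^sup>2 \<le> (\<Sum>\<xi>\<in>\<Lambda>. (norm (x \<xi>))\<^sup>2)"
    define y where "y = Q x"
    define e where "e \<xi> = x \<xi> - y \<xi>" for \<xi>
    have xye: "x \<xi> = y \<xi> + e \<xi>" for \<xi> by (simp add: e_def)
    have ey: "(\<Sum>\<xi>\<in>\<Lambda>. e \<xi> \<bullet> y \<xi>) = 0" unfolding e_def y_def by (rule orth[OF Qm])
    have eG: "(\<Sum>\<xi>\<in>\<Lambda>. e \<xi> \<bullet> G y \<xi>) = 0" unfolding e_def y_def by (rule orthG)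
    define Y where "Y = (\<Sum>\<xi>\<in>\<Lambda>. (norm (y \<xi>))\<^sup>2)"
    define Z where "Z = (\<Sum>\<xi>\<in>\<Lambda>. (norm (e \<xi>))\<^sup>2)"
    have YZ: "Y \<ge> 0" "Z \<ge> 0" unfolding Y_def Z_def by (intro sum_nonneg; simp)+
    have "(\<Sum>\<xi>\<in>\<Lambda>. (norm (x \<xi>))\<^sup>2) = Y + 2 * (\<Sum>\<xi>\<in>\<Lambda>. e \<xi> \<bullet> y \<xi>) + Z"
      unfolding xye Y_def Z_def
      by (simp add: power2_norm_eq_inner inner_add_left inner_add_right inner_commute sum.distrib sum_distrib_left)
    then have X: "(\<Sum>\<xi>\<in>\<Lambda>. (norm (x \<xi>))\<^sup>2) = Y + Z" using ey by simp
    have "(\<Sum>\<xi>\<in>\<Lambda>. F x \<xi> \<bullet> x \<xi>) = (\<Sum>\<xi>\<in>\<Lambda>. G y \<xi> \<bullet> y \<xi>) + (\<Sum>\<xi>\<in>\<Lambda>. e \<xi> \<bullet> G y \<xi>) + (\<Sum>\<xi>\<in>\<Lambda>. e \<xi> \<bullet> y \<xi>) + Z"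
      unfolding F_def y_def[symmetric] e_def[symmetric] Z_def power2_norm_eq_inner sum.distrib[symmetric]
      by (intro sum.cong refl) (simp add: xye inner_add_left inner_add_right inner_commute)
    then have FX: "(\<Sum>\<xi>\<in>\<Lambda>. F x \<xi> \<bullet> x \<xi>) = (\<Sum>\<xi>\<in>\<Lambda>. viscous_symbol a \<xi> (y \<xi>) \<bullet> y \<xi>) - (\<Sum>\<xi>\<in>\<Lambda>. f \<xi> \<bullet> y \<xi>) + Z"
      using ey eG galerkin_residual_inner[OF sym, of y a f] Qm[of x] by (simp add: G_def y_def)
    have "c' * Y \<le> (\<Sum>\<xi>\<in>\<Lambda>. viscous_symbol a \<xi> (y \<xi>) \<bullet> y \<xi>)"
      unfolding Y_def sum_distrib_left
    proof (rule sum_mono)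
      fix \<xi> assume "\<xi> \<in> \<Lambda>"
      then have "\<xi> \<noteq> 0" using \<open>0 \<notin> \<Lambda>\<close> by auto
      then have "1 * norm (y \<xi>) \<le> norm (lattice_vec \<xi>) * norm (y \<xi>)"
        by (intro mult_right_mono norm_lattice_vec_ge_1) auto
      then have "(norm (y \<xi>))\<^sup>2 \<le> (norm (lattice_vec \<xi>) * norm (y \<xi>))\<^sup>2" by (intro power_mono) auto
      then have "c' * (norm (y \<xi>))\<^sup>2 \<le> c * (norm (lattice_vec \<xi>) * norm (y \<xi>))\<^sup>2"
        using c' c by (intro mult_mono) auto
      also have "\<dots> \<le> viscous_symbol a \<xi> (y \<xi>) \<bullet> y \<xi>"
        using Qm[of x] by (intro coer) (simp add: solenoidal_modes_def y_def)
      finally show "c' * (norm (y \<xi>))\<^sup>2 \<le> viscous_symbol a \<xi> (y \<xi>) \<bullet> y \<xi>" .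
    qed
    moreover have "(\<Sum>\<xi>\<in>\<Lambda>. f \<xi> \<bullet> y \<xi>) \<le> c' / 2 * Y + \<Phi> / (2 * c')"
    proof -
      have "f \<xi> \<bullet> y \<xi> \<le> c' / 2 * (norm (y \<xi>))\<^sup>2 + (norm (f \<xi>))\<^sup>2 / (2 * c')" for \<xi>
      proof -
        have "0 \<le> (c' * norm (y \<xi>) - norm (f \<xi>))\<^sup>2 / (2 * c')" using c' by simp
        then have "norm (f \<xi>) * norm (y \<xi>) \<le> c' / 2 * (norm (y \<xi>))\<^sup>2 + (norm (f \<xi>))\<^sup>2 / (2 * c')"
          using c' by (simp add: power2_eq_square field_simps)
        then show ?thesis using norm_cauchy_schwarz[of "f \<xi>" "y \<xi>"] by linarith
      qed
      then have "(\<Sum>\<xi>\<in>\<Lambda>. f \<xi> \<bullet> y \<xi>) \<le> (\<Sum>\<xi>\<in>\<Lambda>. c' / 2 * (norm (y \<xi>))\<^sup>2 + (norm (f \<xi>))\<^sup>2 / (2 * c'))"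
        by (intro sum_mono)
      then show ?thesis by (simp add: Y_def \<Phi>_def sum.distrib sum_distrib_left sum_divide_distrib)
    qed
    moreover have "c' / 2 * Z \<le> Z" using c' YZ by (intro mult_left_le_one_le) auto
    moreover have "\<Phi> / (2 * c') \<le> c' / 2 * (Y + Z)"
    proof -
      have "\<Phi> / c'\<^sup>2 = (sqrt \<Phi> / c')\<^sup>2" using \<Phi> by (simp add: power_divide)
      also have "\<dots> \<le> R\<^sup>2" using \<Phi> c' by (intro power_mono) (auto simp: R_def)
      also have "\<dots> \<le> Y + Z" using x X by simp
      finally have "\<Phi> / c'\<^sup>2 * (c' / 2) \<le> (Y + Z) * (c' / 2)" using c' by (intro mult_right_mono) auto
      then show ?thesis using c' by (simp add: power2_eq_square mult.commute)
    qed
    ultimately show "0 \<le> (\<Sum>\<xi>\<in>\<Lambda>. F x \<xi> \<bullet> x \<xi>)" unfolding FX by (simp add: distrib_left)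
  qed
  then obtain x where x: "\<And>\<xi>. \<xi> \<in> \<Lambda> \<Longrightarrow> F x \<xi> = 0" by blast
  define e where "e \<xi> = x \<xi> - Q x \<xi>" for \<xi>
  have "0 = (\<Sum>\<xi>\<in>\<Lambda>. e \<xi> \<bullet> F x \<xi>)" using x by simp
  also have "\<dots> = (\<Sum>\<xi>\<in>\<Lambda>. e \<xi> \<bullet> G (Q x) \<xi>) + (\<Sum>\<xi>\<in>\<Lambda>. (norm (e \<xi>))\<^sup>2)"
    by (simp add: F_def e_def[symmetric] inner_add_right sum.distrib power2_norm_eq_inner)
  also have "\<dots> = (\<Sum>\<xi>\<in>\<Lambda>. (norm (e \<xi>))\<^sup>2)" using orthG[of x] by (simp add: e_def)
  finally have "\<forall>\<xi>\<in>\<Lambda>. (norm (e \<xi>))\<^sup>2 = 0" using fin by (subst (asm) eq_commute, subst (asm) sum_nonneg_eq_0_iff) auto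
  then have "G (Q x) \<xi> = 0" if "\<xi> \<in> \<Lambda>" for \<xi> using x[OF that] that by (simp add: F_def e_def)
  then show ?thesis using that[OF Qm[of x]] by (simp add: G_def)
qed

text \<open>Pairing the equation with \<open>u\<close> removes the convective term. At nonzero
  frequencies \<open>rho^2\<close> is at most twice the squared norm of \<xi>, so the viscous form
  is at least \<open>c / 2\<close> times the weighted sum. Young's inequality bounds the force by
  half of that plus \<open>K / c\<close>. The resulting bound does not depend on the size of
  \<Lambda>.\<close>

lemma galerkin_bound:
  fixes a :: "('n::finite) tensor" and f :: "int^'n \<Rightarrow> complex^'n"
  assumes sym: "\<And>\<xi>. - \<xi> \<in> \<Lambda> \<longleftrightarrow> \<xi> \<in> \<Lambda>" and "0 \<notin> \<Lambda>" and fin: "finite \<Lambda>"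
    and c: "c > 0" and coer: "\<And>\<xi> w. cdot \<xi> w = 0 \<Longrightarrow> viscous_symbol a \<xi> w \<bullet> w \<ge> c * (norm (lattice_vec \<xi>) * norm w)\<^sup>2"
    and u: "u \<in> solenoidal_modes \<Lambda>" and eq: "\<And>\<xi>. \<xi> \<in> \<Lambda> \<Longrightarrow> leray \<xi> (galerkin_residual a f \<Lambda> u \<xi>) = 0"
    and f: "(\<Sum>\<xi>\<in>\<Lambda>. (norm (f \<xi>) / rho \<xi>)\<^sup>2) \<le> K" and F: "finite F"
  shows "(\<Sum>\<xi>\<in>F. (rho \<xi> * norm (u \<xi>))\<^sup>2) \<le> 4 * K / c\<^sup>2"
proof -
  have rho2: "(rho \<xi>)\<^sup>2 \<le> 2 * (norm (lattice_vec \<xi>))\<^sup>2" if "\<xi> \<in> \<Lambda>" for \<xi>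
  proof -
    have "1\<^sup>2 \<le> (norm (lattice_vec \<xi>))\<^sup>2"
      using norm_lattice_vec_ge_1[of \<xi>] that \<open>0 \<notin> \<Lambda>\<close> by (intro power_mono) auto
    then show ?thesis by (simp add: rho_squared)
  qed
  define W where "W = (\<Sum>\<xi>\<in>\<Lambda>. (rho \<xi> * norm (u \<xi>))\<^sup>2)"
  have "c / 2 * W \<le> (\<Sum>\<xi>\<in>\<Lambda>. viscous_symbol a \<xi> (u \<xi>) \<bullet> u \<xi>)"
    unfolding W_def sum_distrib_left
  proof (rule sum_mono)
    fix \<xi> assume "\<xi> \<in> \<Lambda>"
    then have "(rho \<xi>)\<^sup>2 * (norm (u \<xi>))\<^sup>2 \<le> 2 * (norm (lattice_vec \<xi>))\<^sup>2 * (norm (u \<xi>))\<^sup>2"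
      by (intro mult_right_mono rho2) auto
    then have "c / 2 * ((rho \<xi>)\<^sup>2 * (norm (u \<xi>))\<^sup>2) \<le> c / 2 * (2 * (norm (lattice_vec \<xi>))\<^sup>2 * (norm (u \<xi>))\<^sup>2)"
      using c by (intro mult_left_mono) auto
    also have "\<dots> = c * (norm (lattice_vec \<xi>) * norm (u \<xi>))\<^sup>2" by (simp add: power_mult_distrib)
    also have "\<dots> \<le> viscous_symbol a \<xi> (u \<xi>) \<bullet> u \<xi>"
      using u by (intro coer) (simp add: solenoidal_modes_def)
    finally show "c / 2 * (rho \<xi> * norm (u \<xi>))\<^sup>2 \<le> viscous_symbol a \<xi> (u \<xi>) \<bullet> u \<xi>"
      by (simp add: power_mult_distrib)
  qed
  also have "\<dots> = (\<Sum>\<xi>\<in>\<Lambda>. f \<xi> \<bullet> u \<xi>)"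
    using galerkin_residual_inner[OF sym u, of a f] eq by simp
  also have "\<dots> \<le> (\<Sum>\<xi>\<in>\<Lambda>. c / 4 * (rho \<xi> * norm (u \<xi>))\<^sup>2 + 1 / c * (norm (f \<xi>) / rho \<xi>)\<^sup>2)"
  proof (rule sum_mono)
    fix \<xi>
    define s where "s = rho \<xi> * norm (u \<xi>)"
    define t where "t = norm (f \<xi>) / rho \<xi>"
    have "f \<xi> \<bullet> u \<xi> \<le> t * s"
      using norm_cauchy_schwarz[of "f \<xi>" "u \<xi>"] rho_pos[of \<xi>] by (simp add: s_def t_def del: rho_pos)
    moreover have "0 \<le> (c / 2 * s - t)\<^sup>2 / c" using c by simp
    then have "t * s \<le> c / 4 * s\<^sup>2 + 1 / c * t\<^sup>2" using c by (simp add: power2_eq_square field_simps)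
    ultimately show "f \<xi> \<bullet> u \<xi> \<le> c / 4 * (rho \<xi> * norm (u \<xi>))\<^sup>2 + 1 / c * (norm (f \<xi>) / rho \<xi>)\<^sup>2"
      by (simp add: s_def t_def)
  qed
  also have "\<dots> = c / 4 * W + 1 / c * (\<Sum>\<xi>\<in>\<Lambda>. (norm (f \<xi>) / rho \<xi>)\<^sup>2)"
    unfolding W_def sum.distrib sum_distrib_left ..
  also have "\<dots> \<le> c / 4 * W + 1 / c * K" using f c by (intro add_left_mono mult_left_mono) auto
  finally have "c / 2 * W \<le> c / 4 * W + 1 / c * K" .
  moreover have "c / 2 * W = c / 4 * W + c / 4 * W" by simp
  ultimately have "c / 4 * W + c / 4 * W \<le> c / 4 * W + 1 / c * K" by (simp only:)
  then have "c / 4 * W \<le> 1 / c * K" by (rule add_le_imp_le_left)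
  then have "4 / c * (c / 4 * W) \<le> 4 / c * (1 / c * K)" using c by (intro mult_left_mono) auto
  then have W: "W \<le> 4 * K / c\<^sup>2" using c by (simp add: power2_eq_square)
  have "(\<Sum>\<xi>\<in>F. (rho \<xi> * norm (u \<xi>))\<^sup>2) = (\<Sum>\<xi>\<in>F \<inter> \<Lambda>. (rho \<xi> * norm (u \<xi>))\<^sup>2)"
    using F u by (intro sum.mono_neutral_right) (auto simp: solenoidal_modes_def)
  also have "\<dots> \<le> W" unfolding W_def using fin by (intro sum_mono2) auto
  finally show ?thesis using W by simp
qed

section \<open>The limit of the Galerkin approximations\<close>

lemma summable_square_mono:
  fixes g h :: "'a \<Rightarrow> real"
  assumes "(\<lambda>x. (h x)\<^sup>2) summable_on UNIV" "\<And>x. \<bar>g x\<bar> \<le> h x"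
  shows "(\<lambda>x. (g x)\<^sup>2) summable_on UNIV"
proof (rule summable_on_comparison_test[OF assms(1)])
  fix x
  have "\<bar>g x\<bar>\<^sup>2 \<le> (h x)\<^sup>2" using assms(2)[of x] by (intro power_mono) auto
  then show "(g x)\<^sup>2 \<le> (h x)\<^sup>2" by simp
qed simp

lemma summable_square_add:
  fixes g h :: "'a \<Rightarrow> real"
  assumes "(\<lambda>x. (g x)\<^sup>2) summable_on UNIV" "(\<lambda>x. (h x)\<^sup>2) summable_on UNIV"
  shows "(\<lambda>x. (g x + h x)\<^sup>2) summable_on UNIV"
proof (rule summable_on_comparison_test)
  show "(\<lambda>x. 2 * (g x)\<^sup>2 + 2 * (h x)\<^sup>2) summable_on UNIV"
    by (intro summable_on_add summable_on_cmult_right assms)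
  fix x
  show "(g x + h x)\<^sup>2 \<le> 2 * (g x)\<^sup>2 + 2 * (h x)\<^sup>2"
    using zero_le_power2[of "g x - h x"] by (simp add: power2_eq_square algebra_simps)
qed simp

lemma summable_square_cmult:
  fixes g :: "'a \<Rightarrow> real"
  assumes "(\<lambda>x. (g x)\<^sup>2) summable_on UNIV"
  shows "(\<lambda>x. (c * g x)\<^sup>2) summable_on UNIV"
  unfolding power_mult_distrib by (intro summable_on_cmult_right assms)

lemma summable_square_sum:
  fixes g :: "'i \<Rightarrow> 'a \<Rightarrow> real"
  assumes "finite A" "\<And>i. i \<in> A \<Longrightarrow> (\<lambda>x. (g i x)\<^sup>2) summable_on UNIV"
  shows "(\<lambda>x. (\<Sum>i\<in>A. g i x)\<^sup>2) summable_on UNIV"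
  using assms by (induction A rule: finite_induct) (auto intro: summable_square_add)

text \<open>The convective term without truncation. It agrees with \<open>advection\<close> on
  families supported in \<Lambda>, so all Galerkin equations can be written with one operator that
  does not change along the sequence.\<close>

definition full_advection :: "(int^'n::finite \<Rightarrow> complex^'n) \<Rightarrow> int^'n \<Rightarrow> complex^'n" where
  "full_advection u \<xi> = (\<chi> k. \<Sum>j\<in>UNIV. 2 * of_real pi * \<i> * of_int (\<xi> $ j) *
     convolution (\<lambda>\<eta>. u \<eta> $ j) (\<lambda>\<eta>. u \<eta> $ k) \<xi>)"

lemma advection_eq_full_advection:
  assumes "finite \<Lambda>" "\<And>\<xi>. \<xi> \<notin> \<Lambda> \<Longrightarrow> u \<xi> = 0"
  shows "advection \<Lambda> u \<xi> = full_advection u \<xi>"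
proof -
  have "convolution (\<lambda>\<eta>. u \<eta> $ j) (\<lambda>\<eta>. u \<eta> $ k) \<xi> = (\<Sum>\<eta>\<in>\<Lambda>. u (\<xi> - \<eta>) $ j * u \<eta> $ k)" for j k
    unfolding convolution_def
    by (rule infsumI, rule has_sum_finite_neutralI[OF assms(1)]) (auto simp: assms(2))
  then show ?thesis by (simp add: advection_def full_advection_def)
qed

lemma convolution_cnj_minus:
  fixes a b :: "'a::ab_group_add \<Rightarrow> complex"
  assumes "\<And>\<xi>. a (- \<xi>) = cnj (a \<xi>)" "\<And>\<xi>. b (- \<xi>) = cnj (b \<xi>)"
  shows "convolution a b (- \<xi>) = cnj (convolution a b \<xi>)"
proof -
  have "bij (uminus :: 'a \<Rightarrow> 'a)" by (rule bij_betw_byWitness[where f' = uminus]) auto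
  from infsum_reindex_bij_betw[OF this, of "\<lambda>\<eta>. a (- \<xi> - \<eta>) * b \<eta>"]
  have "convolution a b (- \<xi>) = (\<Sum>\<^sub>\<infinity>\<eta>. a (- (\<xi> - \<eta>)) * b (- \<eta>))"
    by (simp add: convolution_def)
  also have "\<dots> = cnj (convolution a b \<xi>)"
    unfolding convolution_def infsum_cnj[symmetric] by (simp only: assms complex_cnj_mult)
  finally show ?thesis .
qed

lemma vcnj_full_advection:
  assumes "\<And>\<xi>. u (- \<xi>) = vcnj (u \<xi>)"
  shows "full_advection u (- \<xi>) = vcnj (full_advection u \<xi>)"
  by (simp add: vec_eq_iff full_advection_def convolution_cnj_minus assms)

lemma norm_component_le: "norm (w $ j) \<le> norm w" for w :: "complex^'n::finite"
  by (rule Finite_Cartesian_Product.norm_nth_le)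

lemma component_weighted_bound:
  fixes u :: "int^'n::finite \<Rightarrow> complex^'n"
  assumes "(\<Sum>\<eta>\<in>F. (rho \<eta> * norm (u \<eta>))\<^sup>2) \<le> M"
  shows "(\<Sum>\<eta>\<in>F. (rho \<eta> * cmod (u \<eta> $ j))\<^sup>2) \<le> M"
proof (rule order_trans[OF sum_mono assms])
  fix \<eta>
  have "rho \<eta> * cmod (u \<eta> $ j) \<le> rho \<eta> * norm (u \<eta>)"
    by (intro mult_left_mono norm_component_le) (simp add: less_imp_le)
  then show "(rho \<eta> * cmod (u \<eta> $ j))\<^sup>2 \<le> (rho \<eta> * norm (u \<eta>))\<^sup>2"
    by (intro power_mono) (auto simp: less_imp_le)
qed

section \<open>Passage to the limit in the projected equation\<close>

lemmas tendsto_mode_intros =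
  tendsto_vec_lambda tendsto_diff tendsto_add tendsto_mult tendsto_sum tendsto_const tendsto_cnj

lemma tendsto_viscous_symbol:
  assumes "(v \<longlongrightarrow> w) F"
  shows "((\<lambda>m. viscous_symbol a \<xi> (v m)) \<longlongrightarrow> viscous_symbol a \<xi> w) F"
  unfolding viscous_symbol_def by (intro tendsto_mode_intros tendsto_vec_nth[OF assms])

lemma tendsto_cdot:
  assumes "(v \<longlongrightarrow> w) F"
  shows "((\<lambda>m. cdot \<xi> (v m)) \<longlongrightarrow> cdot \<xi> w) F"
  unfolding cdot_def by (intro tendsto_mode_intros tendsto_vec_nth[OF assms])

lemma tendsto_vcnj:
  assumes "(v \<longlongrightarrow> w) F"
  shows "((\<lambda>m. vcnj (v m)) \<longlongrightarrow> vcnj w) F"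
  unfolding vcnj_def by (intro tendsto_mode_intros tendsto_vec_nth[OF assms])

lemma tendsto_leray:
  assumes "(v \<longlongrightarrow> w) F"
  shows "((\<lambda>m. leray \<xi> (v m)) \<longlongrightarrow> leray \<xi> w) F"
  unfolding leray_def divide_inverse
  by (intro tendsto_mode_intros tendsto_vec_nth[OF assms] tendsto_cdot[OF assms])

text \<open>The factor \<xi> stands outside the convolution, so at a fixed frequency only
  undifferentiated products have to converge.\<close>

lemma tendsto_full_advection:
  fixes u :: "nat \<Rightarrow> int^'n::finite \<Rightarrow> complex^'n"
  assumes bound: "\<And>m F. finite F \<Longrightarrow> (\<Sum>\<eta>\<in>F. (rho \<eta> * norm (u m \<eta>))\<^sup>2) \<le> M"
    and lim: "\<And>\<eta>. (\<lambda>m. u m \<eta>) \<longlonglongrightarrow> l \<eta>"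
  shows "(\<lambda>m. full_advection (u m) \<xi>) \<longlonglongrightarrow> full_advection l \<xi>"
proof -
  have "(\<lambda>m. convolution (\<lambda>\<eta>. u m \<eta> $ j) (\<lambda>\<eta>. u m \<eta> $ k) \<xi>) \<longlonglongrightarrow> convolution (\<lambda>\<eta>. l \<eta> $ j) (\<lambda>\<eta>. l \<eta> $ k) \<xi>" for j k
    by (rule convolution_tendsto[where M = M])
      (auto intro: component_weighted_bound bound tendsto_vec_nth lim)
  then show ?thesis unfolding full_advection_def by (intro tendsto_mode_intros)
qed

text \<open>The energy bound confines every coefficient to one ball, and a countable product of
  compact balls is sequentially compact; this yields a coefficientwise limit without an explicit
  diagonal argument. The linear conditions and the weighted bound are closed under such
  limits.\<close>

lemma projected_fourier_solution:
  fixes a :: "('n::finite) tensor" and f :: "int^'n \<Rightarrow> complex^'n"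
  assumes sym: "symmetric_tensor a" and ell: "relaxed_elliptic a"
    and f: "\<And>\<xi>. f (- \<xi>) = vcnj (f \<xi>)" and fs: "(\<lambda>\<xi>. (norm (f \<xi>) / rho \<xi>)\<^sup>2) summable_on UNIV"
  obtains u where "u 0 = 0" "\<And>\<xi>. cdot \<xi> (u \<xi>) = 0" "\<And>\<xi>. u (- \<xi>) = vcnj (u \<xi>)"
    "(\<lambda>\<xi>. (rho \<xi> * norm (u \<xi>))\<^sup>2) summable_on UNIV"
    "\<And>\<xi>. \<xi> \<noteq> 0 \<Longrightarrow> leray \<xi> (viscous_symbol a \<xi> (u \<xi>) + full_advection u \<xi> - f \<xi>) = 0"
proof -
  obtain C where C: "C > 0" and ell': "\<And>\<zeta>::real^'n^'n. transpose \<zeta> = \<zeta> \<Longrightarrow> trace \<zeta> = 0 \<Longrightarrow>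
        (\<Sum>k\<in>UNIV. \<Sum>j\<in>UNIV. \<Sum>\<alpha>\<in>UNIV. \<Sum>\<beta>\<in>UNIV. a k j \<alpha> \<beta> * \<zeta> $ k $ \<alpha> * \<zeta> $ j $ \<beta>)
          \<ge> inverse C * (\<Sum>k\<in>UNIV. \<Sum>\<alpha>\<in>UNIV. (\<zeta> $ k $ \<alpha>)\<^sup>2)"
    using ell unfolding relaxed_elliptic_def by blast
  define c where "c = 2 * pi\<^sup>2 * inverse C"
  have c: "c > 0" using C by (simp add: c_def)
  have coer: "viscous_symbol a \<xi> w \<bullet> w \<ge> c * (norm (lattice_vec \<xi>) * norm w)\<^sup>2" if "cdot \<xi> w = 0" for \<xi> w
    unfolding c_def by (rule viscous_symbol_coercive[OF sym ell' that])
  define K where "K = (\<Sum>\<^sub>\<infinity>\<xi>. (norm (f \<xi>) / rho \<xi>)\<^sup>2)"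
  define M where "M = 4 * K / c\<^sup>2"
  \<comment> \<open>Removing 0 restricts the system to mean-zero fields; at the remaining
    frequencies the viscous form is coercive.\<close>
  define \<Lambda> :: "nat \<Rightarrow> (int^'n) set" where "\<Lambda> N = lattice_box N - {0}" for N
  have \<Lambda>: "- \<xi> \<in> \<Lambda> N \<longleftrightarrow> \<xi> \<in> \<Lambda> N" "0 \<notin> \<Lambda> N" "finite (\<Lambda> N)" for \<xi> N by (auto simp: \<Lambda>_def)
  have "\<exists>u. u \<in> solenoidal_modes (\<Lambda> N) \<and> (\<forall>\<xi>\<in>\<Lambda> N. leray \<xi> (galerkin_residual a f (\<Lambda> N) u \<xi>) = 0)" for N
    using galerkin_solution[where \<Lambda> = "\<Lambda> N" and f = f and a = a and c = c, OF \<Lambda> f c coer] by metis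
  then obtain U where U: "\<And>N. U N \<in> solenoidal_modes (\<Lambda> N)"
    and eq: "\<And>N \<xi>. \<xi> \<in> \<Lambda> N \<Longrightarrow> leray \<xi> (galerkin_residual a f (\<Lambda> N) (U N) \<xi>) = 0"
    by metis
  have bound: "(\<Sum>\<xi>\<in>F. (rho \<xi> * norm (U N \<xi>))\<^sup>2) \<le> M" if "finite F" for F N
    unfolding M_def
  proof (rule galerkin_bound[where \<Lambda> = "\<Lambda> N" and f = f and a = a and c = c, OF \<Lambda> c coer U eq _ that])
    show "(\<Sum>\<xi>\<in>\<Lambda> N. (norm (f \<xi>) / rho \<xi>)\<^sup>2) \<le> K"
      unfolding K_def by (rule finite_sum_le_infsum[OF fs \<Lambda>(3)]) auto
  qed
  have "norm (U N \<xi>) \<le> sqrt M" for N \<xi>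
  proof -
    have "norm (U N \<xi>) \<le> rho \<xi> * norm (U N \<xi>)" using mult_right_mono[OF rho_ge_1, of "norm (U N \<xi>)" \<xi>] by simp
    moreover have "(rho \<xi> * norm (U N \<xi>))\<^sup>2 \<le> M" using bound[of "{\<xi>}" N] by simp
    then have "rho \<xi> * norm (U N \<xi>) \<le> sqrt M" by (rule real_le_rsqrt)
    ultimately show ?thesis by linarith
  qed
  then have "U N \<in> PiE UNIV (\<lambda>_. cball 0 (sqrt M))" for N by auto
  moreover have "compact (PiE UNIV (\<lambda>_ :: int^'n. cball (0 :: complex^'n) (sqrt M)))"
    using compactin_PiE[where X = "\<lambda>_. euclidean" and I = UNIV and S = "\<lambda>_ :: int^'n. cball (0 :: complex^'n) (sqrt M)"]
    by (simp add: euclidean_product_topology)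
  ultimately obtain l \<sigma> where \<sigma>: "strict_mono (\<sigma> :: nat \<Rightarrow> nat)" and "(U \<circ> \<sigma>) \<longlonglongrightarrow> l"
    unfolding compact_def by metis
  then have lim: "(\<lambda>m. U (\<sigma> m) \<xi>) \<longlonglongrightarrow> l \<xi>" for \<xi>
    using continuous_on_tendsto_compose[OF continuous_on_product_coordinates[of \<xi>], of "U \<circ> \<sigma>" l] by (simp add: o_def)
  have modes: "U N 0 = 0" "cdot \<xi> (U N \<xi>) = 0" "U N (- \<xi>) = vcnj (U N \<xi>)" "\<xi> \<notin> \<Lambda> N \<Longrightarrow> U N \<xi> = 0" for N \<xi>
    using U[of N] \<Lambda>(2)[of N] by (auto simp: solenoidal_modes_def)
  show ?thesis
  proof (rule that)
    show "l 0 = 0" using lim[of 0] by (simp add: modes(1) LIMSEQ_const_iff)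
    show "cdot \<xi> (l \<xi>) = 0" for \<xi>
      using tendsto_cdot[OF lim[of \<xi>], of \<xi>] by (simp add: modes(2) LIMSEQ_const_iff)
    show "l (- \<xi>) = vcnj (l \<xi>)" for \<xi>
      using LIMSEQ_unique[OF lim[of "- \<xi>"]] tendsto_vcnj[OF lim[of \<xi>]] by (simp add: modes(3))
    show "(\<lambda>\<xi>. (rho \<xi> * norm (l \<xi>))\<^sup>2) summable_on UNIV"
      by (rule summable_on_if_bounded(1)[where M = M])
        (auto intro: weighted_l2_limit[where a = "\<lambda>m. U (\<sigma> m)", OF bound lim])
  next
    fix \<xi> :: "int^'n" assume "\<xi> \<noteq> 0"
    have "(\<lambda>m. leray \<xi> (viscous_symbol a \<xi> (U (\<sigma> m) \<xi>) + full_advection (U (\<sigma> m)) \<xi> - f \<xi>)) \<longlonglongrightarrow>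
        leray \<xi> (viscous_symbol a \<xi> (l \<xi>) + full_advection l \<xi> - f \<xi>)"
      by (intro tendsto_leray tendsto_diff tendsto_add tendsto_const tendsto_viscous_symbol lim
          tendsto_full_advection[OF bound lim])
    \<comment> \<open>A fixed nonzero frequency lies in all large boxes, so the projected equation
      holds there exactly from some index on.\<close>
    moreover have "\<forall>\<^sub>F m in sequentially. leray \<xi> (viscous_symbol a \<xi> (U (\<sigma> m) \<xi>) + full_advection (U (\<sigma> m)) \<xi> - f \<xi>) = 0"
    proof -
      obtain N where "{\<xi>} \<subseteq> lattice_box N" using finite_subset_lattice_box[of "{\<xi>}"] by auto
      then have N: "\<xi> \<in> \<Lambda> n" if "n \<ge> N" for n using \<open>\<xi> \<noteq> 0\<close> lattice_box_mono[OF that] by (auto simp: \<Lambda>_def)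
      show ?thesis
        using eventually_ge_at_top[of N]
      proof eventually_elim
        case (elim m)
        then have "\<sigma> m \<ge> N" using seq_suble[OF \<sigma>, of m] by simp
        from eq[OF N[OF this]] show ?case
          by (simp add: galerkin_residual_def advection_eq_full_advection[OF \<Lambda>(3) modes(4)])
      qed
    qed
    then have "(\<lambda>m. leray \<xi> (viscous_symbol a \<xi> (U (\<sigma> m) \<xi>) + full_advection (U (\<sigma> m)) \<xi> - f \<xi>)) \<longlonglongrightarrow> 0"
      by (rule tendsto_eventually)
    ultimately show "leray \<xi> (viscous_symbol a \<xi> (l \<xi>) + full_advection l \<xi> - f \<xi>) = 0"
      by (rule LIMSEQ_unique)
  qed
qed

section \<open>Recovery and square-summability of the pressure\<close>

lemma abs_component_le_norm_lattice_vec: "\<bar>real_of_int (\<xi> $ j)\<bar> \<le> norm (lattice_vec \<xi>)"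
  using component_le_norm_cart[of "lattice_vec \<xi>" j] by simp

lemma viscous_symbol_bound:
  fixes a :: "('n::finite) tensor"
  obtains A where "A \<ge> 0" "\<And>\<xi> w k. cmod (viscous_symbol a \<xi> w $ k) \<le> A * (norm (lattice_vec \<xi>))\<^sup>2 * norm w"
proof
  define A where "A = 4 * pi\<^sup>2 * (\<Sum>k\<in>UNIV. \<Sum>j\<in>UNIV. \<Sum>\<alpha>\<in>UNIV. \<Sum>\<beta>\<in>UNIV. \<bar>a k j \<alpha> \<beta>\<bar>)"
  show "A \<ge> 0" unfolding A_def by (intro mult_nonneg_nonneg sum_nonneg) auto
  fix \<xi> :: "int^'n" and w :: "complex^'n" and k
  define r where "r = norm (lattice_vec \<xi>)"
  have r: "\<bar>real_of_int (\<xi> $ j)\<bar> \<le> r" "r \<ge> 0" for j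
    using abs_component_le_norm_lattice_vec[of \<xi> j] by (simp_all add: r_def)
  have "cmod (viscous_symbol a \<xi> w $ k) =
      4 * pi\<^sup>2 * cmod (\<Sum>j\<in>UNIV. (\<Sum>\<alpha>\<in>UNIV. \<Sum>\<beta>\<in>UNIV. of_real (a k j \<alpha> \<beta> * real_of_int (\<xi> $ \<alpha>) * real_of_int (\<xi> $ \<beta>))) * w $ j)"
    unfolding viscous_symbol_def vec_lambda_beta norm_mult norm_of_real by simp
  also have "\<dots> \<le> 4 * pi\<^sup>2 * (\<Sum>j\<in>UNIV. (\<Sum>\<alpha>\<in>UNIV. \<Sum>\<beta>\<in>UNIV. \<bar>a k j \<alpha> \<beta>\<bar> * r * r) * norm w)"
  proof (intro mult_left_mono)
    show "cmod (\<Sum>j\<in>UNIV. (\<Sum>\<alpha>\<in>UNIV. \<Sum>\<beta>\<in>UNIV. of_real (a k j \<alpha> \<beta> * real_of_int (\<xi> $ \<alpha>) * real_of_int (\<xi> $ \<beta>))) * w $ j) \<le>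
        (\<Sum>j\<in>UNIV. (\<Sum>\<alpha>\<in>UNIV. \<Sum>\<beta>\<in>UNIV. \<bar>a k j \<alpha> \<beta>\<bar> * r * r) * norm w)"
    proof (rule sum_norm_le)
      fix j
      have "cmod (\<Sum>\<alpha>\<in>UNIV. \<Sum>\<beta>\<in>UNIV. of_real (a k j \<alpha> \<beta> * real_of_int (\<xi> $ \<alpha>) * real_of_int (\<xi> $ \<beta>))) \<le>
          (\<Sum>\<alpha>\<in>UNIV. \<Sum>\<beta>\<in>UNIV. \<bar>a k j \<alpha> \<beta>\<bar> * r * r)"
      proof (rule sum_norm_le, rule sum_norm_le)
        fix \<alpha> \<beta>
        have "\<bar>a k j \<alpha> \<beta>\<bar> * \<bar>real_of_int (\<xi> $ \<alpha>)\<bar> * \<bar>real_of_int (\<xi> $ \<beta>)\<bar> \<le> \<bar>a k j \<alpha> \<beta>\<bar> * r * r"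
          using r by (intro mult_mono mult_nonneg_nonneg) auto
        then show "cmod (of_real (a k j \<alpha> \<beta> * real_of_int (\<xi> $ \<alpha>) * real_of_int (\<xi> $ \<beta>))) \<le> \<bar>a k j \<alpha> \<beta>\<bar> * r * r"
          unfolding norm_of_real abs_mult .
      qed
      then show "cmod ((\<Sum>\<alpha>\<in>UNIV. \<Sum>\<beta>\<in>UNIV. of_real (a k j \<alpha> \<beta> * real_of_int (\<xi> $ \<alpha>) * real_of_int (\<xi> $ \<beta>))) * w $ j) \<le>
          (\<Sum>\<alpha>\<in>UNIV. \<Sum>\<beta>\<in>UNIV. \<bar>a k j \<alpha> \<beta>\<bar> * r * r) * norm w"
        unfolding norm_mult using r by (intro mult_mono norm_component_le) (auto intro!: sum_nonneg mult_nonneg_nonneg)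
    qed
  qed simp
  also have "\<dots> = 4 * pi\<^sup>2 * (\<Sum>j\<in>UNIV. \<Sum>\<alpha>\<in>UNIV. \<Sum>\<beta>\<in>UNIV. \<bar>a k j \<alpha> \<beta>\<bar>) * r\<^sup>2 * norm w"
    by (simp add: sum_distrib_right power2_eq_square mult.assoc)
  also have "\<dots> \<le> A * r\<^sup>2 * norm w"
    unfolding A_def
    by (intro mult_right_mono mult_left_mono member_le_sum[where f = "\<lambda>k. \<Sum>j\<in>UNIV. \<Sum>\<alpha>\<in>UNIV. \<Sum>\<beta>\<in>UNIV. \<bar>a k j \<alpha> \<beta>\<bar>"])
      (auto intro!: sum_nonneg)
  finally show "cmod (viscous_symbol a \<xi> w $ k) \<le> A * (norm (lattice_vec \<xi>))\<^sup>2 * norm w" by (simp add: r_def)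
qed

text \<open>The residual of the projected equation is parallel to \<open>\<xi>\<close>, which yields the pressure.
  It is square-integrable since \<open>u \<otimes> u\<close> is.\<close>

theorem fourier_solution:
  fixes a :: "('n::finite) tensor" and f :: "int^'n \<Rightarrow> complex^'n"
  assumes n: "CARD('n) < 4" and sym: "symmetric_tensor a" and ell: "relaxed_elliptic a"
    and f: "\<And>\<xi>. f (- \<xi>) = vcnj (f \<xi>)" "f 0 = 0"
    and fs: "(\<lambda>\<xi>. (norm (f \<xi>) / rho \<xi>)\<^sup>2) summable_on UNIV"
  obtains u p where "u 0 = 0" "\<And>\<xi>. cdot \<xi> (u \<xi>) = 0" "\<And>\<xi>. u (- \<xi>) = vcnj (u \<xi>)"
    "(\<lambda>\<xi>. (rho \<xi> * norm (u \<xi>))\<^sup>2) summable_on UNIV"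
    "p 0 = 0" "\<And>\<xi>. p (- \<xi>) = cnj (p \<xi>)" "(\<lambda>\<xi>. (cmod (p \<xi>))\<^sup>2) summable_on UNIV"
    "\<And>\<xi> k. viscous_symbol a \<xi> (u \<xi>) $ k + full_advection u \<xi> $ k + 2 * of_real pi * \<i> * of_int (\<xi> $ k) * p \<xi> = f \<xi> $ k"
proof -
  obtain u where u: "u 0 = 0" "\<And>\<xi>. cdot \<xi> (u \<xi>) = 0" "\<And>\<xi>. u (- \<xi>) = vcnj (u \<xi>)"
    and us: "(\<lambda>\<xi>. (rho \<xi> * norm (u \<xi>))\<^sup>2) summable_on UNIV"
    and eq: "\<And>\<xi>. \<xi> \<noteq> 0 \<Longrightarrow> leray \<xi> (viscous_symbol a \<xi> (u \<xi>) + full_advection u \<xi> - f \<xi>) = 0"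
    by (rule projected_fourier_solution[where f = f, OF sym ell f(1) fs]) (rule that)
  define r where "r \<xi> = viscous_symbol a \<xi> (u \<xi>) + full_advection u \<xi> - f \<xi>" for \<xi>
  \<comment> \<open>If \<open>r \<xi>\<close> is a multiple of \<xi>, this solves
    \<open>r \<xi> $ k + 2 * pi * \<i> * \<xi> $ k * p \<xi> = 0\<close> for all k at once. At 0 the
    division by 0 gives the required mean value.\<close>
  define p where "p \<xi> = - cdot \<xi> (r \<xi>) / (2 * of_real pi * \<i> * of_real ((norm (lattice_vec \<xi>))\<^sup>2))" for \<xi>
  have r_cnj: "r (- \<xi>) = vcnj (r \<xi>)" for \<xi>
    unfolding r_def vcnj_diff vcnj_add vcnj_viscous_symbol vcnj_full_advection[of u, OF u(3)] u(3) f(1) ..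
  \<comment> \<open>At frequency 0 the derivatives annihilate the viscous and convective terms and
    the force has mean zero, so the full equation holds there as well.\<close>
  have r0: "r 0 = 0" using u(1) f(2) by (simp add: r_def vec_eq_iff viscous_symbol_def full_advection_def)
  have eqn: "r \<xi> $ k + 2 * of_real pi * \<i> * of_int (\<xi> $ k) * p \<xi> = 0" for \<xi> k
  proof (cases "\<xi> = 0")
    case False
    have "r \<xi> $ k = of_int (\<xi> $ k) * (cdot \<xi> (r \<xi>) / of_real ((norm (lattice_vec \<xi>))\<^sup>2))"
      by (rule leray_eq_0) (simp only: r_def eq[OF False])
    then show ?thesis by (simp add: p_def)
  qed (simp add: r0)
  obtain A where A: "A \<ge> 0" "\<And>\<xi> w k. cmod (viscous_symbol a \<xi> w $ k) \<le> A * (norm (lattice_vec \<xi>))\<^sup>2 * norm w"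
    using viscous_symbol_bound[of a] by blast
  define cv where "cv j k = convolution (\<lambda>\<eta>. u \<eta> $ j) (\<lambda>\<eta>. u \<eta> $ k)" for j k
  \<comment> \<open>Each term of the residual is at most the norm of \<xi> times a square-summable
    quantity, and the summands of \<open>h\<close> are these quantities. The pressure divides the
    residual by one power of \<xi>. The final factor 2 comes from
    \<open>rho \<xi> \<le> 2 * norm (lattice_vec \<xi>)\<close> at nonzero frequencies.\<close>
  define h where "h k \<xi> = A * (rho \<xi> * norm (u \<xi>)) + (\<Sum>j\<in>UNIV. 2 * pi * cmod (cv j k \<xi>)) + 2 * (norm (f \<xi>) / rho \<xi>)" for k \<xi>
  have uj: "(\<lambda>\<eta>. (rho \<eta> * cmod (u \<eta> $ j))\<^sup>2) summable_on UNIV" for j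
    by (rule summable_square_mono[OF us]) (auto simp: abs_mult less_imp_le intro!: mult_left_mono norm_component_le)
  have cv: "(\<lambda>\<xi>. (cmod (cv j k \<xi>))\<^sup>2) summable_on UNIV" for j k
    unfolding cv_def by (rule convolution_l2[OF n uj uj])
  have "(\<lambda>\<xi>. (h k \<xi>)\<^sup>2) summable_on UNIV" for k
    unfolding h_def
    by (intro summable_square_add summable_square_sum summable_square_cmult us cv fs) simp
  then have hs: "(\<lambda>\<xi>. (\<Sum>k\<in>UNIV. h k \<xi>)\<^sup>2) summable_on UNIV"
    by (intro summable_square_sum) auto
  have p_le: "cmod (p \<xi>) \<le> (\<Sum>k\<in>UNIV. h k \<xi>)" for \<xi>
  proof (cases "\<xi> = 0")
    case True
    then show ?thesis using A by (auto simp: p_def r0 h_def less_imp_le intro!: sum_nonneg add_nonneg_nonneg mult_nonneg_nonneg)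
  next
    case False
    define s where "s = norm (lattice_vec \<xi>)"
    have s: "s \<ge> 1" unfolding s_def by (rule norm_lattice_vec_ge_1[OF False])
    have comp: "\<bar>real_of_int (\<xi> $ k)\<bar> \<le> s" for k unfolding s_def by (rule abs_component_le_norm_lattice_vec)
    have rho: "s \<le> rho \<xi>" "rho \<xi> \<le> 2 * s"
    proof -
      have eq: "(rho \<xi>)\<^sup>2 = 1 + s\<^sup>2" by (simp add: rho_squared s_def)
      have "1\<^sup>2 \<le> s\<^sup>2" using s by (intro power_mono) auto
      then have "(rho \<xi>)\<^sup>2 \<le> (2 * s)\<^sup>2" unfolding eq power_mult_distrib by simp
      then show "rho \<xi> \<le> 2 * s" by (rule power2_le_imp_le) (use s in simp)
      have "s\<^sup>2 \<le> (rho \<xi>)\<^sup>2" by (simp add: eq)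
      then show "s \<le> rho \<xi>" by (rule power2_le_imp_le) (simp add: less_imp_le)
    qed
    have r_le: "cmod (r \<xi> $ k) \<le> s * h k \<xi>" for k
    proof -
      have "cmod (viscous_symbol a \<xi> (u \<xi>) $ k) \<le> s * (A * (rho \<xi> * norm (u \<xi>)))"
      proof -
        have "A * (s * s) * norm (u \<xi>) \<le> A * (s * rho \<xi>) * norm (u \<xi>)"
          using A s rho by (intro mult_right_mono mult_left_mono) auto
        then show ?thesis using A(2)[of \<xi> "u \<xi>" k] by (simp add: s_def power2_eq_square mult_ac)
      qed
      moreover have "cmod (full_advection u \<xi> $ k) \<le> s * (\<Sum>j\<in>UNIV. 2 * pi * cmod (cv j k \<xi>))"
        unfolding full_advection_def vec_lambda_beta sum_distrib_left
      proof (rule sum_norm_le)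
        fix j
        have "2 * pi * \<bar>real_of_int (\<xi> $ j)\<bar> * cmod (cv j k \<xi>) \<le> 2 * pi * s * cmod (cv j k \<xi>)"
          using comp[of j] by (intro mult_right_mono mult_left_mono) auto
        then show "cmod (2 * of_real pi * \<i> * of_int (\<xi> $ j) * convolution (\<lambda>\<eta>. u \<eta> $ j) (\<lambda>\<eta>. u \<eta> $ k) \<xi>)
            \<le> s * (2 * pi * cmod (cv j k \<xi>))"
          by (simp add: norm_mult cv_def mult_ac)
      qed
      moreover have "cmod (f \<xi> $ k) \<le> s * (2 * (norm (f \<xi>) / rho \<xi>))"
      proof -
        have "norm (f \<xi>) * rho \<xi> \<le> norm (f \<xi>) * (2 * s)" using rho by (intro mult_left_mono) auto
        then have "norm (f \<xi>) \<le> s * (2 * (norm (f \<xi>) / rho \<xi>))"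
          using rho_pos[of \<xi>] by (simp add: field_simps del: rho_pos)
        then show ?thesis using norm_component_le[of "f \<xi>" k] by linarith
      qed
      moreover have "cmod (r \<xi> $ k) \<le> cmod (viscous_symbol a \<xi> (u \<xi>) $ k) + cmod (full_advection u \<xi> $ k) + cmod (f \<xi> $ k)"
        unfolding r_def vector_minus_component vector_add_component
        by (rule order_trans[OF norm_triangle_ineq4 add_right_mono[OF norm_triangle_ineq]])
      ultimately show ?thesis unfolding h_def by (simp add: distrib_left)
    qed
    have "cmod (cdot \<xi> (r \<xi>)) \<le> (\<Sum>k\<in>UNIV. s * (s * h k \<xi>))"
      unfolding cdot_def
    proof (rule sum_norm_le)
      fix k
      show "cmod (of_int (\<xi> $ k) * r \<xi> $ k) \<le> s * (s * h k \<xi>)"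
        unfolding norm_mult using comp[of k] r_le[of k] s by (intro mult_mono) auto
    qed
    also have "\<dots> = s\<^sup>2 * (\<Sum>k\<in>UNIV. h k \<xi>)" by (simp add: sum_distrib_left power2_eq_square mult.assoc)
    finally have le: "cmod (cdot \<xi> (r \<xi>)) \<le> s\<^sup>2 * (\<Sum>k\<in>UNIV. h k \<xi>)" .
    have "1 \<le> 2 * pi" using pi_gt3 by simp
    then have "1 * s\<^sup>2 \<le> 2 * pi * s\<^sup>2" by (intro mult_right_mono) auto
    then have "cmod (p \<xi>) \<le> cmod (cdot \<xi> (r \<xi>)) / s\<^sup>2"
      using s unfolding p_def s_def[symmetric] norm_divide norm_mult norm_minus_cancel
      by (intro frac_le) (auto simp: norm_power)
    also have "\<dots> \<le> (\<Sum>k\<in>UNIV. h k \<xi>)" using le s by (simp add: divide_le_eq mult.commute)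
    finally show ?thesis .
  qed
  show ?thesis
  proof (rule that[OF u us])
    show "p 0 = 0" by (simp add: p_def r0)
    show "p (- \<xi>) = cnj (p \<xi>)" for \<xi> by (simp add: p_def r_cnj cdot_vcnj)
    show "(\<lambda>\<xi>. (cmod (p \<xi>))\<^sup>2) summable_on UNIV"
      by (rule summable_square_mono[OF hs]) (simp add: p_le)
    show "viscous_symbol a \<xi> (u \<xi>) $ k + full_advection u \<xi> $ k + 2 * of_real pi * \<i> * of_int (\<xi> $ k) * p \<xi> = f \<xi> $ k" for \<xi> k
      using eqn[of \<xi> k] by (simp add: r_def algebra_simps)
  qed
qed

section \<open>From Fourier coefficients to distributions\<close>

lemma has_sum_finite_sum:
  fixes f :: "'i \<Rightarrow> 'a \<Rightarrow> 'b::{topological_comm_monoid_add, t2_space}"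
  assumes "finite A" "\<And>i. i \<in> A \<Longrightarrow> (f i has_sum s i) B"
  shows "((\<lambda>x. \<Sum>i\<in>A. f i x) has_sum (\<Sum>i\<in>A. s i)) B"
  using assms by (induction A rule: finite_induct) (auto intro: has_sum_add)

lemma periodic_distributionsI:
  assumes "\<And>\<phi> \<psi> a b. \<phi> \<in> test_functions \<Longrightarrow> \<psi> \<in> test_functions \<Longrightarrow>
      g (\<lambda>x. a * \<phi> x + b * \<psi> x) = a * g \<phi> + b * g \<psi>"
    and "\<And>\<Phi> \<phi>. \<phi> \<in> test_functions \<Longrightarrow> (\<And>m. \<Phi> m \<in> test_functions) \<Longrightarrow> test_converges \<Phi> \<phi> \<Longrightarrow>
      (\<lambda>m. g (\<Phi> m)) \<longlonglongrightarrow> g \<phi>"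
  shows "g \<in> periodic_distributions"
  using assms unfolding periodic_distributions_def by blast

lemma periodic_distributions_sum:
  assumes "\<And>i. i \<in> A \<Longrightarrow> g i \<in> periodic_distributions"
  shows "(\<lambda>\<phi>. \<Sum>i\<in>A. g i \<phi>) \<in> periodic_distributions"
proof (rule periodic_distributionsI)
  show "(\<Sum>i\<in>A. g i (\<lambda>x. a * \<phi> x + b * \<psi> x)) = a * (\<Sum>i\<in>A. g i \<phi>) + b * (\<Sum>i\<in>A. g i \<psi>)"
    if "\<phi> \<in> test_functions" "\<psi> \<in> test_functions" for \<phi> \<psi> a b
    using that assms by (simp add: periodic_distributions_lincomb sum.distrib sum_distrib_left)
  show "(\<lambda>m. \<Sum>i\<in>A. g i (\<Phi> m)) \<longlonglongrightarrow> (\<Sum>i\<in>A. g i \<phi>)"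
    if "\<phi> \<in> test_functions" "\<And>m. \<Phi> m \<in> test_functions" "test_converges \<Phi> \<phi>" for \<Phi> \<phi>
    by (rule tendsto_sum) (rule periodic_distributions_tendsto[OF assms that])
qed

lemma periodic_distributions_cmult:
  assumes "g \<in> periodic_distributions"
  shows "(\<lambda>\<phi>. c * g \<phi>) \<in> periodic_distributions"
proof (rule periodic_distributionsI)
  show "c * g (\<lambda>x. a * \<phi> x + b * \<psi> x) = a * (c * g \<phi>) + b * (c * g \<psi>)"
    if "\<phi> \<in> test_functions" "\<psi> \<in> test_functions" for \<phi> \<psi> a b
    using that assms by (simp add: periodic_distributions_lincomb algebra_simps)
  show "(\<lambda>m. c * g (\<Phi> m)) \<longlonglongrightarrow> c * g \<phi>"
    if "\<phi> \<in> test_functions" "\<And>m. \<Phi> m \<in> test_functions" "test_converges \<Phi> \<phi>" for \<Phi> \<phi>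
    by (rule tendsto_mult_left) (rule periodic_distributions_tendsto[OF assms that])
qed

lemma periodic_distributions_diff:
  assumes "g \<in> periodic_distributions" "h \<in> periodic_distributions"
  shows "(\<lambda>\<phi>. g \<phi> - h \<phi>) \<in> periodic_distributions"
proof (rule periodic_distributionsI)
  show "g (\<lambda>x. a * \<phi> x + b * \<psi> x) - h (\<lambda>x. a * \<phi> x + b * \<psi> x) = a * (g \<phi> - h \<phi>) + b * (g \<psi> - h \<psi>)"
    if "\<phi> \<in> test_functions" "\<psi> \<in> test_functions" for \<phi> \<psi> a b
    using that assms by (simp add: periodic_distributions_lincomb algebra_simps)
  show "(\<lambda>m. g (\<Phi> m) - h (\<Phi> m)) \<longlonglongrightarrow> g \<phi> - h \<phi>"
    if "\<phi> \<in> test_functions" "\<And>m. \<Phi> m \<in> test_functions" "test_converges \<Phi> \<phi>" for \<Phi> \<phi>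
    by (rule tendsto_diff; rule periodic_distributions_tendsto[OF _ that]) (rule assms)+
qed

lemma periodic_distributions_deriv:
  assumes g: "g \<in> periodic_distributions"
  shows "dist_deriv i g \<in> periodic_distributions"
proof (rule periodic_distributionsI)
  fix \<phi> \<psi> :: "real^'a \<Rightarrow> real" and a b assume t: "\<phi> \<in> test_functions" "\<psi> \<in> test_functions"
  then have "partial i (\<lambda>x. a * \<phi> x + b * \<psi> x) = (\<lambda>x. a * partial i \<phi> x + b * partial i \<psi> x)"
    by (intro partial_lincomb smooth_differentiable) (auto simp: test_functions_def)
  then show "dist_deriv i g (\<lambda>x. a * \<phi> x + b * \<psi> x) = a * dist_deriv i g \<phi> + b * dist_deriv i g \<psi>"
    using t by (simp add: dist_deriv_def periodic_distributions_lincomb[OF g] test_functions_partial)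
next
  fix \<Phi> and \<phi> :: "real^'a \<Rightarrow> real"
  assume t: "\<phi> \<in> test_functions" "\<And>m. \<Phi> m \<in> test_functions" "test_converges \<Phi> \<phi>"
  have "test_converges (\<lambda>m. partial i (\<Phi> m)) (partial i \<phi>)"
    unfolding test_converges_def partials_snoc[symmetric] using t(3) by (simp add: test_converges_def)
  then show "(\<lambda>m. dist_deriv i g (\<Phi> m)) \<longlonglongrightarrow> dist_deriv i g \<phi>"
    unfolding dist_deriv_def
    by (intro tendsto_minus periodic_distributions_tendsto[OF g] test_functions_partial t)
qed

lemma fourier_sum: "fourier (\<lambda>\<phi>. \<Sum>i\<in>A. g i \<phi>) \<xi> = (\<Sum>i\<in>A. fourier (g i) \<xi>)"
  by (simp add: fourier_waves complex_eq_iff sum_negf)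

lemma fourier_cmult: "fourier (\<lambda>\<phi>. c * g \<phi>) \<xi> = of_real c * fourier g \<xi>"
  by (simp add: fourier_waves complex_eq_iff)

lemma fourier_diff: "fourier (\<lambda>\<phi>. g \<phi> - h \<phi>) \<xi> = fourier g \<xi> - fourier h \<xi>"
  by (simp add: fourier_waves complex_eq_iff)

lemma periodic_distributions_scale:
  assumes "g \<in> periodic_distributions" "\<phi> \<in> test_functions"
  shows "g (\<lambda>x. c * \<phi> x) = c * g \<phi>"
  using periodic_distributions_lincomb[OF assms assms(2), of c 0] by simp

lemma fourier_deriv:
  assumes g: "g \<in> periodic_distributions"
  shows "fourier (dist_deriv i g) \<xi> = 2 * of_real pi * \<i> * of_int (\<xi> $ i) * fourier g \<xi>"
  unfolding fourier_waves dist_deriv_def partial_cos_wave partial_sin_wave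
    periodic_distributions_scale[OF g waves_in_test_functions(1)]
    periodic_distributions_scale[OF g waves_in_test_functions(2)]
  by (simp add: complex_eq_iff)

lemma fourier_minus:
  assumes g: "g \<in> periodic_distributions"
  shows "fourier g (- \<xi>) = cnj (fourier g \<xi>)"
proof -
  have "cos_wave (- \<xi>) = cos_wave \<xi>" "sin_wave (- \<xi>) = (\<lambda>x. - 1 * sin_wave \<xi> x)"
    by (simp_all add: cos_wave_def sin_wave_def)
  then show ?thesis
    using periodic_distributions_scale[OF g waves_in_test_functions(2), of "- 1" \<xi>]
    by (simp add: fourier_waves complex_eq_iff)
qed

lemma fourier_0:
  assumes g: "g \<in> periodic_distributions"
  shows "fourier g 0 = of_real (g (\<lambda>x. 1))"
proof -
  have "cos_wave 0 = (\<lambda>x::real^'a. 1)" "sin_wave 0 = (\<lambda>x::real^'a. 0 * sin_wave 0 x)"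
    by (simp_all add: cos_wave_def sin_wave_def)
  then show ?thesis
    using periodic_distributions_scale[OF g waves_in_test_functions(2), of 0 0]
    by (simp add: fourier_waves complex_eq_iff)
qed

text \<open>The symmetry of the tensor in \<open>j\<close> and \<open>\<beta>\<close> makes the two
  halves of the strain contribute equally, so the symbol can be written with the full
  gradient.\<close>

lemma fourier_viscous:
  fixes a :: "('n::finite) tensor"
  assumes sym: "symmetric_tensor a" and w: "\<And>k. w $ k \<in> periodic_distributions"
  shows "fourier (viscous a w $ k) \<xi> = - viscous_symbol a \<xi> (\<chi> j. fourier (w $ j) \<xi>) $ k"
    and "viscous a w $ k \<in> periodic_distributions"
proof -
  define h where "h j = fourier (w $ j) \<xi>" for j
  define t where "t = (2 * of_real pi * \<i> :: complex)"
  define x where "x j = (of_int (\<xi> $ j) :: complex)" for j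
  \<comment> \<open>Written as a sum over a two-element index set, the strain falls under the rules
    for finite sums.\<close>
  have strain_eq: "strain w j \<beta> = (\<lambda>\<phi>. 1/2 * (\<Sum>b\<in>{True, False}. (if b then dist_deriv j (w $ \<beta>) else dist_deriv \<beta> (w $ j)) \<phi>))" for j \<beta>
    by (simp add: strain_def)
  have strain_pd: "strain w j \<beta> \<in> periodic_distributions" for j \<beta>
    unfolding strain_eq
    by (intro periodic_distributions_cmult periodic_distributions_sum) (simp add: periodic_distributions_deriv w)
  have strain_f: "fourier (strain w j \<beta>) \<xi> = t / 2 * (x j * h \<beta> + x \<beta> * h j)" for j \<beta>
    unfolding strain_eq fourier_cmult fourier_sum
    by (simp add: fourier_deriv w h_def t_def x_def algebra_simps)
  have inner_pd: "(\<lambda>\<psi>. \<Sum>j\<in>UNIV. \<Sum>\<beta>\<in>UNIV. a k j \<alpha> \<beta> * strain w j \<beta> \<psi>) \<in> periodic_distributions" for \<alpha>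
    by (intro periodic_distributions_sum periodic_distributions_cmult strain_pd)
  have visc: "viscous a w $ k = (\<lambda>\<phi>. \<Sum>\<alpha>\<in>UNIV. dist_deriv \<alpha> (\<lambda>\<psi>. \<Sum>j\<in>UNIV. \<Sum>\<beta>\<in>UNIV. a k j \<alpha> \<beta> * strain w j \<beta> \<psi>) \<phi>)"
    by (simp add: viscous_def)
  show "viscous a w $ k \<in> periodic_distributions"
    unfolding visc by (intro periodic_distributions_sum periodic_distributions_deriv inner_pd)
  have s2: "a k \<beta> \<alpha> j = a k j \<alpha> \<beta>" for j \<alpha> \<beta>
    using sym unfolding symmetric_tensor_def by metis
  define Y where "Y j \<alpha> \<beta> = of_real (a k j \<alpha> \<beta>) * x \<alpha> * x \<beta> * h j" for j \<alpha> \<beta>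
  have "fourier (viscous a w $ k) \<xi> =
     (\<Sum>\<alpha>\<in>UNIV. t * x \<alpha> * (\<Sum>j\<in>UNIV. \<Sum>\<beta>\<in>UNIV. of_real (a k j \<alpha> \<beta>) * (t / 2 * (x j * h \<beta> + x \<beta> * h j))))"
    unfolding visc fourier_sum fourier_deriv[OF inner_pd] fourier_cmult strain_f by (simp add: t_def x_def)
  also have "\<dots> = (\<Sum>\<alpha>\<in>UNIV. \<Sum>j\<in>UNIV. \<Sum>\<beta>\<in>UNIV. t\<^sup>2 / 2 * Y \<beta> \<alpha> j + t\<^sup>2 / 2 * Y j \<alpha> \<beta>)"
    unfolding sum_distrib_left
  proof (intro sum.cong refl)
    fix \<alpha> j \<beta>
    have "Y \<beta> \<alpha> j = of_real (a k j \<alpha> \<beta>) * x \<alpha> * x j * h \<beta>"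
      by (simp only: Y_def s2[of j \<alpha> \<beta>])
    moreover have "Y j \<alpha> \<beta> = of_real (a k j \<alpha> \<beta>) * x \<alpha> * x \<beta> * h j" by (simp only: Y_def)
    ultimately show "t * x \<alpha> * (of_real (a k j \<alpha> \<beta>) * (t / 2 * (x j * h \<beta> + x \<beta> * h j))) =
        t\<^sup>2 / 2 * Y \<beta> \<alpha> j + t\<^sup>2 / 2 * Y j \<alpha> \<beta>"
      by (simp only: power2_eq_square) (simp add: algebra_simps)
  qed
  also have "\<dots> = t\<^sup>2 / 2 * (\<Sum>\<alpha>\<in>UNIV. \<Sum>j\<in>UNIV. \<Sum>\<beta>\<in>UNIV. Y \<beta> \<alpha> j) + t\<^sup>2 / 2 * (\<Sum>\<alpha>\<in>UNIV. \<Sum>j\<in>UNIV. \<Sum>\<beta>\<in>UNIV. Y j \<alpha> \<beta>)"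
    by (simp only: sum.distrib sum_distrib_left)
  also have "(\<Sum>\<alpha>\<in>UNIV. \<Sum>j\<in>UNIV. \<Sum>\<beta>\<in>UNIV. Y \<beta> \<alpha> j) = (\<Sum>\<alpha>\<in>UNIV. \<Sum>j\<in>UNIV. \<Sum>\<beta>\<in>UNIV. Y j \<alpha> \<beta>)"
    by (rule sum.cong[OF refl], rule sum.swap)
  also have "(\<Sum>\<alpha>\<in>UNIV. \<Sum>j\<in>UNIV. \<Sum>\<beta>\<in>UNIV. Y j \<alpha> \<beta>) = (\<Sum>j\<in>UNIV. \<Sum>\<alpha>\<in>UNIV. \<Sum>\<beta>\<in>UNIV. Y j \<alpha> \<beta>)"
    by (rule sum.swap)
  also have "t\<^sup>2 / 2 * (\<Sum>j\<in>UNIV. \<Sum>\<alpha>\<in>UNIV. \<Sum>\<beta>\<in>UNIV. Y j \<alpha> \<beta>) + t\<^sup>2 / 2 * (\<Sum>j\<in>UNIV. \<Sum>\<alpha>\<in>UNIV. \<Sum>\<beta>\<in>UNIV. Y j \<alpha> \<beta>) =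
      t\<^sup>2 * (\<Sum>j\<in>UNIV. \<Sum>\<alpha>\<in>UNIV. \<Sum>\<beta>\<in>UNIV. Y j \<alpha> \<beta>)" by simp
  also have "t\<^sup>2 = - of_real (4 * pi\<^sup>2)" by (simp add: t_def power_mult_distrib)
  also have "- of_real (4 * pi\<^sup>2) * (\<Sum>j\<in>UNIV. \<Sum>\<alpha>\<in>UNIV. \<Sum>\<beta>\<in>UNIV. Y j \<alpha> \<beta>) = - viscous_symbol a \<xi> (\<chi> j. h j) $ k"
    unfolding viscous_symbol_def Y_def x_def vec_lambda_beta sum_distrib_right by (simp add: mult.assoc)
  finally show "fourier (viscous a w $ k) \<xi> = - viscous_symbol a \<xi> (\<chi> j. fourier (w $ j) \<xi>) $ k"
    by (simp add: h_def)
qed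

text \<open>The identity \<open>(u \<cdot> \<nabla>) u = div (u \<otimes> u)\<close> for solenoidal
  u, on coefficients: \<open>u (\<xi> - \<eta>)\<close> has the same product with \<eta> as with
  \<xi>, so the factor coming from the derivative can be pulled out of the sum. It connects the
  product of functions in the definition of a solution with the divergence form solved on the
  Fourier side.\<close>

lemma convolution_gradient_eq_full_advection:
  fixes u :: "int^'n::finite \<Rightarrow> complex^'n"
  assumes div: "\<And>\<xi>. cdot \<xi> (u \<xi>) = 0"
    and l2: "\<And>j. (\<lambda>\<eta>. (cmod (u \<eta> $ j))\<^sup>2) summable_on UNIV"
    and gl2: "\<And>j k. (\<lambda>\<eta>. (cmod (2 * of_real pi * \<i> * of_int (\<eta> $ j) * u \<eta> $ k))\<^sup>2) summable_on UNIV"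
  shows "(\<Sum>j\<in>UNIV. convolution (\<lambda>\<eta>. u \<eta> $ j) (\<lambda>\<eta>. 2 * of_real pi * \<i> * of_int (\<eta> $ j) * u \<eta> $ k) \<xi>) = full_advection u \<xi> $ k"
proof -
  define t where "t = (2 * of_real pi * \<i> :: complex)"
  have s1: "(\<lambda>\<eta>. u (\<xi> - \<eta>) $ j * (t * of_int (\<eta> $ j) * u \<eta> $ k)) summable_on UNIV" for j
    unfolding t_def by (rule abs_summable_summable[OF abs_summable_convolution[OF l2 gl2]])
  have s2: "(\<lambda>\<eta>. u (\<xi> - \<eta>) $ j * u \<eta> $ k) summable_on UNIV" for j
    by (rule abs_summable_summable[OF abs_summable_convolution[OF l2 l2]])
  have "(\<Sum>j\<in>UNIV. convolution (\<lambda>\<eta>. u \<eta> $ j) (\<lambda>\<eta>. t * of_int (\<eta> $ j) * u \<eta> $ k) \<xi>) =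
      (\<Sum>\<^sub>\<infinity>\<eta>. \<Sum>j\<in>UNIV. u (\<xi> - \<eta>) $ j * (t * of_int (\<eta> $ j) * u \<eta> $ k))"
    unfolding convolution_def
    by (intro infsumI[symmetric] has_sum_finite_sum has_sum_infsum s1) simp
  also have "\<dots> = (\<Sum>\<^sub>\<infinity>\<eta>. \<Sum>j\<in>UNIV. t * of_int (\<xi> $ j) * (u (\<xi> - \<eta>) $ j * u \<eta> $ k))"
  proof (rule infsum_cong)
    fix \<eta>
    have "cdot \<eta> (u (\<xi> - \<eta>)) = cdot \<xi> (u (\<xi> - \<eta>))"
      using div[of "\<xi> - \<eta>"] by (simp add: cdot_diff_left)
    then have "t * u \<eta> $ k * cdot \<eta> (u (\<xi> - \<eta>)) = t * u \<eta> $ k * cdot \<xi> (u (\<xi> - \<eta>))" by simp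
    then show "(\<Sum>j\<in>UNIV. u (\<xi> - \<eta>) $ j * (t * of_int (\<eta> $ j) * u \<eta> $ k)) =
        (\<Sum>j\<in>UNIV. t * of_int (\<xi> $ j) * (u (\<xi> - \<eta>) $ j * u \<eta> $ k))"
      unfolding cdot_def sum_distrib_left by (simp add: mult_ac)
  qed
  also have "\<dots> = (\<Sum>j\<in>UNIV. \<Sum>\<^sub>\<infinity>\<eta>. t * of_int (\<xi> $ j) * (u (\<xi> - \<eta>) $ j * u \<eta> $ k))"
    by (intro infsumI has_sum_finite_sum has_sum_infsum summable_on_cmult_right s2) simp
  also have "\<dots> = full_advection u \<xi> $ k"
    by (simp add: full_advection_def convolution_def infsum_cmult_right' t_def)
  finally show ?thesis by (simp add: t_def)
qed

section \<open>Assembly of velocity, pressure and convective term\<close>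

lemma rho_powr_2: "rho \<xi> powr 2 = (rho \<xi>)\<^sup>2"
  using powr_realpow[OF rho_pos, of \<xi> 2] by simp

lemma sobolev0_dist_of:
  fixes c :: "int^'n::finite \<Rightarrow> complex"
  assumes G: "L2_expansion G c" and c: "\<And>\<xi>. c (- \<xi>) = cnj (c \<xi>)" "(\<lambda>\<xi>. (cmod (c \<xi>))\<^sup>2) summable_on UNIV"
    and c0: "c 0 = 0" and s: "(\<lambda>\<xi>. rho \<xi> powr (2 * s) * (cmod (c \<xi>))\<^sup>2) summable_on UNIV"
  shows "dist_of G \<in> sobolev0 s"
proof -
  have pd: "dist_of G \<in> periodic_distributions"
    by (rule dist_of_periodic_distribution[OF L2_expansion_integrable[OF G]])
  have F: "fourier (dist_of G) = c" by (rule fourier_dist_of_expansion[OF G c])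
  have "dist_of G (\<lambda>x. 1) = 0" using fourier_0[OF pd] F c0 by (simp add: fun_eq_iff)
  then show ?thesis using pd s by (simp add: sobolev0_def sobolev_def F)
qed

theorem theorem4:
  fixes a :: "('n::finite) tensor" and f :: "'n dist ^ 'n"
  assumes "CARD('n) = 2 \<or> CARD('n) = 3"
    and "symmetric_tensor a"
    and "relaxed_elliptic a"
    and "f \<in> vsobolev0 (- 1)"
  shows "\<exists>u p. u \<in> vsobolev0_sigma 1 \<and> p \<in> sobolev0 0 \<and> navier_stokes_solution a f u p"
proof -
  have n: "CARD('n) < 4" using assms(1) by auto
  have f_pd: "f $ k \<in> periodic_distributions"
    and f_sum: "(\<lambda>\<xi>. rho \<xi> powr (2 * (- 1)) * (cmod (fourier (f $ k) \<xi>))\<^sup>2) summable_on UNIV"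
    and f_1: "(f $ k) (\<lambda>x. 1) = 0" for k
    using assms(4) by (auto simp: vsobolev0_def sobolev0_def sobolev_def)
  define fh where "fh \<xi> = (\<chi> k. fourier (f $ k) \<xi>)" for \<xi>
  have fh: "fh (- \<xi>) = vcnj (fh \<xi>)" "fh 0 = 0" for \<xi>
    by (simp_all add: fh_def vec_eq_iff fourier_minus[OF f_pd] fourier_0[OF f_pd] f_1)
  have "(\<lambda>\<xi>. (norm (fh \<xi>) / rho \<xi>)\<^sup>2) summable_on UNIV"
  proof -
    have "(norm (fh \<xi>) / rho \<xi>)\<^sup>2 = (\<Sum>k\<in>UNIV. rho \<xi> powr (2 * (- 1)) * (cmod (fourier (f $ k) \<xi>))\<^sup>2)" for \<xi>
    proof -
      have "rho \<xi> powr (2 * (- 1)) = 1 / (rho \<xi>)\<^sup>2" by (simp add: powr_minus rho_powr_2 inverse_eq_divide)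
      then show ?thesis
        by (simp add: norm_vec_def L2_set_def power_divide sum_nonneg fh_def sum_divide_distrib)
    qed
    then show ?thesis
      using has_sum_imp_summable[OF has_sum_finite_sum[OF finite has_sum_infsum[OF f_sum]]] by (simp only:)
  qed
  then obtain u p where u: "u 0 = 0" "\<And>\<xi>. cdot \<xi> (u \<xi>) = 0" "\<And>\<xi>. u (- \<xi>) = vcnj (u \<xi>)"
    and us: "(\<lambda>\<xi>. (rho \<xi> * norm (u \<xi>))\<^sup>2) summable_on UNIV"
    and p: "p 0 = 0" "\<And>\<xi>. p (- \<xi>) = cnj (p \<xi>)" "(\<lambda>\<xi>. (cmod (p \<xi>))\<^sup>2) summable_on UNIV"
    and eq: "\<And>\<xi> k. viscous_symbol a \<xi> (u \<xi>) $ k + full_advection u \<xi> $ k + 2 * of_real pi * \<i> * of_int (\<xi> $ k) * p \<xi> = fh \<xi> $ k"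
    by (rule fourier_solution[where f = fh, OF n assms(2,3) fh]) (rule that)
  \<comment> \<open>The coefficients of the derivative of the k-th component in direction j. They
    are square-summable because \<open>u\<close> is so with the weight \<open>rho\<close>.\<close>
  define gr where "gr j k \<eta> = 2 * of_real pi * \<i> * of_int (\<eta> $ j) * u \<eta> $ k" for j k \<eta>
  have uj: "(\<lambda>\<eta>. (rho \<eta> * cmod (u \<eta> $ j))\<^sup>2) summable_on UNIV" for j
    by (rule summable_square_mono[OF us]) (auto simp: abs_mult less_imp_le intro!: mult_left_mono norm_component_le)
  have ul2: "(\<lambda>\<eta>. (cmod (u \<eta> $ j))\<^sup>2) summable_on UNIV" for j
    by (rule summable_l2_of_weighted[OF uj])
  have grl2: "(\<lambda>\<eta>. (cmod (gr j k \<eta>))\<^sup>2) summable_on UNIV" for j k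
  proof (rule summable_square_mono[OF summable_square_cmult[OF uj[of k], of "2 * pi"]])
    fix \<eta> :: "int^'n"
    have "norm (lattice_vec \<eta>) \<le> rho \<eta>" by (rule power2_le_imp_le) (auto simp: rho_squared less_imp_le)
    then have "\<bar>real_of_int (\<eta> $ j)\<bar> \<le> rho \<eta>" using abs_component_le_norm_lattice_vec[of \<eta> j] by linarith
    then have "2 * pi * (\<bar>real_of_int (\<eta> $ j)\<bar> * cmod (u \<eta> $ k)) \<le> 2 * pi * (rho \<eta> * cmod (u \<eta> $ k))"
      by (intro mult_left_mono mult_right_mono) auto
    then show "\<bar>cmod (gr j k \<eta>)\<bar> \<le> 2 * pi * (rho \<eta> * cmod (u \<eta> $ k))"
      by (simp add: gr_def norm_mult)
  qed
  have u_cnj: "u (- \<xi>) $ j = cnj (u \<xi> $ j)" for \<xi> j by (simp add: u(3))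
  have gr_cnj: "gr j k (- \<xi>) = cnj (gr j k \<xi>)" for j k \<xi> by (simp add: gr_def u(3))
  have "\<exists>G. L2_expansion G (\<lambda>\<eta>. u \<eta> $ k)" for k
    by (rule Riesz_Fischer[OF _ ul2[of k]]) (auto simp: u_cnj)
  then obtain U where U: "\<And>k. L2_expansion (U k) (\<lambda>\<eta>. u \<eta> $ k)" by metis
  have "\<exists>G. L2_expansion G (gr j k)" for j k
    by (rule Riesz_Fischer[OF _ grl2[of j k]]) (auto simp: gr_cnj)
  then obtain W where W: "\<And>j k. L2_expansion (W j k) (gr j k)" by metis
  obtain P where P: "L2_expansion P p" by (rule Riesz_Fischer[OF p(2,3)])
  define uu where "uu = (\<chi> k. dist_of (U k))"
  define pp where "pp = dist_of P"
  \<comment> \<open>Both factors are square-integrable, so their product is integrable on the torus,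
    as \<open>is_product\<close> demands.\<close>
  define q where "q j k = dist_of (\<lambda>x. U j x * W j k x)" for j k
  define c where "c = (\<chi> k. (\<lambda>\<phi>. \<Sum>j\<in>UNIV. q j k \<phi>))"
  have uu_pd: "uu $ k \<in> periodic_distributions" for k
    unfolding uu_def vec_lambda_beta by (rule dist_of_periodic_distribution[OF L2_expansion_integrable[OF U]])
  have pp_pd: "pp \<in> periodic_distributions"
    unfolding pp_def by (rule dist_of_periodic_distribution[OF L2_expansion_integrable[OF P]])
  have q_pd: "q j k \<in> periodic_distributions" for j k
    unfolding q_def by (rule dist_of_periodic_distribution[OF L2_expansion_mult_integrable[OF U W]])
  have c_pd: "c $ k \<in> periodic_distributions" for k
    unfolding c_def vec_lambda_beta by (rule periodic_distributions_sum[OF q_pd])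
  have uu_f: "fourier (uu $ k) = (\<lambda>\<xi>. u \<xi> $ k)" for k
    unfolding uu_def vec_lambda_beta by (rule fourier_dist_of_expansion[OF U u_cnj ul2])
  have pp_f: "fourier pp = p" unfolding pp_def by (rule fourier_dist_of_expansion[OF P p(2,3)])
  have q_f: "fourier (q j k) = convolution (\<lambda>\<eta>. u \<eta> $ j) (gr j k)" for j k
    unfolding q_def by (rule fourier_dist_of_mult[OF U W u_cnj ul2 gr_cnj grl2])
  have c_f: "fourier (c $ k) \<xi> = full_advection u \<xi> $ k" for k \<xi>
    using convolution_gradient_eq_full_advection[where u = u and k = k and \<xi> = \<xi>, OF u(2) ul2 grl2[unfolded gr_def]]
    by (simp add: c_def fourier_sum q_f gr_def[abs_def])
  have "uu $ k \<in> sobolev0 1" for k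
    unfolding uu_def vec_lambda_beta
  proof (rule sobolev0_dist_of[OF U u_cnj ul2])
    have "rho \<xi> powr (2 * 1) * (cmod (u \<xi> $ k))\<^sup>2 = (rho \<xi> * cmod (u \<xi> $ k))\<^sup>2" for \<xi>
      by (simp add: power_mult_distrib rho_powr_2)
    then show "(\<lambda>\<xi>. rho \<xi> powr (2 * 1) * (cmod (u \<xi> $ k))\<^sup>2) summable_on UNIV" using uj[of k] by (simp only:)
  qed (simp add: u(1))
  moreover have "divergence uu \<doteq> (\<lambda>\<phi>. 0)"
  proof (rule dist_eq_if_fourier_eq)
    show "divergence uu \<in> periodic_distributions"
      unfolding divergence_def by (intro periodic_distributions_sum periodic_distributions_deriv uu_pd)
    show "(\<lambda>\<phi>. 0) \<in> (periodic_distributions :: 'n dist set)"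
      by (rule periodic_distributionsI) auto
    fix \<xi> :: "int^'n"
    have "fourier (divergence uu) \<xi> = 2 * of_real pi * \<i> * cdot \<xi> (u \<xi>)"
      unfolding divergence_def fourier_sum fourier_deriv[OF uu_pd] uu_f cdot_def
      by (simp add: sum_distrib_left mult.assoc)
    then show "fourier (divergence uu) \<xi> = fourier (\<lambda>\<phi>. 0) \<xi>"
      by (simp add: u(2) fourier_waves complex_eq_iff)
  qed
  ultimately have "uu \<in> vsobolev0_sigma 1" by (simp add: vsobolev0_sigma_def vsobolev0_def)
  moreover have "pp \<in> sobolev0 0"
    unfolding pp_def by (rule sobolev0_dist_of[OF P p(2,3,1)]) (simp add: p(3) less_imp_neq[OF rho_pos, symmetric])
  moreover have "is_convection uu c"
    unfolding is_convection_def
  proof (intro exI conjI allI)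
    show "is_product (uu $ j) (dist_deriv j (uu $ k)) (q j k)" for j k
      unfolding is_product_def
    proof (intro exI conjI)
      show "represents (U j) (uu $ j)"
        by (rule represents_dist_of[OF L2_expansion_integrable[OF U]]) (simp add: uu_def dist_eq_def)
      \<comment> \<open>\<open>W j k\<close> was built from coefficients alone; comparing Fourier
        coefficients identifies it with the weak derivative.\<close>
      have "dist_deriv j (uu $ k) \<doteq> dist_of (W j k)"
      proof (rule dist_eq_if_fourier_eq)
        show "dist_deriv j (uu $ k) \<in> periodic_distributions" by (intro periodic_distributions_deriv uu_pd)
        show "dist_of (W j k) \<in> periodic_distributions"
          by (rule dist_of_periodic_distribution[OF L2_expansion_integrable[OF W]])
        show "fourier (dist_deriv j (uu $ k)) \<xi> = fourier (dist_of (W j k)) \<xi>" for \<xi>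
          unfolding fourier_dist_of_expansion[OF W gr_cnj grl2] fourier_deriv[OF uu_pd] uu_f gr_def ..
      qed
      then show "represents (W j k) (dist_deriv j (uu $ k))"
        by (rule represents_dist_of[OF L2_expansion_integrable[OF W]])
      show "represents (\<lambda>x. U j x * W j k x) (q j k)"
        by (rule represents_dist_of[OF L2_expansion_mult_integrable[OF U W]]) (simp add: q_def dist_eq_def)
    qed
    show "c $ k \<doteq> (\<lambda>\<phi>. \<Sum>j\<in>UNIV. q j k \<phi>)" for k by (simp add: c_def dist_eq_def)
  qed
  moreover have "(\<lambda>\<phi>. - (stokes a uu pp $ k) \<phi>) \<doteq> (\<lambda>\<phi>. (f $ k) \<phi> - (c $ k) \<phi>)" for k
  proof (rule dist_eq_if_fourier_eq)
    note visc = fourier_viscous[where w = uu, OF assms(2) uu_pd]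
    have st: "(\<lambda>\<phi>. - (stokes a uu pp $ k) \<phi>) = (\<lambda>\<phi>. dist_deriv k pp \<phi> - (viscous a uu $ k) \<phi>)"
      by (simp add: stokes_def)
    show "(\<lambda>\<phi>. - (stokes a uu pp $ k) \<phi>) \<in> periodic_distributions"
      unfolding st by (intro periodic_distributions_diff periodic_distributions_deriv pp_pd visc(2))
    show "(\<lambda>\<phi>. (f $ k) \<phi> - (c $ k) \<phi>) \<in> periodic_distributions"
      by (intro periodic_distributions_diff f_pd c_pd)
    fix \<xi>
    have "(\<chi> j. fourier (uu $ j) \<xi>) = u \<xi>" by (simp add: uu_f vec_eq_iff)
    then have "fourier (\<lambda>\<phi>. - (stokes a uu pp $ k) \<phi>) \<xi> =
        2 * of_real pi * \<i> * of_int (\<xi> $ k) * p \<xi> + viscous_symbol a \<xi> (u \<xi>) $ k"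
      unfolding st fourier_diff fourier_deriv[OF pp_pd] pp_f visc(1) by simp
    also have "\<dots> = fh \<xi> $ k - full_advection u \<xi> $ k"
      using eq[of \<xi> k] by (simp add: algebra_simps)
    also have "\<dots> = fourier (\<lambda>\<phi>. (f $ k) \<phi> - (c $ k) \<phi>) \<xi>"
      by (simp add: fourier_diff c_f fh_def)
    finally show "fourier (\<lambda>\<phi>. - (stokes a uu pp $ k) \<phi>) \<xi> = fourier (\<lambda>\<phi>. (f $ k) \<phi> - (c $ k) \<phi>) \<xi>" .
  qed
  ultimately show ?thesis unfolding navier_stokes_solution_def by blast
qed

end
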